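(* Let $d\ge2$ and let $\Omega=B_1$ be the unit ball in $\mathbb{R}^d$. Assume that $V:B_1\to[0,\infty)$ satisfies $V\in L^\infty(B_1)$ and ${\rm supp}\,V=\overline{B_c}$ for some $c\in(0,1)$. Suppose moreover that for any $\delta\in(0,c)$ we have ${\rm ess\,inf}_{x\in B_\delta}V(x)>0$. Then $$\lim_{\lambda\downarrow0}|\ln\lambda|^{-d+1}\,n_+(\lambda;T_V)=\frac{2^{-d+2}}{(d-1)!\,|\ln c|^{d-1}}.$$
   Context: $B_R=\{x\in\mathbb{R}^d:|x|<R\}$. $\mathcal{H}(\Omega)=\{u\in L^2(\Omega):\Delta u=0\text{ in }\Omega\}$, $P$ is the orthogonal projection of $L^2(\Omega)$ onto $\mathcal{H}(\Omega)$, and $T_V=PV:\mathcal{H}(\Omega)\to\mathcal{H}(\Omega)$, $T_Vu=P(Vu)$ (compact and self-adjoint here). For a compact self-adjoint operator $T$ and $s>0$, $n_+(s;T)$ is the number of eigenvalues of $T$ larger than $s$, counted with multiplicities. *)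

theory Defs
  imports
    "HOL-Analysis.Analysis"
    "HOL-Probability.Essential_Supremum"
    "HOL-Library.Function_Algebras"
begin

definition L2 :: "'a::euclidean_space set \<Rightarrow> ('a \<Rightarrow> complex) set" where
  "L2 \<Omega> = {f \<in> borel_measurable (lebesgue_on \<Omega>). integrable (lebesgue_on \<Omega>) (\<lambda>x. (cmod (f x))\<^sup>2)}"

definition L2_inner :: "'a::euclidean_space set \<Rightarrow> ('a \<Rightarrow> complex) \<Rightarrow> ('a \<Rightarrow> complex) \<Rightarrow> complex" where
  "L2_inner \<Omega> f g = (LINT x|lebesgue_on \<Omega>. f x * cnj (g x))"

definition partial_deriv :: "'a::euclidean_space \<Rightarrow> ('a \<Rightarrow> complex) \<Rightarrow> 'a \<Rightarrow> complex" where
  "partial_deriv b u x = frechet_derivative u (at x) b"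

definition C2_on :: "'a::euclidean_space set \<Rightarrow> ('a \<Rightarrow> complex) \<Rightarrow> bool" where
  "C2_on \<Omega> u \<longleftrightarrow>
     (\<forall>x\<in>\<Omega>. u differentiable (at x)) \<and>
     (\<forall>b\<in>Basis. \<forall>x\<in>\<Omega>. partial_deriv b u differentiable (at x)) \<and>
     (\<forall>b\<in>Basis. \<forall>b'\<in>Basis. continuous_on \<Omega> (partial_deriv b' (partial_deriv b u)))"

definition laplacian :: "('a::euclidean_space \<Rightarrow> complex) \<Rightarrow> 'a \<Rightarrow> complex" where
  "laplacian u x = (\<Sum>b\<in>Basis. partial_deriv b (partial_deriv b u) x)"

definition harmonic_on :: "'a::euclidean_space set \<Rightarrow> ('a \<Rightarrow> complex) \<Rightarrow> bool" where
  "harmonic_on \<Omega> u \<longleftrightarrow> C2_on \<Omega> u \<and> (\<forall>x\<in>\<Omega>. laplacian u x = 0)"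

text \<open>Elements are represented by functions rather than by classes modulo null sets: for open
  \<open>\<Omega>\<close> a class contains at most one function that is harmonic on \<open>\<Omega>\<close>, and the condition
  \<open>u x = 0\<close> off \<open>\<Omega>\<close> fixes the irrelevant values. Two members therefore represent the same
  element of \<open>L\<^sup>2(\<Omega>)\<close> iff they are equal.\<close>

definition harmonic_L2 :: "'a::euclidean_space set \<Rightarrow> ('a \<Rightarrow> complex) set" where
  "harmonic_L2 \<Omega> = {u \<in> L2 \<Omega>. harmonic_on \<Omega> u \<and> (\<forall>x. x \<notin> \<Omega> \<longrightarrow> u x = 0)}"

text \<open>The orthogonal projection of \<open>f \<in> L\<^sup>2(\<Omega>)\<close> is the unique \<open>h\<close> in the closed subspace
  such that \<open>f - h\<close> is orthogonal to that subspace.\<close>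

definition harmonic_proj :: "'a::euclidean_space set \<Rightarrow> ('a \<Rightarrow> complex) \<Rightarrow> ('a \<Rightarrow> complex)" where
  "harmonic_proj \<Omega> f =
     (THE h. h \<in> harmonic_L2 \<Omega> \<and> (\<forall>g\<in>harmonic_L2 \<Omega>. L2_inner \<Omega> (\<lambda>x. f x - h x) g = 0))"

definition toeplitz :: "'a::euclidean_space set \<Rightarrow> ('a \<Rightarrow> real) \<Rightarrow> ('a \<Rightarrow> complex) \<Rightarrow> ('a \<Rightarrow> complex)" where
  "toeplitz \<Omega> V u = harmonic_proj \<Omega> (\<lambda>x. of_real (V x) * u x)"

interpretation cfun: vector_space "\<lambda>(c::complex) (f::'a \<Rightarrow> complex) x. c * f x"
  by unfold_locales (auto simp: fun_eq_iff algebra_simps)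

definition eigenspace ::
  "('a \<Rightarrow> complex) set \<Rightarrow> (('a \<Rightarrow> complex) \<Rightarrow> ('a \<Rightarrow> complex)) \<Rightarrow> real \<Rightarrow> ('a \<Rightarrow> complex) set" where
  "eigenspace H T \<mu> = {u \<in> H. T u = (\<lambda>x. of_real \<mu> * u x)}"

definition eigenvalues ::
  "('a \<Rightarrow> complex) set \<Rightarrow> (('a \<Rightarrow> complex) \<Rightarrow> ('a \<Rightarrow> complex)) \<Rightarrow> real set" where
  "eigenvalues H T = {\<mu>. \<exists>u\<in>eigenspace H T \<mu>. u \<noteq> (\<lambda>_. 0)}"

text \<open>Meant for a compact self-adjoint operator \<open>T\<close> on \<open>H\<close> and \<open>s > 0\<close>. Then all eigenvalues
  are real, those above \<open>s\<close> are finite in number, and their eigenspaces have finite (complex)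
  dimension, so neither \<open>sum\<close> nor \<open>dim\<close> takes its default value \<open>0\<close>.\<close>

definition n_plus ::
  "real \<Rightarrow> ('a \<Rightarrow> complex) set \<Rightarrow> (('a \<Rightarrow> complex) \<Rightarrow> ('a \<Rightarrow> complex)) \<Rightarrow> nat" where
  "n_plus s H T = (\<Sum>\<mu>\<in>{\<mu> \<in> eigenvalues H T. s < \<mu>}. cfun.dim (eigenspace H T \<mu>))"

text \<open>Since \<open>esssup\<close> is \<open>\<infinity>\<close> on non-measurable functions, \<open>ess_inf\<close> is \<open>-\<infinity>\<close> there.\<close>

definition ess_inf :: "'a::euclidean_space set \<Rightarrow> ('a \<Rightarrow> real) \<Rightarrow> ereal" where
  "ess_inf A f = - esssup (lebesgue_on A) (\<lambda>x. - ereal (f x))"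

definition L_infinity :: "'a::euclidean_space set \<Rightarrow> ('a \<Rightarrow> real) set" where
  "L_infinity \<Omega> =
     {f \<in> borel_measurable (lebesgue_on \<Omega>). esssup (lebesgue_on \<Omega>) (\<lambda>x. ereal \<bar>f x\<bar>) < \<infinity>}"

text \<open>The support of a class modulo null sets: the complement in \<open>\<Omega>\<close> of the largest open set
  on which \<open>f\<close> vanishes almost everywhere.\<close>

definition ess_support :: "'a::euclidean_space set \<Rightarrow> ('a \<Rightarrow> real) \<Rightarrow> 'a set" where
  "ess_support \<Omega> f = \<Omega> - \<Union>{U. open U \<and> (AE x in lebesgue_on \<Omega>. x \<in> U \<longrightarrow> f x = 0)}"

end

theory Submission
  imports Defs "HOL-Complex_Analysis.Great_Picard" "HOL-Real_Asymp.Real_Asymp"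
begin

text \<open>
  For \<open>V = M\<close> on a ball of radius \<open>r\<close> the operator is diagonal in spherical harmonics, with
  eigenvalue \<open>M r^(2k+d)\<close> on degree \<open>k\<close>; in general \<open>V\<close> is squeezed between such potentials and the
  min-max principle applies. Instead of expanding in spherical harmonics, everything is read off
  from one identity: for harmonic \<open>u\<close>, \<open>v\<close> and a radial weight \<open>\<phi>\<close>, Green's formula shows that
  \<open>\<integral> \<phi>(x) u(r x) v(s x) dx\<close> depends only on the product \<open>r s\<close>.

  With \<open>v = 1\<close> this is the mean value property, hence interior regularity, closedness and local
  compactness. With \<open>v = cnj u\<close> the Cauchy-Schwarz inequality makes the weighted mean
  \<open>m(r) = \<integral> \<phi>(x) |u(r x)|^2 dx\<close> logarithmically convex in \<open>ln r\<close>. Consequently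
  \<open>m(r) \<le> (r / \<rho>)^(2k) m(\<rho>)\<close> for \<open>r < \<rho>\<close> if \<open>u\<close> vanishes to order \<open>k\<close> at the origin, and
  \<open>m(\<rho>) \<le> (\<rho> / r)^(2k) m(r)\<close> if \<open>u\<close> grows at most like \<open>|x|^k\<close> at infinity.

  Upper bound: vanishing to order \<open>K + 1\<close> is imposed by the derivatives at \<open>0\<close> of order at most \<open>K\<close> with
  at most one derivative in a fixed direction, asymptotically \<open>2 K^(d-1) / (d-1)!\<close> linear conditions.
  Lower bound: the harmonic polynomials of degree at most \<open>K\<close> form the kernel of the Laplacian from
  degree \<open>\<le> K\<close> to degree \<open>\<le> K - 2\<close>, so they have at least that dimension.
\<close>

section \<open>Linear algebra and counting\<close>

text \<open>The pairing depends on \<open>r * s\<close> only because homogeneous harmonics of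
  different degrees are orthogonal; the proof uses that its derivative along
  \<open>r = exp t\<close>, \<open>s = exp (-t)\<close> is the integral of a divergence. A
  polynomial weight of compact support replaces surface integrals.

  The constant: \<open>c^(2k)\<close> drops below \<lambda> at k = |ln \<lambda>| / (2 |ln c|), and
  \<open>2 k^(d-1) / (d-1)!\<close> at this k is the main term. Both growth estimates lose
  arbitrarily little in the base, so every slope on the proper side of 1 / (2 |ln c|) is reached.

  The obstacle is \<open>n_plus\<close> itself: \<open>sum\<close> and \<open>dim\<close> have
  default values on infinite data. Finiteness is proved along with the upper bound: finitely many
  functionals whose common kernel has small Rayleigh quotients limit the number of independent
  eigenfunctions. For the lower bound, if too few eigenvalues lay above s, a maximiser of the
  Rayleigh quotient orthogonal to their eigenfunctions would be a further eigenfunction. All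
  dimension counts reduce to homogeneous systems with fewer equations than unknowns.\<close>

lemma homogeneous_system_nontrivial:
  fixes A :: "'j \<Rightarrow> 'i \<Rightarrow> complex"
  assumes "finite J" "finite I" "card J < card I"
  obtains c where "\<exists>i\<in>I. c i \<noteq> 0" "\<And>j. j \<in> J \<Longrightarrow> (\<Sum>i\<in>I. A j i * c i) = 0"
proof -
  have "\<exists>c. (\<exists>i\<in>I. c i \<noteq> 0) \<and> (\<forall>j\<in>J. (\<Sum>i\<in>I. A j i * c i) = 0)"
    using assms
  proof (induction J arbitrary: I A rule: finite_induct)
    case empty
    then have "I \<noteq> {}" by auto
    then show ?case by (intro exI[of _ "\<lambda>_. 1"]) auto
  next
    case (insert j J)
    show ?case
    proof (cases "\<forall>i\<in>I. A j i = 0")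
      case True
      from insert.IH[of I A] insert.prems insert.hyps
      obtain c where "\<exists>i\<in>I. c i \<noteq> 0" "\<forall>j\<in>J. (\<Sum>i\<in>I. A j i * c i) = 0"
        by (auto simp: card_insert_if)
      with True show ?thesis by (intro exI[of _ c]) auto
    next
      case False
      then obtain i0 where i0: "i0 \<in> I" "A j i0 \<noteq> 0" by auto
      \<comment> \<open>Gaussian elimination with pivot \<open>A j i0\<close>: the other equations
        lose the unknown \<open>i0\<close>, so one equation and one unknown disappear. Afterwards
        \<open>c0\<close> solves the pivot equation for \<open>i0\<close>.\<close>
      define A' where "A' = (\<lambda>k i. A k i - A k i0 * A j i / A j i0)"
      have "card J < card (I - {i0})"
        using insert.prems insert.hyps i0 by (simp add: card_insert_if)
      from insert.IH[OF _ this, of A'] insert.prems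
      obtain c where c: "\<exists>i\<in>I - {i0}. c i \<noteq> 0"
        "\<And>k. k \<in> J \<Longrightarrow> (\<Sum>i\<in>I - {i0}. A' k i * c i) = 0"
        by auto
      define c0 where "c0 = - (\<Sum>i\<in>I - {i0}. A j i * c i) / A j i0"
      define c' where "c' = c(i0 := c0)"
      have split: "(\<Sum>i\<in>I. A k i * c' i) = A k i0 * c0 + (\<Sum>i\<in>I - {i0}. A k i * c i)" for k
      proof -
        have "(\<Sum>i\<in>I. A k i * c' i) = A k i0 * c' i0 + (\<Sum>i\<in>I - {i0}. A k i * c' i)"
          using i0 insert.prems by (simp add: sum.remove)
        also have "(\<Sum>i\<in>I - {i0}. A k i * c' i) = (\<Sum>i\<in>I - {i0}. A k i * c i)"
          by (intro sum.cong) (auto simp: c'_def)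
        finally show ?thesis by (simp add: c'_def)
      qed
      have 1: "(\<Sum>i\<in>I. A j i * c' i) = 0"
        unfolding split using i0 by (simp add: c0_def)
      have 2: "(\<Sum>i\<in>I. A k i * c' i) = 0" if "k \<in> J" for k
      proof -
        have "0 = (\<Sum>i\<in>I - {i0}. A k i * c i) - (\<Sum>i\<in>I - {i0}. A k i0 / A j i0 * (A j i * c i))"
          using c(2)[OF that] by (simp add: A'_def algebra_simps sum_subtractf)
        also have "(\<Sum>i\<in>I - {i0}. A k i0 / A j i0 * (A j i * c i)) = - A k i0 * c0"
          by (simp add: c0_def sum_distrib_left sum_divide_distrib)
        finally show ?thesis unfolding split by (simp add: add.commute)
      qed
      have 3: "\<exists>i\<in>I. c' i \<noteq> 0" using c(1) by (auto simp: c'_def)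
      show ?thesis using 1 2 3 by blast
    qed
  qed
  with that show ?thesis by blast
qed

text \<open>With \<open>B\<close> the coordinate directions these multisets index both the monomials
  of degree at most \<open>K\<close> and the partial derivatives of order at most \<open>K\<close>
  up to reordering.\<close>

definition msets_upto :: "'a set \<Rightarrow> nat \<Rightarrow> 'a multiset set" where
  "msets_upto B K = {M. set_mset M \<subseteq> B \<and> size M \<le> K}"

text \<open>Pascal's rule for multisets: either \<open>b\<close> does not occur, or one copy of it
  can be removed.\<close>

lemma msets_upto_insert_Suc:
  assumes "b \<notin> B"
  shows "msets_upto (insert b B) (Suc K) =
    msets_upto B (Suc K) \<union> add_mset b ` msets_upto (insert b B) K" (is "?L = ?R")
proof
  show "?L \<subseteq> ?R"
  proof
    fix M assume M: "M \<in> ?L"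
    show "M \<in> ?R"
    proof (cases "b \<in># M")
      case True
      then obtain N where "M = add_mset b N" by (auto dest: multi_member_split)
      with M show ?thesis by (auto simp: msets_upto_def)
    next
      case False
      with M show ?thesis by (auto simp: msets_upto_def)
    qed
  qed
qed (auto simp: msets_upto_def)

lemma msets_upto_0: "msets_upto B 0 = {{#}}"
  by (auto simp: msets_upto_def)

lemma card_msets_upto:
  assumes "finite B"
  shows "finite (msets_upto B K) \<and> card (msets_upto B K) = (K + card B) choose card B"
  using assms
proof (induction B arbitrary: K rule: finite_induct)
  case empty
  have "{M :: 'a multiset. set_mset M \<subseteq> {} \<and> size M \<le> K} = {{#}}" by auto
  then show ?case by (simp add: msets_upto_def)
next
  case (insert b B)
  show ?case
  proof (induction K)
    case 0
    then show ?case using insert.hyps by (simp add: msets_upto_0)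
  next
    case (Suc K)
    have disj: "msets_upto B (Suc K) \<inter> add_mset b ` msets_upto (insert b B) K = {}"
      using insert.hyps by (auto simp: msets_upto_def)
    have "card (msets_upto (insert b B) (Suc K)) =
        card (msets_upto B (Suc K)) + card (msets_upto (insert b B) K)"
      unfolding msets_upto_insert_Suc[OF insert.hyps(2)]
      using insert.IH Suc disj
      by (subst card_Un_disjoint) (auto simp: card_image inj_on_def)
    also have "\<dots> = (Suc K + card (insert b B)) choose card (insert b B)"
      using insert.IH Suc insert.hyps by (simp add: add_ac)
    finally show ?case
      using insert.IH Suc by (simp add: msets_upto_insert_Suc[OF insert.hyps(2)])
  qed
qed

lemmas finite_msets_upto = card_msets_upto[THEN conjunct1]

text \<open>Log-convexity makes the ratios \<open>t (Suc n) / t n\<close> nondecreasing. If the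
  first ratio \<open>p\<close> exceeded \<open>q\<close>, then \<open>t n\<close> would be at least
  \<open>t 0 * p ^ n\<close>, which no multiple of \<open>q ^ n\<close> can dominate. The constant
  \<open>C\<close> leaves no trace in the conclusion; this is how a crude growth bound becomes a
  sharp one.\<close>

lemma geometric_growth_bound:
  fixes t :: "nat \<Rightarrow> real"
  assumes nonneg: "\<And>n. 0 \<le> t n" and lc: "\<And>n. (t (Suc n))\<^sup>2 \<le> t n * t (Suc (Suc n))"
    and bound: "\<And>n. t n \<le> C * q ^ n" and "0 < q"
  shows "t 1 \<le> q * t 0"
proof (rule ccontr)
  assume neg: "\<not> t 1 \<le> q * t 0"
  then have less: "q * t 0 < t 1" by simp
  have t0: "0 < t 0"
  proof (rule ccontr)
    assume "\<not> 0 < t 0"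
    then have "t 0 = 0" using nonneg[of 0] by simp
    then have "t 1 = 0" using lc[of 0] by simp
    with less \<open>t 0 = 0\<close> show False by simp
  qed
  define p where "p = t 1 / t 0"
  have p: "q < p" using less t0 by (simp add: p_def field_simps)
  \<comment> \<open>Positivity is carried through the induction because the next ratio is obtained
    by cancelling \<open>t n\<close>.\<close>
  have step: "0 < t n \<and> p * t n \<le> t (Suc n)" for n
  proof (induction n)
    case 0 then show ?case using t0 by (simp add: p_def)
  next
    case (Suc n)
    have pos: "0 < t (Suc n)" using Suc p \<open>0 < q\<close> by (smt (verit) mult_pos_pos)
    have "p * t n * t (Suc n) \<le> t (Suc n) * t (Suc n)"
      using Suc pos by (intro mult_right_mono) auto
    also have "\<dots> \<le> t n * t (Suc (Suc n))" using lc[of n] by (simp add: power2_eq_square)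
    finally have "t n * (p * t (Suc n)) \<le> t n * t (Suc (Suc n))" by (simp add: algebra_simps)
    then show ?case using Suc pos by (simp add: mult_le_cancel_left)
  qed
  have "t 0 * p ^ n \<le> t n" for n
  proof (induction n)
    case (Suc n)
    have "t 0 * p ^ Suc n = p * (t 0 * p ^ n)" by simp
    also have "\<dots> \<le> p * t n" using Suc p \<open>0 < q\<close> by (intro mult_left_mono) auto
    also have "\<dots> \<le> t (Suc n)" using step by blast
    finally show ?case .
  qed simp
  then have "t 0 * p ^ n \<le> C * q ^ n" for n using bound order_trans by blast
  then have le: "(p / q) ^ n \<le> C / t 0" for n
    using t0 \<open>0 < q\<close> by (simp add: power_divide field_simps)
  have "1 < p / q" using p \<open>0 < q\<close> by simp
  then obtain n where "C / t 0 < (p / q) ^ n" using real_arch_pow by blast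
  with le[of n] show False by simp
qed

section \<open>Differentiation under the integral sign and bump functions\<close>

text \<open>Differentiability in sequential form, the form that dominated convergence can
  use.\<close>

lemma has_derivative_seq_quotient:
  assumes "(f has_derivative f') (at p)" and "X \<longlonglongrightarrow> p" and "\<And>n::nat. X n \<noteq> p"
  shows "(\<lambda>n. (1 / norm (X n - p)) *\<^sub>R (f (X n) - (f p + f' (X n - p)))) \<longlonglongrightarrow> 0"
proof -
  have "((\<lambda>y. (1 / norm (y - p)) *\<^sub>R (f y - (f p + f' (y - p)))) \<longlongrightarrow> 0) (at p)"
    using assms(1) unfolding has_derivative_within by simp
  then show ?thesis
    using assms(2,3) unfolding tendsto_at_iff_sequentially by (auto simp: o_def)
qed

text \<open>Measurability of the derivative is derived rather than assumed: it is a pointwise limit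
  of difference quotients. The mean value inequality turns the bound on the derivative into the
  majorant \<open>2 * w\<close> for the remainder quotients. The parameter space is general since it
  is the real line for dilations and translations along a vector, and the whole space for
  convolutions.\<close>

lemma has_derivative_dominated_integral:
  fixes g :: "'p::real_normed_vector \<Rightarrow> 'x \<Rightarrow> complex"
  assumes e: "0 < e"
    and int: "\<And>p. p \<in> ball p0 e \<Longrightarrow> integrable M (g p)"
    and der: "\<And>p x. p \<in> ball p0 e \<Longrightarrow> x \<in> space M \<Longrightarrow>
        ((\<lambda>p. g p x) has_derivative g' p x) (at p)"
    and dom: "\<And>p x h. p \<in> ball p0 e \<Longrightarrow> x \<in> space M \<Longrightarrow> norm (g' p x h) \<le> w x * norm h"
    and w: "integrable M w"
  shows "\<And>h. integrable M (\<lambda>x. g' p0 x h)"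
    and "((\<lambda>p. \<integral>x. g p x \<partial>M) has_derivative (\<lambda>h. \<integral>x. g' p0 x h \<partial>M)) (at p0)"
proof -
  have p0: "p0 \<in> ball p0 e" using e by simp
  have w0: "0 \<le> w x * norm h" if x: "x \<in> space M" for x and h :: 'p
    using dom[OF p0 x, of h] norm_ge_zero order_trans by blast
  have lin: "linear (g' p0 x)" if "x \<in> space M" for x
    using der[OF p0 that] has_derivative_linear by blast
  have meas: "(\<lambda>x. g' p0 x h) \<in> borel_measurable M" for h
  proof (cases "h = 0")
    case True
    have "g' p0 x h = 0" if "x \<in> space M" for x
      using linear_0[OF lin[OF that]] True by simp
    then show ?thesis by (subst measurable_cong[of _ _ "\<lambda>_. 0"]) auto
  next
    case False
    \<comment> \<open>This length keeps all increments \<open>s n *\<^sub>R h\<close> within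
      distance \<open>e / 2\<close> of \<open>p0\<close>.\<close>
    define t where "t = e / (2 * norm h)"
    have t: "0 < t" using e False by (simp add: t_def)
    define s where "s = (\<lambda>n::nat. t * inverse (real (Suc n)))"
    have s_pos: "0 < s n" for n using t by (simp add: s_def)
    have s_le: "s n \<le> t" for n using t by (simp add: s_def field_simps)
    have s_lim: "s \<longlonglongrightarrow> 0" unfolding s_def
      using tendsto_mult_right_zero[OF LIMSEQ_inverse_real_of_nat] by simp
    define X where "X = (\<lambda>n. p0 + s n *\<^sub>R h)"
    have X: "X \<longlonglongrightarrow> p0" unfolding X_def by (rule tendsto_eq_intros s_lim | simp)+
    have Xne: "X n \<noteq> p0" for n using False s_pos[of n] by (simp add: X_def)
    have Xball: "X n \<in> ball p0 e" for n
    proof -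
      have "s n * norm h \<le> t * norm h" using s_le by (intro mult_right_mono) auto
      also have "\<dots> < e" using False e by (simp add: t_def)
      finally show ?thesis using s_pos[of n] by (simp add: X_def dist_norm)
    qed
    show ?thesis
    proof (rule borel_measurable_LIMSEQ_metric)
      show "(\<lambda>x. (1 / s n) *\<^sub>R (g (X n) x - g p0 x)) \<in> borel_measurable M" for n
        using int[OF Xball[of n]] int[OF p0] by measurable
    next
      fix x assume x: "x \<in> space M"
      have "(\<lambda>n. (1 / norm (X n - p0)) *\<^sub>R (g (X n) x - (g p0 x + g' p0 x (X n - p0)))) \<longlonglongrightarrow> 0"
        by (rule has_derivative_seq_quotient[OF der[OF p0 x] X Xne])
      then have "(\<lambda>n. norm h *\<^sub>R ((1 / norm (X n - p0)) *\<^sub>R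
           (g (X n) x - (g p0 x + g' p0 x (X n - p0)))) + g' p0 x h) \<longlonglongrightarrow> norm h *\<^sub>R 0 + g' p0 x h"
        by (intro tendsto_intros)
      moreover have "norm h *\<^sub>R ((1 / norm (X n - p0)) *\<^sub>R
           (g (X n) x - (g p0 x + g' p0 x (X n - p0)))) + g' p0 x h
         = (1 / s n) *\<^sub>R (g (X n) x - g p0 x)" for n
        using s_pos[of n] False lin[OF x]
        by (simp add: X_def linear_scale algebra_simps)
      ultimately show "(\<lambda>n. (1 / s n) *\<^sub>R (g (X n) x - g p0 x)) \<longlonglongrightarrow> g' p0 x h" by simp
    qed
  qed
  show int': "integrable M (\<lambda>x. g' p0 x h)" for h
    by (rule Bochner_Integration.integrable_bound[OF integrable_mult_left[OF w, of "norm h"] meas])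
      (auto intro!: AE_I2 order_trans[OF dom[OF p0] abs_ge_self])
  have blin: "bounded_linear (\<lambda>h. \<integral>x. g' p0 x h \<partial>M)"
  proof (rule bounded_linear_intro)
    show "(\<integral>x. g' p0 x (a + b) \<partial>M) = (\<integral>x. g' p0 x a \<partial>M) + (\<integral>x. g' p0 x b \<partial>M)" for a b
      by (simp only: Bochner_Integration.integral_add[OF int' int', symmetric] linear_add[OF lin]
          cong: Bochner_Integration.integral_cong)
    show "(\<integral>x. g' p0 x (r *\<^sub>R a) \<partial>M) = r *\<^sub>R (\<integral>x. g' p0 x a \<partial>M)" for r a
      by (simp only: integral_scaleR_right[symmetric] linear_scale[OF lin]
          cong: Bochner_Integration.integral_cong)
    show "norm (\<integral>x. g' p0 x a \<partial>M) \<le> norm a * (\<integral>x. w x \<partial>M)" for a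
    proof -
      have "norm (\<integral>x. g' p0 x a \<partial>M) \<le> (\<integral>x. w x * norm a \<partial>M)"
        by (rule order_trans[OF Bochner_Integration.integral_norm_bound
              Bochner_Integration.integral_mono[OF integrable_norm[OF int'] integrable_mult_left[OF w]]])
          (rule dom[OF p0])
      then show ?thesis by (simp add: mult.commute)
    qed
  qed
  show "((\<lambda>p. \<integral>x. g p x \<partial>M) has_derivative (\<lambda>h. \<integral>x. g' p0 x h \<partial>M)) (at p0)"
    unfolding has_derivative_within
  proof (intro conjI blin, unfold tendsto_at_iff_sequentially, intro allI impI)
    fix X :: "nat \<Rightarrow> 'p" assume X: "\<forall>n. X n \<in> UNIV - {p0}" "X \<longlonglongrightarrow> p0"
    obtain N where N: "\<And>n. n \<ge> N \<Longrightarrow> X n \<in> ball p0 e"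
      using X(2) e unfolding lim_sequentially by (auto simp: dist_commute)
    define Y where "Y = (\<lambda>n. X (n + N))"
    have Y: "Y \<longlonglongrightarrow> p0" "\<And>n. Y n \<noteq> p0" "\<And>n. Y n \<in> ball p0 e"
      using X N LIMSEQ_ignore_initial_segment[OF X(2), of N] by (auto simp: Y_def)
    define q where "q = (\<lambda>n x. (1 / norm (Y n - p0)) *\<^sub>R (g (Y n) x - (g p0 x + g' p0 x (Y n - p0))))"
    have bnd: "norm (q n x) \<le> 2 * w x" if x: "x \<in> space M" for n x
    proof -
      have "norm (g (Y n) x - g p0 x) \<le> w x * norm (Y n - p0)"
      proof (rule differentiable_bound[of "ball p0 e"])
        show "((\<lambda>p. g p x) has_derivative g' p x) (at p within ball p0 e)" if "p \<in> ball p0 e" for p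
          using der[OF that x] by (rule has_derivative_at_withinI)
        show "onorm (g' p x) \<le> w x" if "p \<in> ball p0 e" for p
          using dom[OF that x] w0[OF x, of "Y 0 - p0"] Y(2)[of 0]
          by (intro onorm_bound) (auto simp: zero_le_mult_iff)
      qed (use Y p0 in auto)
      moreover have "norm (g' p0 x (Y n - p0)) \<le> w x * norm (Y n - p0)" by (rule dom[OF p0 x])
      ultimately have "norm (g (Y n) x - (g p0 x + g' p0 x (Y n - p0))) \<le> 2 * w x * norm (Y n - p0)"
        using norm_triangle_ineq4[of "g (Y n) x - g p0 x" "g' p0 x (Y n - p0)"]
        by (simp add: diff_diff_eq)
      moreover have "0 < norm (Y n - p0)" using Y(2)[of n] by simp
      ultimately show ?thesis unfolding q_def norm_scaleR by (simp add: pos_divide_le_eq)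
    qed
    have meas_q: "q n \<in> borel_measurable M" for n
      unfolding q_def using int[OF Y(3)[of n]] int[OF p0] int'[of "Y n - p0"] by measurable
    have "(\<lambda>n. \<integral>x. q n x \<partial>M) \<longlonglongrightarrow> (\<integral>x. 0 \<partial>M)"
    proof (rule integral_dominated_convergence[where w = "\<lambda>x. 2 * w x"])
      show "AE x in M. (\<lambda>n. q n x) \<longlonglongrightarrow> 0"
        unfolding q_def by (intro AE_I2 has_derivative_seq_quotient der p0 Y)
    qed (use bnd meas_q w in auto)
    moreover have "(\<integral>x. q n x \<partial>M) = (1 / norm (Y n - p0)) *\<^sub>R
        ((\<integral>x. g (Y n) x \<partial>M) - ((\<integral>x. g p0 x \<partial>M) + (\<integral>x. g' p0 x (Y n - p0) \<partial>M)))" for n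
      unfolding q_def using int[OF Y(3)[of n]] int[OF p0] int'[of "Y n - p0"] by simp
    ultimately have "(\<lambda>n. (1 / norm (Y n - p0)) *\<^sub>R
        ((\<integral>x. g (Y n) x \<partial>M) - ((\<integral>x. g p0 x \<partial>M) + (\<integral>x. g' p0 x (Y n - p0) \<partial>M)))) \<longlonglongrightarrow> 0"
      by simp
    from LIMSEQ_offset[OF this[unfolded Y_def]]
    show "((\<lambda>y. (1 / norm (y - p0)) *\<^sub>R ((\<integral>x. g y x \<partial>M) -
        ((\<integral>x. g p0 x \<partial>M) + (\<integral>x. g' p0 x (y - p0) \<partial>M)))) \<circ> X) \<longlonglongrightarrow> 0"
      by (simp add: o_def)
  qed
qed

lemma integrable_indicator_mult_const:
  fixes S :: "'a::euclidean_space set"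
  assumes "bounded S" "S \<in> sets borel"
  shows "integrable lborel (\<lambda>x. indicator S x * (k :: real))"
  using assms emeasure_bounded_finite[OF assms(1)]
  by (intro integrable_mult_left integrable_real_indicator) auto

lemma integrable_bounded_support:
  fixes g :: "'a::euclidean_space \<Rightarrow> complex"
  assumes "g \<in> borel_measurable borel" "\<And>x. x \<notin> ball x0 r \<Longrightarrow> g x = 0" "\<And>x. x \<in> ball x0 r \<Longrightarrow> norm (g x) \<le> B"
  shows "integrable lborel g"
proof (rule Bochner_Integration.integrable_bound)
  show "integrable lborel (\<lambda>x::'a. indicator (ball x0 r) x * B)"
    by (rule integrable_indicator_mult_const) auto
  show "AE x in lborel. norm (g x) \<le> norm (indicator (ball x0 r) x * B)"
  proof (rule AE_I2)
    fix x show "norm (g x) \<le> norm (indicator (ball x0 r) x * B)"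
      using assms(2,3)[of x] by (cases "x \<in> ball x0 r") auto
  qed
qed (use assms in auto)

lemma lborel_integral_translate:
  fixes g :: "'a::euclidean_space \<Rightarrow> complex"
  assumes "g \<in> borel_measurable borel"
  shows "(\<integral>x. g (t + x) \<partial>lborel) = (\<integral>x. g x \<partial>lborel)"
proof -
  have "(\<integral>x. g x \<partial>lborel) = (\<integral>x. g x \<partial>distr lborel borel ((+) t))" by (simp add: lborel_distr_plus)
  also have "\<dots> = (\<integral>x. g (t + x) \<partial>lborel)" using assms by (subst integral_distr) auto
  finally show ?thesis by simp
qed

lemma lborel_integrable_translate:
  fixes g :: "'a::euclidean_space \<Rightarrow> complex"
  assumes "integrable lborel g"
  shows "integrable lborel (\<lambda>x. g (t + x))"
proof -
  have "integrable (distr lborel borel ((+) t)) g" using assms by (simp add: lborel_distr_plus)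
  then show ?thesis using assms by (subst (asm) integrable_distr_eq) auto
qed

text \<open>By translation invariance the integral of \<open>g (t *\<^sub>R b + x)\<close> does not
  depend on \<open>t\<close>; its derivative at \<open>t = 0\<close> is the integral in
  question.\<close>

lemma integral_derivative_compact_support:
  fixes g :: "'a::euclidean_space \<Rightarrow> complex"
  assumes der: "\<And>x. (g has_derivative g' x) (at x)"
    and bnd: "\<And>x h. norm (g' x h) \<le> C * norm h"
    and supp: "\<And>x. x \<notin> ball 0 r \<Longrightarrow> g x = 0"
  shows "integrable lborel (\<lambda>x. g' x b)" and "(\<integral>x. g' x b \<partial>lborel) = 0"
proof -
  have cont: "continuous_on UNIV g"
    using der by (auto intro!: continuous_at_imp_continuous_on has_derivative_continuous)
  have gm: "g \<in> borel_measurable borel" using cont by (rule borel_measurable_continuous_onI)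
  \<comment> \<open>Only off the closed ball does \<open>g\<close> vanish on a whole neighbourhood,
    hence the radius enlarged by one.\<close>
  have supp': "g' x h = 0" if "x \<notin> ball 0 (r + 1)" for x h
  proof -
    have "((\<lambda>_. 0) has_derivative g' x) (at x)"
    proof (rule has_derivative_transform_within_open[OF der])
      show "open (- cball 0 r :: 'a set)" by auto
      show "x \<in> - cball 0 r" using that by auto
    qed (use supp in auto)
    then have "g' x = (\<lambda>_. 0)" using has_derivative_unique has_derivative_const by blast
    then show ?thesis by simp
  qed
  have "compact (g ` cball 0 r)"
    by (intro compact_continuous_image continuous_on_subset[OF cont]) auto
  then obtain B where "\<And>y. y \<in> g ` cball 0 r \<Longrightarrow> norm y \<le> B"
    using compact_imp_bounded bounded_iff by metis
  then have gi: "integrable lborel g"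
    by (intro integrable_bounded_support[OF gm, of 0 r B]) (use supp in auto)
  have der1: "((\<lambda>t::real. g (t *\<^sub>R b + x)) has_derivative (\<lambda>h. g' (t *\<^sub>R b + x) (h *\<^sub>R b))) (at t)" for t x
    by (rule has_derivative_compose[where g = g and f = "\<lambda>t. t *\<^sub>R b + x", OF _ der])
      (auto intro!: derivative_eq_intros)
  \<comment> \<open>For |t| < 1 the translate by \<open>t *\<^sub>R b\<close> moves the support by
    at most \<open>norm b\<close>, so one indicator dominates all parameters at once.\<close>
  define w where "w = (\<lambda>x::'a. indicator (ball 0 (r + 1 + norm b)) x * (C * norm b))"
  have w: "integrable lborel w" unfolding w_def
    by (rule integrable_indicator_mult_const) auto
  have dom: "norm (g' (t *\<^sub>R b + x) (h *\<^sub>R b)) \<le> w x * norm h" if "t \<in> ball 0 (1::real)" for t h x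
  proof (cases "x \<in> ball 0 (r + 1 + norm b)")
    case True
    then show ?thesis using bnd[of "t *\<^sub>R b + x" "h *\<^sub>R b"] by (simp add: w_def mult_ac)
  next
    case False
    have "norm (t *\<^sub>R b) \<le> norm b" using that by (simp add: mult_left_le_one_le)
    then have "t *\<^sub>R b + x \<notin> ball 0 (r + 1)" using False norm_triangle_ineq4[of "t *\<^sub>R b + x" "t *\<^sub>R b"] by simp
    then show ?thesis using supp' False by (simp add: w_def)
  qed
  note L = has_derivative_dominated_integral[of 1 "0::real" lborel "\<lambda>t x. g (t *\<^sub>R b + x)"
      "\<lambda>t x h. g' (t *\<^sub>R b + x) (h *\<^sub>R b)" w, OF _ lborel_integrable_translate[OF gi] der1 dom w]
  show "integrable lborel (\<lambda>x. g' x b)" using L(1)[of 1] by simp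
  have "((\<lambda>t::real. \<integral>x. g x \<partial>lborel) has_derivative (\<lambda>h. \<integral>x. g' x (h *\<^sub>R b) \<partial>lborel)) (at 0)"
    using L(2) by (simp add: lborel_integral_translate[OF gm])
  then have "(\<lambda>h. \<integral>x. g' x (h *\<^sub>R b) \<partial>lborel) = (\<lambda>h. 0)"
    using has_derivative_unique has_derivative_const by blast
  from fun_cong[OF this, of 1] show "(\<integral>x. g' x b \<partial>lborel) = 0" by simp
qed

section \<open>Radial polynomial weights of compact support\<close>

text \<open>A truncated power of \<open>\<rho>\<^sup>2 - |x|\<^sup>2\<close>. Its gradient is a
  multiple of \<open>x\<close> times the weight with exponent lowered by one, so integration by
  parts produces radial derivatives and again a weight of the same family.\<close>

definition bump :: "real \<Rightarrow> nat \<Rightarrow> 'a::euclidean_space \<Rightarrow> real" where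
  "bump \<rho> n x = (max 0 (\<rho>\<^sup>2 - x \<bullet> x)) ^ n"

lemma bump_nonneg: "0 \<le> bump \<rho> n x" by (simp add: bump_def)

lemma bump_le: "bump \<rho> n x \<le> (\<rho>\<^sup>2) ^ n"
  unfolding bump_def by (intro power_mono) auto

lemma bump_outside: "0 < n \<Longrightarrow> 0 \<le> \<rho> \<Longrightarrow> x \<notin> ball 0 \<rho> \<Longrightarrow> bump \<rho> n x = 0"
  unfolding bump_def by (auto simp: dot_square_norm power_mono not_less max_def intro: antisym)

lemma continuous_on_bump [continuous_intros]: "continuous_on S (bump \<rho> n)"
  unfolding bump_def by (intro continuous_intros)

lemma borel_measurable_bump [measurable]: "bump \<rho> n \<in> borel_measurable borel"
  by (intro borel_measurable_continuous_onI continuous_on_bump)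

text \<open>An exponent of at least two makes the truncated power differentiable also at zero, where
  the difference quotient is at most \<open>\<bar>h\<bar> ^ Suc n\<close>.\<close>

lemma has_derivative_bump:
  "(bump \<rho> (Suc (Suc n)) has_derivative
     (\<lambda>h. - 2 * real (Suc (Suc n)) * bump \<rho> (Suc n) x * (x \<bullet> h))) (at x)"
proof -
  have pos: "((\<lambda>s::real. (max 0 s) ^ Suc (Suc n)) has_real_derivative real (Suc (Suc n)) * (max 0 s) ^ Suc n) (at s)" for s
  proof -
    consider "s > 0" | "s < 0" | "s = 0" by linarith
    then show ?thesis
    proof cases
      case 1
      have "((\<lambda>s::real. s ^ Suc (Suc n)) has_real_derivative real (Suc (Suc n)) * (max 0 s) ^ Suc n) (at s)"
        using 1 DERIV_pow[of "Suc (Suc n)" s] by (simp add: max_def)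
      then show ?thesis
        by (rule has_field_derivative_transform_within_open[where S = "{0<..}"]) (use 1 in auto)
    next
      case 2
      have "((\<lambda>s::real. 0) has_real_derivative real (Suc (Suc n)) * (max 0 s) ^ Suc n) (at s)"
        using 2 by (auto simp: max_def)
      then show ?thesis
        by (rule has_field_derivative_transform_within_open[where S = "{..<0}"]) (use 2 in auto)
    next
      case 3
      have "((\<lambda>h. \<bar>h\<bar> ^ Suc n) \<longlongrightarrow> \<bar>0::real\<bar> ^ Suc n) (at 0)"
        by (intro tendsto_intros)
      then have "((\<lambda>h. \<bar>h\<bar> ^ Suc n) \<longlongrightarrow> (0::real)) (at 0)" by simp
      then have "((\<lambda>h::real. (max 0 h) ^ Suc (Suc n) / h) \<longlongrightarrow> 0) (at 0)"
      proof (rule Lim_null_comparison[rotated])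
        show "\<forall>\<^sub>F h::real in at 0. norm ((max 0 h) ^ Suc (Suc n) / h) \<le> \<bar>h\<bar> ^ Suc n"
        proof (intro always_eventually allI)
          fix h :: real
          show "norm ((max 0 h) ^ Suc (Suc n) / h) \<le> \<bar>h\<bar> ^ Suc n"
            by (cases "h > 0") (auto simp: max_def intro: mult_nonpos_nonneg)
        qed
      qed
      then show ?thesis using 3 by (simp add: DERIV_def)
    qed
  qed
  have "((\<lambda>x. \<rho>\<^sup>2 - x \<bullet> x) has_derivative (\<lambda>h. - 2 * (x \<bullet> h))) (at x)"
    by (auto intro!: derivative_eq_intros simp: inner_commute)
  from has_derivative_compose[OF this pos[of "\<rho>\<^sup>2 - x \<bullet> x", unfolded has_field_derivative_def]]
  show ?thesis by (simp add: bump_def[abs_def] algebra_simps)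
qed

section \<open>Harmonic functions\<close>

lemma partial_deriv_eqI:
  "(u has_derivative u') (at x) \<Longrightarrow> partial_deriv b u x = u' b"
  unfolding partial_deriv_def using frechet_derivative_at by metis

lemma has_derivative_partial_deriv:
  fixes u :: "'a::euclidean_space \<Rightarrow> complex"
  assumes "u differentiable (at x)"
  shows "(u has_derivative (\<lambda>h. \<Sum>b\<in>Basis. (h \<bullet> b) *\<^sub>R partial_deriv b u x)) (at x)"
proof -
  have der: "(u has_derivative frechet_derivative u (at x)) (at x)"
    using assms by (simp add: frechet_derivative_works)
  then have lin: "linear (frechet_derivative u (at x))" by (rule has_derivative_linear)
  have "frechet_derivative u (at x) h = (\<Sum>b\<in>Basis. (h \<bullet> b) *\<^sub>R partial_deriv b u x)" for h
  proof -
    have "frechet_derivative u (at x) h = frechet_derivative u (at x) (\<Sum>b\<in>Basis. (h \<bullet> b) *\<^sub>R b)"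
      by (simp add: euclidean_representation)
    also have "\<dots> = (\<Sum>b\<in>Basis. (h \<bullet> b) *\<^sub>R partial_deriv b u x)"
      by (simp add: linear_sum[OF lin] linear_scale[OF lin] partial_deriv_def)
    finally show ?thesis .
  qed
  then have "frechet_derivative u (at x) = (\<lambda>h. \<Sum>b\<in>Basis. (h \<bullet> b) *\<^sub>R partial_deriv b u x)"
    by blast
  with der show ?thesis by simp
qed

lemma partial_deriv_cong_open:
  assumes "open S" "x \<in> S" and eq: "\<And>y. y \<in> S \<Longrightarrow> u y = v y"
  shows "partial_deriv b u x = partial_deriv b v x"
proof -
  have "(u has_derivative f') (at x) \<longleftrightarrow> (v has_derivative f') (at x)" for f'
    using has_derivative_transform_within_open[OF _ assms(1,2), of u f' UNIV v]
      has_derivative_transform_within_open[OF _ assms(1,2), of v f' UNIV u] eq by auto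
  then show ?thesis by (simp add: partial_deriv_def frechet_derivative_def)
qed

text \<open>Candidates \<open>u1\<close>, \<open>u2\<close> for the derivatives are supplied from
  outside. Uniqueness of the derivative then forces the values chosen by
  \<open>frechet_derivative\<close>, and openness lets the identity for \<open>u1\<close> be
  differentiated once more.\<close>

lemma C2_onI:
  assumes "open \<Omega>"
    and d1: "\<And>x. x \<in> \<Omega> \<Longrightarrow> (u has_derivative (\<lambda>h. \<Sum>b\<in>Basis. (h \<bullet> b) *\<^sub>R u1 b x)) (at x)"
    and d2: "\<And>b x. b \<in> Basis \<Longrightarrow> x \<in> \<Omega> \<Longrightarrow>
        (u1 b has_derivative (\<lambda>h. \<Sum>b'\<in>Basis. (h \<bullet> b') *\<^sub>R u2 b b' x)) (at x)"
    and cont: "\<And>b b'. b \<in> Basis \<Longrightarrow> b' \<in> Basis \<Longrightarrow> continuous_on \<Omega> (u2 b b')"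
  shows "\<And>b x. b \<in> Basis \<Longrightarrow> x \<in> \<Omega> \<Longrightarrow> partial_deriv b u x = u1 b x"
    and C2_onI_partial2: "\<And>b b' x. b \<in> Basis \<Longrightarrow> b' \<in> Basis \<Longrightarrow> x \<in> \<Omega> \<Longrightarrow>
        partial_deriv b' (partial_deriv b u) x = u2 b b' x"
    and "C2_on \<Omega> u"
proof -
  have basis: "(\<Sum>b'\<in>Basis. (b \<bullet> b') *\<^sub>R (f b' :: complex)) = f b" if "b \<in> Basis" for b :: 'a and f
  proof -
    have "(\<Sum>b'\<in>Basis. (b \<bullet> b') *\<^sub>R f b') = (\<Sum>b'\<in>Basis. if b' = b then f b' else 0)"
      using that by (intro sum.cong) (auto simp: inner_Basis)
    then show ?thesis using that by simp
  qed
  show 1: "partial_deriv b u x = u1 b x" if "b \<in> Basis" "x \<in> \<Omega>" for b x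
    using partial_deriv_eqI[OF d1[OF that(2)]] basis[OF that(1)] by simp
  have d2': "(partial_deriv b u has_derivative (\<lambda>h. \<Sum>b'\<in>Basis. (h \<bullet> b') *\<^sub>R u2 b b' x)) (at x)"
    if "b \<in> Basis" "x \<in> \<Omega>" for b x
    by (rule has_derivative_transform_within_open[OF d2[OF that] \<open>open \<Omega>\<close> that(2)])
      (use 1[OF that(1)] in simp)
  show 2: "partial_deriv b' (partial_deriv b u) x = u2 b b' x"
    if "b \<in> Basis" "b' \<in> Basis" "x \<in> \<Omega>" for b b' x
    using partial_deriv_eqI[OF d2'[OF that(1,3)]] basis[OF that(2)] by simp
  show "C2_on \<Omega> u"
    unfolding C2_on_def
  proof (intro conjI ballI)
    show "u differentiable at x" if "x \<in> \<Omega>" for x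
      using d1[OF that] differentiableI by blast
    show "partial_deriv b u differentiable at x" if "b \<in> Basis" "x \<in> \<Omega>" for b x
      using d2'[OF that] differentiableI by blast
    show "continuous_on \<Omega> (partial_deriv b' (partial_deriv b u))" if "b \<in> Basis" "b' \<in> Basis" for b b'
      using cont[OF that] by (rule continuous_on_eq) (use 2[OF that] in simp)
  qed
qed

lemma harmonic_onI:
  assumes "open \<Omega>"
    and "\<And>x. x \<in> \<Omega> \<Longrightarrow> (u has_derivative (\<lambda>h. \<Sum>b\<in>Basis. (h \<bullet> b) *\<^sub>R u1 b x)) (at x)"
    and "\<And>b x. b \<in> Basis \<Longrightarrow> x \<in> \<Omega> \<Longrightarrow>
        (u1 b has_derivative (\<lambda>h. \<Sum>b'\<in>Basis. (h \<bullet> b') *\<^sub>R u2 b b' x)) (at x)"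
    and "\<And>b b'. b \<in> Basis \<Longrightarrow> b' \<in> Basis \<Longrightarrow> continuous_on \<Omega> (u2 b b')"
    and "\<And>x. x \<in> \<Omega> \<Longrightarrow> (\<Sum>b\<in>Basis. u2 b b x) = 0"
  shows "harmonic_on \<Omega> u"
  unfolding harmonic_on_def laplacian_def
  using C2_onI[OF assms(1-4)] assms(5) by simp

lemma harmonic_onD:
  assumes "harmonic_on \<Omega> u"
  shows harmonic_on_has_derivative: "\<And>x. x \<in> \<Omega> \<Longrightarrow>
      (u has_derivative (\<lambda>h. \<Sum>b\<in>Basis. (h \<bullet> b) *\<^sub>R partial_deriv b u x)) (at x)"
    and harmonic_on_has_derivative2: "\<And>b x. b \<in> Basis \<Longrightarrow> x \<in> \<Omega> \<Longrightarrow>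
      (partial_deriv b u has_derivative
        (\<lambda>h. \<Sum>b'\<in>Basis. (h \<bullet> b') *\<^sub>R partial_deriv b' (partial_deriv b u) x)) (at x)"
    and harmonic_on_continuous: "continuous_on \<Omega> u"
    and harmonic_on_continuous1: "\<And>b. b \<in> Basis \<Longrightarrow> continuous_on \<Omega> (partial_deriv b u)"
    and harmonic_on_continuous2: "\<And>b b'. b \<in> Basis \<Longrightarrow> b' \<in> Basis \<Longrightarrow>
      continuous_on \<Omega> (partial_deriv b' (partial_deriv b u))"
    and harmonic_on_laplacian: "\<And>x. x \<in> \<Omega> \<Longrightarrow>
      (\<Sum>b\<in>Basis. partial_deriv b (partial_deriv b u) x) = 0"
proof -
  note u = assms[unfolded harmonic_on_def C2_on_def laplacian_def]
  show 1: "(u has_derivative (\<lambda>h. \<Sum>b\<in>Basis. (h \<bullet> b) *\<^sub>R partial_deriv b u x)) (at x)"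
    if "x \<in> \<Omega>" for x
    using u that by (intro has_derivative_partial_deriv) blast
  show 2: "(partial_deriv b u has_derivative
        (\<lambda>h. \<Sum>b'\<in>Basis. (h \<bullet> b') *\<^sub>R partial_deriv b' (partial_deriv b u) x)) (at x)"
    if "b \<in> Basis" "x \<in> \<Omega>" for b x
    using u that by (intro has_derivative_partial_deriv) blast
  show "continuous_on \<Omega> u"
    using 1 by (auto intro!: continuous_at_imp_continuous_on has_derivative_continuous)
  show "continuous_on \<Omega> (partial_deriv b u)" if "b \<in> Basis" for b
    using 2[OF that] by (auto intro!: continuous_at_imp_continuous_on has_derivative_continuous)
qed (use assms[unfolded harmonic_on_def C2_on_def laplacian_def] in auto)

lemma harmonic_on_subset: "harmonic_on \<Omega> u \<Longrightarrow> S \<subseteq> \<Omega> \<Longrightarrow> harmonic_on S u"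
  unfolding harmonic_on_def C2_on_def by (meson continuous_on_subset subsetD)

lemma harmonic_on_cong_open:
  assumes "open \<Omega>" "harmonic_on \<Omega> u" and eq: "\<And>x. x \<in> \<Omega> \<Longrightarrow> u x = v x"
  shows "harmonic_on \<Omega> v"
  by (rule harmonic_onI[OF assms(1) has_derivative_transform_within_open[OF
        harmonic_on_has_derivative[OF assms(2)] assms(1) _ eq]
        harmonic_on_has_derivative2[OF assms(2)] harmonic_on_continuous2[OF assms(2)]
        harmonic_on_laplacian[OF assms(2)]])

lemma harmonic_on_locally:
  assumes "open \<Omega>" "\<And>x. x \<in> \<Omega> \<Longrightarrow> \<exists>S. open S \<and> x \<in> S \<and> harmonic_on S u"
  shows "harmonic_on \<Omega> u"
proof (rule harmonic_onI[OF assms(1), of u "\<lambda>b. partial_deriv b u" "\<lambda>b b'. partial_deriv b' (partial_deriv b u)"])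
  fix b b' :: 'a assume b: "b \<in> Basis" "b' \<in> Basis"
  have "isCont (partial_deriv b' (partial_deriv b u)) x" if x: "x \<in> \<Omega>" for x
  proof -
    from assms(2)[OF x] obtain S where "open S" "x \<in> S" "harmonic_on S u" by blast
    then show ?thesis
      using harmonic_on_continuous2[OF \<open>harmonic_on S u\<close> b] continuous_on_eq_continuous_at by blast
  qed
  then show "continuous_on \<Omega> (partial_deriv b' (partial_deriv b u))"
    by (rule continuous_at_imp_continuous_on[rule_format])
qed (use assms(2) harmonic_onD in blast)+

lemma harmonic_on_const: "open \<Omega> \<Longrightarrow> harmonic_on \<Omega> (\<lambda>_. k)"
  by (rule harmonic_onI[of _ _ "\<lambda>_ _. 0" "\<lambda>_ _ _. 0"]) auto

lemma harmonic_on_add: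
  assumes "open \<Omega>" "harmonic_on \<Omega> u" "harmonic_on \<Omega> v"
  shows "harmonic_on \<Omega> (\<lambda>x. u x + v x)"
proof (rule harmonic_onI[OF assms(1)])
  show "((\<lambda>x. u x + v x) has_derivative
      (\<lambda>h. \<Sum>b\<in>Basis. (h \<bullet> b) *\<^sub>R (partial_deriv b u x + partial_deriv b v x))) (at x)" if "x \<in> \<Omega>" for x
    using has_derivative_add[OF assms(2,3)[THEN harmonic_on_has_derivative, OF that]]
    by (simp add: scaleR_add_right sum.distrib)
  show "((\<lambda>x. partial_deriv b u x + partial_deriv b v x) has_derivative
      (\<lambda>h. \<Sum>b'\<in>Basis. (h \<bullet> b') *\<^sub>R (partial_deriv b' (partial_deriv b u) x
        + partial_deriv b' (partial_deriv b v) x))) (at x)" if "b \<in> Basis" "x \<in> \<Omega>" for b x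
    using has_derivative_add[OF assms(2,3)[THEN harmonic_on_has_derivative2, OF that]]
    by (simp add: scaleR_add_right sum.distrib)
qed (use assms in \<open>auto intro!: continuous_intros harmonic_on_continuous2 simp: sum.distrib harmonic_on_laplacian\<close>)

text \<open>\<open>bounded_linear\<close> means linear over the reals, so both multiplication by a
  complex constant and conjugation are instances.\<close>

lemma harmonic_on_bounded_linear:
  fixes f :: "complex \<Rightarrow> complex"
  assumes "open \<Omega>" "harmonic_on \<Omega> u" and f: "bounded_linear f"
  shows "harmonic_on \<Omega> (\<lambda>x. f (u x))"
proof -
  interpret f: bounded_linear f by (rule f)
  show ?thesis
  proof (rule harmonic_onI[OF assms(1)])
    show "((\<lambda>x. f (u x)) has_derivative
        (\<lambda>h. \<Sum>b\<in>Basis. (h \<bullet> b) *\<^sub>R f (partial_deriv b u x))) (at x)" if "x \<in> \<Omega>" for x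
      using f.has_derivative[OF harmonic_on_has_derivative[OF assms(2) that]]
      by (simp add: f.sum f.scaleR)
    show "((\<lambda>x. f (partial_deriv b u x)) has_derivative
        (\<lambda>h. \<Sum>b'\<in>Basis. (h \<bullet> b') *\<^sub>R f (partial_deriv b' (partial_deriv b u) x))) (at x)"
      if "b \<in> Basis" "x \<in> \<Omega>" for b x
      using f.has_derivative[OF harmonic_on_has_derivative2[OF assms(2) that]]
      by (simp add: f.sum f.scaleR)
    show "continuous_on \<Omega> (\<lambda>x. f (partial_deriv b' (partial_deriv b u) x))"
      if "b \<in> Basis" "b' \<in> Basis" for b b'
      by (intro f.continuous_on harmonic_on_continuous2[OF assms(2) that])
    show "(\<Sum>b\<in>Basis. f (partial_deriv b (partial_deriv b u) x)) = 0" if "x \<in> \<Omega>" for x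
      using harmonic_on_laplacian[OF assms(2) that] by (simp flip: f.sum)
  qed
qed

lemma harmonic_on_cmult:
  "open \<Omega> \<Longrightarrow> harmonic_on \<Omega> u \<Longrightarrow> harmonic_on \<Omega> (\<lambda>x. k * u x)"
  by (rule harmonic_on_bounded_linear) (auto intro: bounded_linear_mult_right)

lemma harmonic_on_cnj: "open \<Omega> \<Longrightarrow> harmonic_on \<Omega> u \<Longrightarrow> harmonic_on \<Omega> (\<lambda>x. cnj (u x))"
  by (rule harmonic_on_bounded_linear) (auto intro: bounded_linear_cnj)

lemma harmonic_on_diff:
  assumes "open \<Omega>" "harmonic_on \<Omega> u" "harmonic_on \<Omega> v"
  shows "harmonic_on \<Omega> (\<lambda>x. u x - v x)"
  using harmonic_on_add[OF assms(1,2) harmonic_on_cmult[OF assms(1,3), of "-1"]] by simp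

lemma harmonic_on_translate:
  assumes "open \<Omega>" "harmonic_on \<Omega> u"
  shows "harmonic_on {x. t + x \<in> \<Omega>} (\<lambda>x. u (t + x))"
proof -
  have o: "open {x. t + x \<in> \<Omega>}"
    using open_vimage[OF assms(1), of "\<lambda>x. t + x"]
    by (simp add: vimage_def continuous_on_add continuous_on_const continuous_on_id)
  have chain: "((\<lambda>x. f (t + x)) has_derivative f') (at x)"
    if "(f has_derivative f') (at (t + x))" for f :: "'a \<Rightarrow> complex" and f' x
    by (rule has_derivative_compose[where f = "\<lambda>x. t + x" and f' = "\<lambda>h. h" and g = f, OF _ that])
      (auto intro!: derivative_eq_intros)
  show ?thesis
    by (rule harmonic_onI[OF o chain[OF harmonic_on_has_derivative[OF assms(2)]]
      chain[OF harmonic_on_has_derivative2[OF assms(2)]]])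
      (auto intro!: harmonic_on_laplacian[OF assms(2)]
        continuous_on_compose2[OF harmonic_on_continuous2[OF assms(2)]] continuous_intros)
qed

section \<open>Green's identity and dilations\<close>

text \<open>A derivative recorded by its coordinates, so that sums over \<open>Basis\<close> such as
  the Laplacian and the radial derivative can be formed directly. Only the values of
  \<open>G\<close> on \<open>Basis\<close> matter.\<close>

definition has_grad :: "('a::euclidean_space \<Rightarrow> complex) \<Rightarrow> ('a \<Rightarrow> complex) \<Rightarrow> 'a \<Rightarrow> bool" where
  "has_grad f G x \<longleftrightarrow> (f has_derivative (\<lambda>h. \<Sum>b\<in>Basis. (h \<bullet> b) *\<^sub>R G b)) (at x)"

lemma norm_gradient_le:
  fixes F :: "'a::euclidean_space \<Rightarrow> complex"
  assumes "\<And>b. b \<in> Basis \<Longrightarrow> norm (F b) \<le> C b"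
  shows "norm (\<Sum>b\<in>Basis. (h \<bullet> b) *\<^sub>R F b) \<le> (\<Sum>b\<in>Basis. C b) * norm h"
proof -
  have "norm (\<Sum>b\<in>Basis. (h \<bullet> b) *\<^sub>R F b) \<le> (\<Sum>b\<in>Basis. norm h * C b)"
    by (auto intro!: sum_norm_le mult_mono assms Basis_le_norm)
  then show ?thesis by (simp only: sum_distrib_left[symmetric] mult.commute[of "sum C Basis"])
qed

lemma has_grad_lipschitz:
  assumes "convex S" "x \<in> S" "y \<in> S"
    and grad: "\<And>z. z \<in> S \<Longrightarrow> has_grad f (F z) z"
    and C: "\<And>z b. z \<in> S \<Longrightarrow> b \<in> Basis \<Longrightarrow> norm (F z b) \<le> C b"
  shows "norm (f x - f y) \<le> (\<Sum>b\<in>Basis. C b) * norm (x - y)"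
proof (rule differentiable_bound[OF assms(1) _ _ assms(2,3)])
  show "(f has_derivative (\<lambda>h. \<Sum>b\<in>Basis. (h \<bullet> b) *\<^sub>R F z b)) (at z within S)" if "z \<in> S" for z
    using grad[OF that] unfolding has_grad_def by (rule has_derivative_at_withinI)
  have "0 \<le> (\<Sum>b\<in>Basis. C b)"
    by (intro sum_nonneg order_trans[OF norm_ge_zero C[OF assms(2)]])
  then show "onorm (\<lambda>h. \<Sum>b\<in>Basis. (h \<bullet> b) *\<^sub>R F z b) \<le> (\<Sum>b\<in>Basis. C b)" if "z \<in> S" for z
    by (intro onorm_bound norm_gradient_le C[OF that])
qed

lemma has_grad_mult:
  assumes "has_grad f F x" "has_grad g G x"
  shows "has_grad (\<lambda>x. f x * g x) (\<lambda>b. F b * g x + f x * G b) x"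
  using has_derivative_mult[OF assms[unfolded has_grad_def]] unfolding has_grad_def
  by (rule has_derivative_eq_rhs)
    (simp add: fun_eq_iff sum_distrib_left sum_distrib_right sum.distrib scaleR_add_right add.commute)

lemma has_grad_diff:
  assumes "has_grad f F x" "has_grad g G x"
  shows "has_grad (\<lambda>x. f x - g x) (\<lambda>b. F b - G b) x"
  using has_derivative_diff[OF assms[unfolded has_grad_def]] unfolding has_grad_def
  by (rule has_derivative_eq_rhs) (simp add: fun_eq_iff sum_subtractf scaleR_diff_right)

lemma has_grad_const: "has_grad (\<lambda>_. k) (\<lambda>_. 0) x"
  by (simp add: has_grad_def)

lemma has_grad_dilate:
  assumes "has_grad f F (r *\<^sub>R x)"
  shows "has_grad (\<lambda>x. f (r *\<^sub>R x)) (\<lambda>b. of_real r * F b) x"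
proof -
  have "((\<lambda>x. f (r *\<^sub>R x)) has_derivative (\<lambda>h. \<Sum>b\<in>Basis. ((r *\<^sub>R h) \<bullet> b) *\<^sub>R F b)) (at x)"
    by (rule has_derivative_compose[where f = "\<lambda>x. r *\<^sub>R x" and f' = "\<lambda>h. r *\<^sub>R h" and g = f,
          OF _ assms[unfolded has_grad_def]])
      (auto intro!: derivative_eq_intros)
  then show ?thesis unfolding has_grad_def
    by (rule has_derivative_eq_rhs) (simp add: fun_eq_iff scaleR_conv_of_real mult_ac)
qed

lemma has_grad_bump:
  "has_grad (\<lambda>x. of_real (bump \<rho> (Suc (Suc n)) x))
     (\<lambda>b. - 2 * of_nat (Suc (Suc n)) * of_real (bump \<rho> (Suc n) x) * of_real (x \<bullet> b)) (x::'a::euclidean_space)"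
proof -
  have "((\<lambda>x. complex_of_real (bump \<rho> (Suc (Suc n)) x)) has_derivative
     (\<lambda>h. of_real (- 2 * real (Suc (Suc n)) * bump \<rho> (Suc n) x * (x \<bullet> h)))) (at x)"
    by (rule bounded_linear.has_derivative[OF bounded_linear_of_real has_derivative_bump])
  then show ?thesis unfolding has_grad_def
  proof (rule has_derivative_eq_rhs, intro ext)
    fix h :: 'a
    have "x \<bullet> h = (\<Sum>b\<in>Basis. (x \<bullet> b) * (h \<bullet> b))" by (rule euclidean_inner)
    then show "complex_of_real (- 2 * real (Suc (Suc n)) * bump \<rho> (Suc n) x * (x \<bullet> h)) =
      (\<Sum>b\<in>Basis. (h \<bullet> b) *\<^sub>R (- 2 * of_nat (Suc (Suc n)) * of_real (bump \<rho> (Suc n) x) * of_real (x \<bullet> b)))"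
      by (simp add: scaleR_conv_of_real sum_distrib_left mult_ac sum_negf)
  qed
qed

lemma bounded_continuous_on_cball:
  fixes w :: "'a::euclidean_space \<Rightarrow> complex"
  assumes "continuous_on (cball x \<rho>) w"
  obtains C where "0 \<le> C" "\<And>y. y \<in> cball x \<rho> \<Longrightarrow> norm (w y) \<le> C"
proof -
  have "compact (w ` cball x \<rho>)"
    by (intro compact_continuous_image assms) auto
  then obtain C where "\<And>y. y \<in> w ` cball x \<rho> \<Longrightarrow> norm y \<le> C"
    using compact_imp_bounded bounded_iff by metis
  then have "0 \<le> max 0 C \<and> (\<forall>y\<in>cball x \<rho>. norm (w y) \<le> max 0 C)" by force
  with that show ?thesis by blast
qed

lemma integrable_bump_mult:
  fixes w :: "'a::euclidean_space \<Rightarrow> complex"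
  assumes "continuous_on (cball 0 \<rho>) w" "0 \<le> \<rho>"
  shows "integrable lborel (\<lambda>x. of_real (bump \<rho> (Suc n) x) * w x)"
proof -
  obtain C where C: "0 \<le> C" "\<And>y. y \<in> cball 0 \<rho> \<Longrightarrow> norm (w y) \<le> C"
    using bounded_continuous_on_cball[OF assms(1)] by blast
  \<comment> \<open>Nothing is known about \<open>w\<close> off the closed ball, not even
    measurability; since the weight vanishes there, \<open>w\<close> may be cut off.\<close>
  have eq: "of_real (bump \<rho> (Suc n) x) * w x = of_real (bump \<rho> (Suc n) x) * (indicator (ball 0 \<rho>) x *\<^sub>R w x)" for x
    using bump_outside[of "Suc n" \<rho> x] assms(2) by (auto simp: indicator_def)
  have m: "(\<lambda>x. indicator (ball 0 \<rho>) x *\<^sub>R w x) \<in> borel_measurable borel"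
    by (intro borel_measurable_continuous_on_indicator continuous_on_subset[OF assms(1)]) auto
  show ?thesis
  proof (rule integrable_bounded_support[of _ 0 \<rho> "(\<rho>\<^sup>2) ^ Suc n * C"])
    show "(\<lambda>x. of_real (bump \<rho> (Suc n) x) * w x) \<in> borel_measurable borel"
      unfolding eq using m by measurable
    show "of_real (bump \<rho> (Suc n) x) * w x = 0" if "x \<notin> ball 0 \<rho>" for x
      using bump_outside[of "Suc n" \<rho> x] assms(2) that by simp
    show "norm (of_real (bump \<rho> (Suc n) x) * w x) \<le> (\<rho>\<^sup>2) ^ Suc n * C" if "x \<in> ball 0 \<rho>" for x
      unfolding norm_mult using bump_le[of \<rho> "Suc n" x] bump_nonneg[of \<rho> "Suc n" x] C that
      by (intro mult_mono) auto
  qed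
qed

text \<open>The gradient \<open>D\<close> is meaningful on the ball of radius \<open>\<rho>'\<close>
  only. Outside the closed ball of radius \<open>\<rho>\<close> the function vanishes locally and
  has derivative zero, which the indicator expresses; the margin up to \<open>\<rho>'\<close> covers
  the boundary sphere.\<close>

lemma integral_grad_compact_support:
  fixes W :: "'a::euclidean_space \<Rightarrow> complex"
  assumes "\<rho> < \<rho>'" and supp: "\<And>x. x \<notin> ball 0 \<rho> \<Longrightarrow> W x = 0"
    and der: "\<And>x. x \<in> ball 0 \<rho>' \<Longrightarrow> has_grad W (D x) x"
    and cont: "\<And>b. b \<in> Basis \<Longrightarrow> continuous_on (cball 0 \<rho>) (\<lambda>x. D x b)"
    and b: "b \<in> Basis"
  shows "integrable lborel (\<lambda>x. indicator (cball 0 \<rho>) x *\<^sub>R D x b)"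
    and "(\<integral>x. indicator (cball 0 \<rho>) x *\<^sub>R D x b \<partial>lborel) = 0"
proof -
  have "\<exists>C\<ge>0. \<forall>x\<in>cball 0 \<rho>. norm (D x b) \<le> C" if "b \<in> Basis" for b
    using bounded_continuous_on_cball[OF cont[OF that]] by metis
  then obtain C where C: "\<And>b. b \<in> Basis \<Longrightarrow> 0 \<le> C b"
    "\<And>b x. b \<in> Basis \<Longrightarrow> x \<in> cball 0 \<rho> \<Longrightarrow> norm (D x b) \<le> C b" by metis
  define g' where "g' = (\<lambda>x h. indicator (cball 0 \<rho>) x *\<^sub>R (\<Sum>b\<in>Basis. (h \<bullet> b) *\<^sub>R D x b))"
  have der': "(W has_derivative g' x) (at x)" for x
  proof (cases "x \<in> cball 0 \<rho>")
    case True
    then show ?thesis using der[of x] assms(1) by (simp add: g'_def has_grad_def)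
  next
    case False
    have "(W has_derivative (\<lambda>_. 0)) (at x)"
      by (rule has_derivative_transform_within_open[OF has_derivative_const, of "- cball 0 \<rho>"])
        (use False supp in auto)
    then show ?thesis using False by (simp add: g'_def)
  qed
  have bnd: "norm (g' x h) \<le> (\<Sum>b\<in>Basis. C b) * norm h" for x h
  proof (cases "x \<in> cball 0 \<rho>")
    case True
    then show ?thesis unfolding g'_def using norm_gradient_le[of "D x" C h] C(2) by simp
  next
    case False
    then show ?thesis by (auto simp: g'_def intro!: mult_nonneg_nonneg sum_nonneg C)
  qed
  have eq: "g' x b = indicator (cball 0 \<rho>) x *\<^sub>R D x b" for x
  proof -
    have "(\<Sum>b'\<in>Basis. (b \<bullet> b') *\<^sub>R D x b') = (\<Sum>b'\<in>Basis. if b' = b then D x b' else 0)"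
      using b by (intro sum.cong) (auto simp: inner_Basis)
    then show ?thesis using b by (simp add: g'_def)
  qed
  show "integrable lborel (\<lambda>x. indicator (cball 0 \<rho>) x *\<^sub>R D x b)"
    "(\<integral>x. indicator (cball 0 \<rho>) x *\<^sub>R D x b \<partial>lborel) = 0"
    using integral_derivative_compact_support[OF der' bnd supp, where b = b] unfolding eq by auto
qed

text \<open>The radial (Euler) derivative, that is, the derivative of
  \<open>u (exp t *\<^sub>R x)\<close> at \<open>t = 0\<close>.\<close>

definition euler :: "('a::euclidean_space \<Rightarrow> complex) \<Rightarrow> 'a \<Rightarrow> complex" where
  "euler u x = (\<Sum>b\<in>Basis. (x \<bullet> b) *\<^sub>R partial_deriv b u x)"

lemma continuous_on_euler: "harmonic_on \<Omega> u \<Longrightarrow> continuous_on \<Omega> (euler u)"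
  unfolding euler_def by (intro continuous_intros harmonic_on_continuous1)

lemma harmonic_has_grad: "harmonic_on \<Omega> u \<Longrightarrow> x \<in> \<Omega> \<Longrightarrow> has_grad u (\<lambda>b. partial_deriv b u x) x"
  unfolding has_grad_def by (rule harmonic_on_has_derivative)

lemma harmonic_has_grad2: "harmonic_on \<Omega> u \<Longrightarrow> b \<in> Basis \<Longrightarrow> x \<in> \<Omega> \<Longrightarrow>
    has_grad (partial_deriv b u) (\<lambda>b'. partial_deriv b' (partial_deriv b u) x) x"
  unfolding has_grad_def by (rule harmonic_on_has_derivative2)

lemma scaled_norm_less:
  fixes r \<rho> A :: real
  assumes "r * \<rho> < A" "0 < r" "norm x \<le> \<rho>"
  shows "norm (r *\<^sub>R x) < A"
proof -
  have "r * norm x \<le> r * \<rho>" using assms by (intro mult_left_mono) auto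
  then have "r * norm x < A" using assms by linarith
  then show ?thesis using assms by simp
qed

lemma continuous_on_dilate:
  fixes f :: "'a::euclidean_space \<Rightarrow> complex"
  assumes "continuous_on (ball 0 A) f" "r * \<rho> < A" "0 < r"
  shows "continuous_on (cball 0 \<rho>) (\<lambda>x. f (r *\<^sub>R x))"
  by (rule continuous_on_compose2[OF assms(1)])
    (use scaled_norm_less[OF assms(2,3)] in \<open>auto intro!: continuous_intros simp del: norm_scaleR\<close>)

text \<open>The divergence theorem for \<psi> times the field \<open>w\<close>, the Wronskian-type
  combination of the dilated functions and their gradients. In the divergence of \<open>w\<close>
  the mixed products of first derivatives cancel and the second derivatives sum to Laplacians. Only
  the gradient of \<psi> survives; it is \<open>k * \<phi>\<close> times \<open>x\<close>, which
  contracts \<open>w\<close> to the two radial derivatives.\<close>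

lemma green_bump:
  fixes u v :: "'a::euclidean_space \<Rightarrow> complex"
  assumes u: "harmonic_on (ball 0 A) u" and v: "harmonic_on (ball 0 B) v"
    and pos: "0 < \<rho>" "0 < r" "0 < s" and r: "r * \<rho> < A" and s: "s * \<rho> < B"
  shows "(\<integral>x. of_real (bump \<rho> (Suc n) x) *
      (euler u (r *\<^sub>R x) * v (s *\<^sub>R x) - u (r *\<^sub>R x) * euler v (s *\<^sub>R x)) \<partial>lborel) = 0"
proof -
  \<comment> \<open>A slightly larger radius is needed because gradients must exist on the boundary
    sphere of the support as well.\<close>
  have "\<rho> < min (A / r) (B / s)" using pos r s by (simp add: field_simps)
  then obtain \<rho>' where "\<rho> < \<rho>'" "\<rho>' < min (A / r) (B / s)" using dense by blast
  then have \<rho>': "\<rho> < \<rho>'" "r * \<rho>' < A" "s * \<rho>' < B" using pos by (auto simp: field_simps)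
  define w where "w = (\<lambda>b x. of_real r * partial_deriv b u (r *\<^sub>R x) * v (s *\<^sub>R x)
      - of_real s * (u (r *\<^sub>R x) * partial_deriv b v (s *\<^sub>R x)))"
  define dw where "dw = (\<lambda>b b' x. of_real r * ((of_real r * partial_deriv b' (partial_deriv b u) (r *\<^sub>R x)) * v (s *\<^sub>R x)
        + partial_deriv b u (r *\<^sub>R x) * (of_real s * partial_deriv b' v (s *\<^sub>R x)))
      - of_real s * ((of_real r * partial_deriv b' u (r *\<^sub>R x)) * partial_deriv b v (s *\<^sub>R x)
        + u (r *\<^sub>R x) * (of_real s * partial_deriv b' (partial_deriv b v) (s *\<^sub>R x))))"
  define \<phi> where "\<phi> = (\<lambda>x::'a. complex_of_real (bump \<rho> (Suc n) x))"
  define \<psi> where "\<psi> = (\<lambda>x::'a. complex_of_real (bump \<rho> (Suc (Suc n)) x))"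
  define k :: complex where "k = - 2 * of_nat (Suc (Suc n))"
  define D where "D = (\<lambda>b x b'. k * \<phi> x * of_real (x \<bullet> b') * w b x + \<psi> x * dw b b' x)"
  have k: "k \<noteq> 0" unfolding k_def by (simp del: of_nat_Suc)
  have w: "has_grad (w b) (\<lambda>b'. dw b b' x) x" if "b \<in> Basis" "x \<in> ball 0 \<rho>'" for b x
  proof -
    have in_b: "r *\<^sub>R x \<in> ball 0 A" "s *\<^sub>R x \<in> ball 0 B"
      using scaled_norm_less[OF \<rho>'(2) pos(2), of x] scaled_norm_less[OF \<rho>'(3) pos(3), of x] that by auto
    have "has_grad (w b) (\<lambda>b'. (0 * (partial_deriv b u (r *\<^sub>R x) * v (s *\<^sub>R x)) +
        of_real r * ((of_real r * partial_deriv b' (partial_deriv b u) (r *\<^sub>R x)) * v (s *\<^sub>R x)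
        + partial_deriv b u (r *\<^sub>R x) * (of_real s * partial_deriv b' v (s *\<^sub>R x))))
      - (0 * (u (r *\<^sub>R x) * partial_deriv b v (s *\<^sub>R x)) + of_real s * ((of_real r * partial_deriv b' u (r *\<^sub>R x)) * partial_deriv b v (s *\<^sub>R x)
        + u (r *\<^sub>R x) * (of_real s * partial_deriv b' (partial_deriv b v) (s *\<^sub>R x))))) x"
      unfolding w_def mult.assoc[of "of_real r" "partial_deriv b u _"]
      by (intro has_grad_diff has_grad_mult has_grad_const has_grad_dilate[where F = "\<lambda>b'. partial_deriv b' _ _"]
          harmonic_has_grad[OF u] harmonic_has_grad[OF v] harmonic_has_grad2[OF u] harmonic_has_grad2[OF v] in_b that)
    then show ?thesis by (simp add: dw_def)
  qed
  have cont_w: "continuous_on (cball 0 \<rho>) (w b)" if "b \<in> Basis" for b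
    unfolding w_def by (intro continuous_intros continuous_on_dilate[OF _ r pos(2)] continuous_on_dilate[OF _ s pos(3)]
        harmonic_on_continuous[OF u] harmonic_on_continuous[OF v] harmonic_on_continuous1[OF u]
        harmonic_on_continuous1[OF v] that)
  have cont_dw: "continuous_on (cball 0 \<rho>) (dw b b')" if "b \<in> Basis" "b' \<in> Basis" for b b'
    unfolding dw_def by (intro continuous_intros continuous_on_dilate[OF _ r pos(2)] continuous_on_dilate[OF _ s pos(3)]
        harmonic_on_continuous[OF u] harmonic_on_continuous[OF v] harmonic_on_continuous1[OF u]
        harmonic_on_continuous1[OF v] harmonic_on_continuous2[OF u] harmonic_on_continuous2[OF v] that)
  have out: "\<phi> x = 0" "\<psi> x = 0" if "x \<notin> ball 0 \<rho>" for x
    using bump_outside[of "Suc n" \<rho> x] bump_outside[of "Suc (Suc n)" \<rho> x] pos that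
    by (auto simp: \<phi>_def \<psi>_def)
  have grad: "has_grad (\<lambda>x. \<psi> x * w b x) (D b x) x" if "b \<in> Basis" "x \<in> ball 0 \<rho>'" for b x
    using has_grad_mult[OF has_grad_bump[of \<rho> n x] w[OF that]]
    unfolding D_def k_def \<phi>_def \<psi>_def .
  have contD: "continuous_on (cball 0 \<rho>) (\<lambda>x. D b x b')" if "b \<in> Basis" "b' \<in> Basis" for b b'
    unfolding D_def \<phi>_def \<psi>_def by (intro continuous_intros cont_w cont_dw that)
  have "D b x b = indicator (cball 0 \<rho>) x *\<^sub>R D b x b" for b x
    using out[of x] by (auto simp: D_def indicator_def)
  then have int: "integrable lborel (\<lambda>x. D b x b)" "(\<integral>x. D b x b \<partial>lborel) = 0" if "b \<in> Basis" for b
    using integral_grad_compact_support[OF \<rho>'(1) _ grad[OF that] contD[OF that] that] out by auto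
  have sumD: "(\<Sum>b\<in>Basis. D b x b) = k * (\<phi> x *
      (euler u (r *\<^sub>R x) * v (s *\<^sub>R x) - u (r *\<^sub>R x) * euler v (s *\<^sub>R x)))" for x
  proof (cases "x \<in> ball 0 \<rho>")
    case False
    then show ?thesis using out by (simp add: D_def)
  next
    case True
    have in_b: "r *\<^sub>R x \<in> ball 0 A" "s *\<^sub>R x \<in> ball 0 B"
      using scaled_norm_less[OF r pos(2), of x] scaled_norm_less[OF s pos(3), of x] True by auto
    have "(\<Sum>b\<in>Basis. dw b b x) = of_real (r * r) * (\<Sum>b\<in>Basis. partial_deriv b (partial_deriv b u) (r *\<^sub>R x)) * v (s *\<^sub>R x)
       - of_real (s * s) * u (r *\<^sub>R x) * (\<Sum>b\<in>Basis. partial_deriv b (partial_deriv b v) (s *\<^sub>R x))"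
      unfolding sum_distrib_left sum_distrib_right sum_subtractf[symmetric]
      by (intro sum.cong) (auto simp: dw_def algebra_simps)
    also have "\<dots> = 0" using harmonic_on_laplacian[OF u in_b(1)] harmonic_on_laplacian[OF v in_b(2)] by simp
    finally have 1: "(\<Sum>b\<in>Basis. dw b b x) = 0" .
    have 2: "(\<Sum>b\<in>Basis. of_real (x \<bullet> b) * w b x) =
       euler u (r *\<^sub>R x) * v (s *\<^sub>R x) - u (r *\<^sub>R x) * euler v (s *\<^sub>R x)"
      unfolding euler_def sum_distrib_left sum_distrib_right sum_subtractf[symmetric]
      by (intro sum.cong) (auto simp: w_def scaleR_conv_of_real algebra_simps)
    have "(\<Sum>b\<in>Basis. D b x b) = k * \<phi> x * (\<Sum>b\<in>Basis. of_real (x \<bullet> b) * w b x) + \<psi> x * (\<Sum>b\<in>Basis. dw b b x)"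
      unfolding sum_distrib_left sum.distrib[symmetric] by (simp add: D_def mult.assoc)
    then show ?thesis using 1 2 by simp
  qed
  have "(\<integral>x. (\<Sum>b\<in>Basis. D b x b) \<partial>lborel) = 0"
    by (subst Bochner_Integration.integral_sum) (use int in auto)
  then show ?thesis unfolding sumD using k by (simp add: \<phi>_def)
qed

text \<open>Moving along \<open>(exp t * r, exp (- t) * s)\<close> keeps the product fixed, and the
  derivative of the integral in \<open>t\<close> is exactly the expression that
  \<open>green_bump\<close> shows to vanish. In terms of homogeneous expansions, the parts of degree
  k of \<open>u\<close> and \<open>v\<close> pair only with each other and contribute a multiple of
  \<open>(r * s) ^ k\<close>.\<close>

lemma dilation_pairing:
  fixes u v :: "'a::euclidean_space \<Rightarrow> complex"
  assumes u: "harmonic_on (ball 0 A) u" and v: "harmonic_on (ball 0 B) v"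
    and pos: "0 < \<rho>" "0 < r" "0 < s" "0 < r'" "0 < s'" and eq: "r * s = r' * s'"
    and r: "r * \<rho> < A" "r' * \<rho> < A" and s: "s * \<rho> < B" "s' * \<rho> < B"
  shows "(\<integral>x. of_real (bump \<rho> (Suc n) x) * (u (r *\<^sub>R x) * v (s *\<^sub>R x)) \<partial>lborel) =
    (\<integral>x. of_real (bump \<rho> (Suc n) x) * (u (r' *\<^sub>R x) * v (s' *\<^sub>R x)) \<partial>lborel)"
proof -
  define T where "T = ln (r' / r)"
  have T: "exp T * r = r'" "exp (- T) * s = s'"
  proof -
    show "exp T * r = r'" using pos by (simp add: T_def)
    then show "exp (- T) * s = s'" using pos eq by (auto simp: exp_minus field_simps)
  qed
  define S where "S = closed_segment 0 T"
  define \<phi> where "\<phi> = (\<lambda>x::'a. complex_of_real (bump \<rho> (Suc n) x))"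
  define F where "F = (\<lambda>t. \<integral>x. \<phi> x * (u ((exp t * r) *\<^sub>R x) * v ((exp (- t) * s) *\<^sub>R x)) \<partial>lborel)"
  \<comment> \<open>Both dilation factors are monotone in \<open>t\<close>, so along the segment
    they stay below the larger of their two end values and the arguments never leave the
    domains.\<close>
  have S: "exp t * r * \<rho> < A" "exp (- t) * s * \<rho> < B" if "t \<in> S" for t
  proof -
    from that have "(0 \<le> t \<and> t \<le> T) \<or> (T \<le> t \<and> t \<le> 0)"
      by (auto simp: S_def closed_segment_eq_real_ivl split: if_splits)
    then have "exp t \<le> 1 \<or> exp t \<le> exp T" "exp (- t) \<le> 1 \<or> exp (- t) \<le> exp (- T)" by auto
    then have "exp t * r \<le> r \<or> exp t * r \<le> r'" "exp (- t) * s \<le> s \<or> exp (- t) * s \<le> s'"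
      using T pos mult_right_mono[of "exp t" "exp T" r] mult_right_mono[of "exp (-t)" "exp (-T)" s] by auto
    then have "exp t * r * \<rho> \<le> r * \<rho> \<or> exp t * r * \<rho> \<le> r' * \<rho>"
      "exp (- t) * s * \<rho> \<le> s * \<rho> \<or> exp (- t) * s * \<rho> \<le> s' * \<rho>" using pos by auto
    then show "exp t * r * \<rho> < A" "exp (- t) * s * \<rho> < B" using r s by auto
  qed
  have "(F has_derivative (\<lambda>h. 0)) (at t0)" if t0: "t0 \<in> S" for t0
  proof -
    \<comment> \<open>Radii strictly between: on the closed balls of radius \<open>A'\<close> and
      \<open>B'\<close> the functions are bounded, and for \<open>t\<close> near \<open>t0\<close>
      all arguments remain in these balls. This provides a majorant that is uniform in
      \<open>t\<close>.\<close>
    obtain A' where A': "exp t0 * r * \<rho> < A'" "A' < A" using dense[OF S(1)[OF t0]] by blast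
    obtain B' where B': "exp (- t0) * s * \<rho> < B'" "B' < B" using dense[OF S(2)[OF t0]] by blast
    have "open {t. exp t * r * \<rho> < A' \<and> exp (- t) * s * \<rho> < B'}"
      by (intro open_Collect_conj open_Collect_less continuous_intros)
    then obtain e where e: "0 < e" "\<And>t. t \<in> ball t0 e \<Longrightarrow> exp t * r * \<rho> < A' \<and> exp (- t) * s * \<rho> < B'"
      using A'(1) B'(1) unfolding open_contains_ball by blast
    have cu: "continuous_on (cball 0 A') u" "continuous_on (cball 0 A') (euler u)"
      using cball_subset_ball_iff[of "0::'a" A' 0 A] A'
      by (auto intro: continuous_on_subset[OF harmonic_on_continuous[OF u]] continuous_on_subset[OF continuous_on_euler[OF u]])
    have cv: "continuous_on (cball 0 B') v" "continuous_on (cball 0 B') (euler v)"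
      using cball_subset_ball_iff[of "0::'a" B' 0 B] B'
      by (auto intro: continuous_on_subset[OF harmonic_on_continuous[OF v]] continuous_on_subset[OF continuous_on_euler[OF v]])
    obtain C1 where C1: "0 \<le> C1" "\<And>y. y \<in> cball 0 A' \<Longrightarrow> norm (u y) \<le> C1" using bounded_continuous_on_cball[OF cu(1)] by blast
    obtain C2 where C2: "0 \<le> C2" "\<And>y. y \<in> cball 0 A' \<Longrightarrow> norm (euler u y) \<le> C2" using bounded_continuous_on_cball[OF cu(2)] by blast
    obtain C3 where C3: "0 \<le> C3" "\<And>y. y \<in> cball 0 B' \<Longrightarrow> norm (v y) \<le> C3" using bounded_continuous_on_cball[OF cv(1)] by blast
    obtain C4 where C4: "0 \<le> C4" "\<And>y. y \<in> cball 0 B' \<Longrightarrow> norm (euler v y) \<le> C4" using bounded_continuous_on_cball[OF cv(2)] by blast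
    define w where "w = (\<lambda>x::'a. indicator (ball 0 \<rho>) x * ((\<rho>\<^sup>2) ^ Suc n * (C2 * C3 + C1 * C4)))"
    have w: "integrable lborel w" unfolding w_def
      by (rule integrable_indicator_mult_const) auto
    define g where "g = (\<lambda>t x. \<phi> x * (u ((exp t * r) *\<^sub>R x) * v ((exp (- t) * s) *\<^sub>R x)))"
    define G where "G = (\<lambda>t x. \<phi> x * (euler u ((exp t * r) *\<^sub>R x) * v ((exp (- t) * s) *\<^sub>R x)
        - u ((exp t * r) *\<^sub>R x) * euler v ((exp (- t) * s) *\<^sub>R x)))"
    have out: "\<phi> x = 0" if "x \<notin> ball 0 \<rho>" for x
      using bump_outside[of "Suc n" \<rho> x] pos that by (auto simp: \<phi>_def)
    have gi: "integrable lborel (g t)" if t: "t \<in> ball t0 e" for t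
      unfolding g_def \<phi>_def
      by (intro integrable_bump_mult continuous_intros continuous_on_dilate[OF harmonic_on_continuous[OF u]]
        continuous_on_dilate[OF harmonic_on_continuous[OF v]])
        (use e(2)[OF t] A' B' pos in auto)
    have in_b: "(exp t * r) *\<^sub>R x \<in> ball 0 A'" "(exp (- t) * s) *\<^sub>R x \<in> ball 0 B'"
      if "t \<in> ball t0 e" "x \<in> ball 0 \<rho>" for t and x :: 'a
      using scaled_norm_less[of "exp t * r" \<rho> A' x] scaled_norm_less[of "exp (- t) * s" \<rho> B' x]
        e(2)[OF that(1)] that(2) pos by auto
    have gd: "((\<lambda>t. g t x) has_derivative (\<lambda>h. h *\<^sub>R G t x)) (at t)" if t: "t \<in> ball t0 e" for t x
    proof (cases "x \<in> ball 0 \<rho>")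
      case False
      then show ?thesis using out by (simp add: g_def G_def)
    next
      case True
      have du: "((\<lambda>t. u ((exp t * r) *\<^sub>R x)) has_derivative (\<lambda>h. h *\<^sub>R euler u ((exp t * r) *\<^sub>R x))) (at t)"
      proof (rule has_derivative_eq_rhs)
        show "((\<lambda>t. u ((exp t * r) *\<^sub>R x)) has_derivative (\<lambda>h. \<Sum>b\<in>Basis.
            (((h * exp t) * r) *\<^sub>R x \<bullet> b) *\<^sub>R partial_deriv b u ((exp t * r) *\<^sub>R x))) (at t)"
          by (rule has_derivative_compose[where f = "\<lambda>t. (exp t * r) *\<^sub>R x" and f' = "\<lambda>h. ((h * exp t) * r) *\<^sub>R x" and g = u,
                OF _ harmonic_on_has_derivative[OF u]])
            (use in_b[OF t True] A' in \<open>auto intro!: derivative_eq_intros\<close>)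
      qed (simp add: euler_def fun_eq_iff scaleR_sum_right mult_ac)
      have dv: "((\<lambda>t. v ((exp (- t) * s) *\<^sub>R x)) has_derivative (\<lambda>h. - (h *\<^sub>R euler v ((exp (- t) * s) *\<^sub>R x)))) (at t)"
      proof (rule has_derivative_eq_rhs)
        show "((\<lambda>t. v ((exp (- t) * s) *\<^sub>R x)) has_derivative (\<lambda>h. \<Sum>b\<in>Basis.
            (((- h * exp (- t)) * s) *\<^sub>R x \<bullet> b) *\<^sub>R partial_deriv b v ((exp (- t) * s) *\<^sub>R x))) (at t)"
          by (rule has_derivative_compose[where f = "\<lambda>t. (exp (- t) * s) *\<^sub>R x" and f' = "\<lambda>h. ((- h * exp (- t)) * s) *\<^sub>R x" and g = v,
                OF _ harmonic_on_has_derivative[OF v]])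
            (use in_b[OF t True] B' in \<open>auto intro!: derivative_eq_intros\<close>)
      qed (simp add: euler_def fun_eq_iff scaleR_sum_right mult_ac sum_negf)
      have "((\<lambda>t. \<phi> x * (u ((exp t * r) *\<^sub>R x) * v ((exp (- t) * s) *\<^sub>R x))) has_derivative
         (\<lambda>h. \<phi> x * (u ((exp t * r) *\<^sub>R x) * - (h *\<^sub>R euler v ((exp (- t) * s) *\<^sub>R x)) +
            h *\<^sub>R euler u ((exp t * r) *\<^sub>R x) * v ((exp (- t) * s) *\<^sub>R x)))) (at t)"
        by (intro has_derivative_mult_right has_derivative_mult du dv)
      then show ?thesis unfolding g_def
        by (rule has_derivative_eq_rhs) (simp add: G_def fun_eq_iff scaleR_conv_of_real algebra_simps)
    qed
    have dom: "norm (h *\<^sub>R G t x) \<le> w x * norm h" if t: "t \<in> ball t0 e" for t x and h :: real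
    proof (cases "x \<in> ball 0 \<rho>")
      case False
      then show ?thesis using out by (simp add: G_def w_def)
    next
      case True
      have in_c: "(exp t * r) *\<^sub>R x \<in> cball 0 A'" "(exp (- t) * s) *\<^sub>R x \<in> cball 0 B'"
        using in_b[OF t True] by (auto simp: less_imp_le)
      have "norm (G t x) \<le> (\<rho>\<^sup>2) ^ Suc n * (C2 * C3 + C1 * C4)"
        unfolding G_def norm_mult
      proof (rule mult_mono)
        show "norm (\<phi> x) \<le> (\<rho>\<^sup>2) ^ Suc n"
          using bump_le[of \<rho> "Suc n" x] bump_nonneg[of \<rho> "Suc n" x] by (simp add: \<phi>_def del: power_Suc)
        have "norm (euler u ((exp t * r) *\<^sub>R x) * v ((exp (- t) * s) *\<^sub>R x)) \<le> C2 * C3"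
          "norm (u ((exp t * r) *\<^sub>R x) * euler v ((exp (- t) * s) *\<^sub>R x)) \<le> C1 * C4"
          unfolding norm_mult by (intro mult_mono C1 C2 C3 C4 in_c norm_ge_zero)+
        then show "norm (euler u ((exp t * r) *\<^sub>R x) * v ((exp (- t) * s) *\<^sub>R x) -
            u ((exp t * r) *\<^sub>R x) * euler v ((exp (- t) * s) *\<^sub>R x)) \<le> C2 * C3 + C1 * C4"
          by (rule order_trans[OF norm_triangle_ineq4 add_mono])
      qed auto
      then show ?thesis using True by (simp add: w_def mult.commute mult_left_mono)
    qed
    have "((\<lambda>t. \<integral>x. g t x \<partial>lborel) has_derivative (\<lambda>h. \<integral>x. h *\<^sub>R G t0 x \<partial>lborel)) (at t0)"
      by (rule has_derivative_dominated_integral[OF e(1) gi gd dom w])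
    moreover have "(\<integral>x. G t0 x \<partial>lborel) = 0"
      unfolding G_def \<phi>_def by (rule green_bump[OF u v]) (use S[OF t0] pos in auto)
    ultimately show ?thesis by (simp add: F_def g_def)
  qed
  then have "\<exists>c. \<forall>t\<in>S. F t = c"
    by (intro has_derivative_zero_constant) (auto simp: S_def has_derivative_at_withinI)
  then have "F 0 = F T" by (auto simp: S_def)
  then show ?thesis using T by (simp add: F_def \<phi>_def)
qed

section \<open>Mean values and regularity\<close>

lemma integrable_bump: "0 \<le> \<rho> \<Longrightarrow> integrable lborel (bump \<rho> (Suc n) :: 'a::euclidean_space \<Rightarrow> real)"
  using integrable_bump_mult[of \<rho> "\<lambda>_::'a. 1" n] by (simp add: complex_of_real_integrable_eq)

lemma integral_bump_pos:
  assumes "0 < \<rho>"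
  shows "0 < (\<integral>x. bump \<rho> (Suc n) (x::'a::euclidean_space) \<partial>lborel)"
proof -
  have "0 < (\<integral>x. indicator (ball (0::'a) (\<rho> / 2)) x * (\<rho>\<^sup>2 / 2) ^ Suc n \<partial>lborel)"
    using assms content_ball_pos[of "\<rho> / 2" "0::'a"] by simp
  also have "\<dots> \<le> (\<integral>x. bump \<rho> (Suc n) (x::'a) \<partial>lborel)"
  proof (rule integral_mono[OF _ integrable_bump])
    show "integrable lborel (\<lambda>x. indicator (ball (0::'a) (\<rho> / 2)) x * (\<rho>\<^sup>2 / 2) ^ Suc n)"
      by (rule integrable_indicator_mult_const) auto
    show "indicator (ball 0 (\<rho> / 2)) x * (\<rho>\<^sup>2 / 2) ^ Suc n \<le> bump \<rho> (Suc n) x" for x :: 'a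
    proof (cases "x \<in> ball 0 (\<rho> / 2)")
      case True
      then have "(norm x)\<^sup>2 \<le> (\<rho> / 2)\<^sup>2" by (intro power_mono) auto
      moreover have "(\<rho> / 2)\<^sup>2 = \<rho>\<^sup>2 / 4" by (simp add: power_divide)
      moreover have "0 \<le> \<rho>\<^sup>2" by simp
      ultimately have "\<rho>\<^sup>2 / 2 \<le> \<rho>\<^sup>2 - x \<bullet> x" unfolding dot_square_norm by linarith
      then have "(\<rho>\<^sup>2 / 2) ^ Suc n \<le> bump \<rho> (Suc n) x" unfolding bump_def
        by (intro power_mono order_trans[OF _ max.cobounded2]) auto
      then show ?thesis using True by simp
    qed (simp add: bump_nonneg)
  qed (use assms in auto)
  finally show ?thesis .
qed

text \<open>Pairing with \<open>v = 1\<close> lets \<open>u\<close> be shrunk by the factor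
  \<open>1 / (k + 1)\<close>, since the opposite dilation of a constant costs nothing. As
  \<open>k\<close> grows, dominated convergence replaces the shrunk function by
  \<open>u 0\<close>.\<close>

lemma mean_value_bump_0:
  fixes u :: "'a::euclidean_space \<Rightarrow> complex"
  assumes u: "harmonic_on (ball 0 R) u" and "0 < \<rho>" "\<rho> < R"
  shows "(\<integral>y. of_real (bump \<rho> (Suc n) y) * u y \<partial>lborel)
    = of_real (\<integral>y. bump \<rho> (Suc n) (y::'a) \<partial>lborel) * u 0"
proof -
  define F where "F = (\<lambda>k::nat. \<integral>y. of_real (bump \<rho> (Suc n) y) * u (inverse (real (Suc k)) *\<^sub>R y) \<partial>lborel)"
  have const: "F k = F 0" for k
  proof -
    have "(\<integral>x. of_real (bump \<rho> (Suc n) x) * (u (1 *\<^sub>R x) * (\<lambda>_. 1) (1 *\<^sub>R x)) \<partial>lborel) =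
       (\<integral>x. of_real (bump \<rho> (Suc n) x) * (u (inverse (real (Suc k)) *\<^sub>R x) * (\<lambda>_. 1) (real (Suc k) *\<^sub>R x)) \<partial>lborel)"
    proof (rule dilation_pairing[where r = 1 and s = 1 and r' = "inverse (real (Suc k))" and s' = "real (Suc k)",
          OF u harmonic_on_const[OF open_ball, where k = 1]])
      show "real (Suc k) * \<rho> < real (Suc k) * \<rho> + 1" "1 * \<rho> < real (Suc k) * \<rho> + 1"
        using assms by (auto simp: algebra_simps intro: add_pos_nonneg)
      have "inverse (real (Suc k)) * \<rho> \<le> 1 * \<rho>" using assms by (intro mult_right_mono) (auto simp: field_simps)
      then show "inverse (real (Suc k)) * \<rho> < R" using assms(3) by linarith
      show "1 * 1 = inverse (real (Suc k)) * real (Suc k)" by (simp del: of_nat_Suc)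
    qed (use assms in auto)
    then show ?thesis by (simp add: F_def)
  qed
  have sub: "cball 0 \<rho> \<subseteq> ball (0::'a) R" using assms by auto
  have cu: "continuous_on (cball 0 \<rho>) u" by (rule continuous_on_subset[OF harmonic_on_continuous[OF u] sub])
  obtain C where C: "0 \<le> C" "\<And>y. y \<in> cball 0 \<rho> \<Longrightarrow> norm (u y) \<le> C"
    using bounded_continuous_on_cball[OF cu] by blast
  have small: "norm (inverse (real (Suc k)) *\<^sub>R y) \<le> \<rho>" if "y \<in> ball 0 \<rho>" for k and y :: 'a
  proof -
    have "inverse (real (Suc k)) * norm y \<le> 1 * norm y" by (intro mult_right_mono) (auto simp: field_simps)
    then show ?thesis using that by simp
  qed
  have "F \<longlonglongrightarrow> (\<integral>y. of_real (bump \<rho> (Suc n) (y::'a)) * u 0 \<partial>lborel)"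
    unfolding F_def
  proof (rule integral_dominated_convergence[where w = "\<lambda>y::'a. bump \<rho> (Suc n) y * C"])
    show "(\<lambda>y::'a. of_real (bump \<rho> (Suc n) y) * u 0) \<in> borel_measurable lborel" by measurable
    show "(\<lambda>y. of_real (bump \<rho> (Suc n) y) * u (inverse (real (Suc k)) *\<^sub>R y)) \<in> borel_measurable lborel" for k
    proof (rule borel_measurable_integrable[OF integrable_bump_mult])
      show "continuous_on (cball 0 \<rho>) (\<lambda>y. u (inverse (real (Suc k)) *\<^sub>R y))"
      proof (rule continuous_on_dilate[OF harmonic_on_continuous[OF u]])
        have "inverse (real (Suc k)) * \<rho> \<le> 1 * \<rho>" using assms by (intro mult_right_mono) (auto simp: field_simps)
        then show "inverse (real (Suc k)) * \<rho> < R" using assms(3) by linarith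
      qed auto
    qed (use assms in auto)
    show "integrable lborel (\<lambda>y::'a. bump \<rho> (Suc n) y * C)"
      using assms by (intro integrable_mult_left integrable_bump) auto
    show "AE y in lborel. (\<lambda>k. of_real (bump \<rho> (Suc n) y) * u (inverse (real (Suc k)) *\<^sub>R y)) \<longlonglongrightarrow>
        of_real (bump \<rho> (Suc n) y) * u 0"
    proof (intro AE_I2 tendsto_mult tendsto_const)
      fix y :: 'a
      have "(\<lambda>k. inverse (real (Suc k)) *\<^sub>R y) \<longlonglongrightarrow> 0 *\<^sub>R y"
        by (intro tendsto_intros LIMSEQ_inverse_real_of_nat)
      moreover have "isCont u 0"
        using harmonic_on_continuous[OF u] assms by (simp add: continuous_on_eq_continuous_at)
      ultimately show "(\<lambda>k. u (inverse (real (Suc k)) *\<^sub>R y)) \<longlonglongrightarrow> u 0"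
        using isCont_tendsto_compose by fastforce
    qed
    show "AE y in lborel. norm (of_real (bump \<rho> (Suc n) y) * u (inverse (real (Suc k)) *\<^sub>R y)) \<le> bump \<rho> (Suc n) y * C" for k
    proof (rule AE_I2)
      fix y :: 'a
      show "norm (of_real (bump \<rho> (Suc n) y) * u (inverse (real (Suc k)) *\<^sub>R y)) \<le> bump \<rho> (Suc n) y * C"
        using bump_outside[of "Suc n" \<rho> y] bump_nonneg[of \<rho> "Suc n" y] C small[of y k] assms
        by (cases "y \<in> ball 0 \<rho>") (auto simp: norm_mult intro!: mult_left_mono)
    qed
  qed
  then have "F 0 = (\<integral>y. of_real (bump \<rho> (Suc n) (y::'a)) * u 0 \<partial>lborel)"
    using const LIMSEQ_unique[OF tendsto_const] by (metis (no_types, lifting) LIMSEQ_const_iff ext)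
  then show ?thesis by (simp add: F_def)
qed

lemma continuous_on_zero_extension_measurable:
  fixes u :: "'a::euclidean_space \<Rightarrow> complex"
  assumes "open S" "continuous_on S u"
  shows "(\<lambda>z. indicator S z *\<^sub>R u z) \<in> borel_measurable borel"
  by (intro borel_measurable_continuous_on_indicator assms) (use assms in auto)

lemma mean_value_bump:
  fixes u :: "'a::euclidean_space \<Rightarrow> complex"
  assumes u: "harmonic_on (ball x R) u" and "0 < \<rho>" "\<rho> < R"
  shows "(\<integral>z. of_real (bump \<rho> (Suc n) (z - x)) * u z \<partial>lborel)
    = of_real (\<integral>y. bump \<rho> (Suc n) (y::'a) \<partial>lborel) * u x"
proof -
  have "{y. x + y \<in> ball x R} = ball 0 R" by (auto simp: dist_norm)
  then have u': "harmonic_on (ball 0 R) (\<lambda>y. u (x + y))"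
    using harmonic_on_translate[OF open_ball u, of x] by simp
  have eq: "of_real (bump \<rho> (Suc n) (z - x)) * u z = of_real (bump \<rho> (Suc n) (z - x)) * (indicator (ball x R) z *\<^sub>R u z)" for z
    using bump_outside[of "Suc n" \<rho> "z - x"] assms by (auto simp: indicator_def dist_norm norm_minus_commute)
  have "(\<lambda>z. of_real (bump \<rho> (Suc n) (z - x)) * u z) \<in> borel_measurable borel"
    unfolding eq by (intro borel_measurable_times continuous_on_zero_extension_measurable
      harmonic_on_continuous[OF u]) auto
  from lborel_integral_translate[OF this, of x] mean_value_bump_0[OF u' assms(2,3), of n]
  show ?thesis by simp
qed

section \<open>Convolution kernels and interior regularity\<close>

lemma bounded_compact_support:
  fixes k :: "'a::euclidean_space \<Rightarrow> complex"
  assumes "continuous_on UNIV k" "\<And>y. y \<notin> ball 0 \<rho> \<Longrightarrow> k y = 0"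
  obtains C where "0 \<le> C" "\<And>y. norm (k y) \<le> C"
proof -
  obtain C where "0 \<le> C" "\<And>y. y \<in> cball 0 \<rho> \<Longrightarrow> norm (k y) \<le> C"
    using bounded_continuous_on_cball[OF continuous_on_subset[OF assms(1)], of 0 \<rho>] by blast
  with assms(2) that show ?thesis by (metis ball_subset_cball norm_zero subsetD)
qed

lemma integrable_mult_kernel:
  fixes W k :: "'a::euclidean_space \<Rightarrow> complex"
  assumes "integrable lborel W" "continuous_on UNIV k" "\<And>y. norm (k y) \<le> C"
  shows "integrable lborel (\<lambda>z. W z * k (z - x))"
proof (rule Bochner_Integration.integrable_bound[OF integrable_mult_right[OF integrable_norm[OF assms(1)], of C]])
  have [measurable]: "k \<in> borel_measurable borel" by (rule borel_measurable_continuous_onI[OF assms(2)])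
  show "(\<lambda>z. W z * k (z - x)) \<in> borel_measurable lborel" using assms(1) by measurable
  have "0 \<le> C" using assms(3) norm_ge_zero order_trans by blast
  then show "AE z in lborel. norm (W z * k (z - x)) \<le> norm (C * norm (W z))"
    using assms(3) by (intro AE_I2) (auto simp: norm_mult mult.commute[of C] intro!: mult_left_mono)
qed

lemma continuous_convolution:
  fixes W k :: "'a::euclidean_space \<Rightarrow> complex"
  assumes W: "integrable lborel W" and k: "continuous_on UNIV k" and C: "\<And>y. norm (k y) \<le> C"
  shows "continuous_on S (\<lambda>x. \<integral>z. W z * k (z - x) \<partial>lborel)"
proof (intro continuous_at_imp_continuous_on ballI)
  fix x
  note int = integrable_mult_kernel[OF W k C]
  have "0 \<le> C" using C norm_ge_zero order_trans by blast
  show "isCont (\<lambda>x. \<integral>z. W z * k (z - x) \<partial>lborel) x"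
    unfolding continuous_at_sequentially o_def
  proof (intro allI impI)
    fix X :: "nat \<Rightarrow> 'a" assume X: "X \<longlonglongrightarrow> x"
    show "(\<lambda>n. \<integral>z. W z * k (z - X n) \<partial>lborel) \<longlonglongrightarrow> (\<integral>z. W z * k (z - x) \<partial>lborel)"
    proof (rule integral_dominated_convergence[where w = "\<lambda>z. C * norm (W z)"])
      show "AE z in lborel. (\<lambda>n. W z * k (z - X n)) \<longlonglongrightarrow> W z * k (z - x)"
      proof (intro AE_I2 tendsto_mult tendsto_const)
        fix z
        have "isCont k (z - x)" using k by (simp add: continuous_on_eq_continuous_at)
        then show "(\<lambda>n. k (z - X n)) \<longlonglongrightarrow> k (z - x)"
          by (rule isCont_tendsto_compose) (intro tendsto_intros X)
      qed
      show "AE z in lborel. norm (W z * k (z - X n)) \<le> C * norm (W z)" for n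
        using C by (intro AE_I2) (auto simp: norm_mult mult.commute[of C] intro!: mult_left_mono)
    qed (use int W in \<open>auto intro: borel_measurable_integrable\<close>)
  qed
qed

text \<open>All differentiation falls on the kernel, so \<open>W\<close> need only be integrable;
  the minus sign comes from the argument \<open>z - x\<close>.\<close>

lemma has_grad_convolution:
  fixes W k :: "'a::euclidean_space \<Rightarrow> complex"
  assumes W: "integrable lborel W" and grad: "\<And>y. has_grad k (\<lambda>b. k1 b y) y"
    and C0: "\<And>y. norm (k y) \<le> C0" and C1: "\<And>b y. b \<in> Basis \<Longrightarrow> norm (k1 b y) \<le> C1 b"
    and k1: "\<And>b. b \<in> Basis \<Longrightarrow> continuous_on UNIV (k1 b)"
  shows "has_grad (\<lambda>x. \<integral>z. W z * k (z - x) \<partial>lborel) (\<lambda>b. \<integral>z. W z * (- k1 b (z - x)) \<partial>lborel) x"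
proof -
  have k: "continuous_on UNIV k"
    using grad unfolding has_grad_def by (auto intro!: continuous_at_imp_continuous_on has_derivative_continuous)
  define D where "D = (\<lambda>x z h. W z * (\<Sum>b\<in>Basis. (- h \<bullet> b) *\<^sub>R k1 b (z - x)))"
  have der: "((\<lambda>x. W z * k (z - x)) has_derivative D x z) (at x)" for x z
    unfolding D_def
    by (intro has_derivative_mult_right has_derivative_compose[where f = "\<lambda>x. z - x" and f' = "\<lambda>h. - h" and g = k,
          OF _ grad[unfolded has_grad_def]])
      (auto intro!: derivative_eq_intros)
  have dom: "norm (D x z h) \<le> (norm (W z) * (\<Sum>b\<in>Basis. C1 b)) * norm h" for x z h
  proof -
    have "norm (W z) * norm (\<Sum>b\<in>Basis. (- h \<bullet> b) *\<^sub>R k1 b (z - x)) \<le> norm (W z) * ((\<Sum>b\<in>Basis. C1 b) * norm (- h))"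
      by (intro mult_left_mono norm_gradient_le C1) auto
    then show ?thesis unfolding D_def norm_mult norm_minus_cancel by (simp only: mult.assoc)
  qed
  have "((\<lambda>x. \<integral>z. W z * k (z - x) \<partial>lborel) has_derivative (\<lambda>h. \<integral>z. D x z h \<partial>lborel)) (at x)"
    by (rule has_derivative_dominated_integral[where e = 1, OF _ integrable_mult_kernel[OF W k C0] der dom])
      (auto intro!: W)
  moreover have "(\<integral>z. D x z h \<partial>lborel) = (\<Sum>b\<in>Basis. (h \<bullet> b) *\<^sub>R (\<integral>z. W z * (- k1 b (z - x)) \<partial>lborel))" for h
  proof -
    have "(\<integral>z. D x z h \<partial>lborel) = (\<integral>z. (\<Sum>b\<in>Basis. (h \<bullet> b) *\<^sub>R (W z * (- k1 b (z - x)))) \<partial>lborel)"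
      by (simp add: D_def sum_distrib_left)
    also have "\<dots> = (\<Sum>b\<in>Basis. \<integral>z. (h \<bullet> b) *\<^sub>R (W z * (- k1 b (z - x))) \<partial>lborel)"
    proof (rule Bochner_Integration.integral_sum)
      fix b :: 'a assume "b \<in> Basis"
      then show "integrable lborel (\<lambda>z. (h \<bullet> b) *\<^sub>R (W z * (- k1 b (z - x))))"
        using integrable_mult_kernel[OF W k1 C1] by simp
    qed
    finally show ?thesis by (simp only: integral_scaleR_right)
  qed
  ultimately show ?thesis unfolding has_grad_def by simp
qed

text \<open>\<open>kern0\<close>, \<open>kern1\<close> and \<open>kern2\<close> are the weight with
  exponent 4 and its first and second partial derivatives: 8 is 2 * 4, and 48 is 8 * (2 * 3). After
  two derivatives the exponent is still positive, so \<open>kern2\<close> is continuous.\<close>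

definition kern0 :: "real \<Rightarrow> 'a::euclidean_space \<Rightarrow> complex" where
  "kern0 \<rho> y = of_real (bump \<rho> 4 y)"

definition kern1 :: "real \<Rightarrow> 'a \<Rightarrow> 'a::euclidean_space \<Rightarrow> complex" where
  "kern1 \<rho> b y = of_real (- 8 * (bump \<rho> 3 y * (y \<bullet> b)))"

definition kern2 :: "real \<Rightarrow> 'a \<Rightarrow> 'a \<Rightarrow> 'a::euclidean_space \<Rightarrow> complex" where
  "kern2 \<rho> b b' y = of_real (48 * bump \<rho> 2 y * (y \<bullet> b) * (y \<bullet> b') - 8 * bump \<rho> 3 y * (b \<bullet> b'))"

lemma kern2_commute: "kern2 \<rho> b b' = kern2 \<rho> b' b"
  by (simp add: kern2_def fun_eq_iff inner_commute mult_ac)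

lemma continuous_on_kern:
  "continuous_on S (kern0 \<rho>)" "continuous_on S (kern1 \<rho> b)" "continuous_on S (kern2 \<rho> b b')"
  unfolding kern0_def kern1_def kern2_def by (intro continuous_intros)+

lemma kern_outside:
  assumes "0 \<le> \<rho>" "y \<notin> ball 0 \<rho>"
  shows "kern0 \<rho> y = 0" "kern1 \<rho> b y = 0" "kern2 \<rho> b b' y = 0"
  using bump_outside[OF _ assms, of 4] bump_outside[OF _ assms, of 3] bump_outside[OF _ assms, of 2]
  by (simp_all add: kern0_def kern1_def kern2_def)

lemma has_grad_of_real_inner: "has_grad (\<lambda>y. of_real (y \<bullet> b)) (\<lambda>b'. of_real (b \<bullet> b')) y"
proof -
  have "((\<lambda>y. complex_of_real (y \<bullet> b)) has_derivative (\<lambda>h. of_real (h \<bullet> b))) (at y)"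
    by (auto intro!: derivative_eq_intros)
  moreover have "complex_of_real (h \<bullet> b) = (\<Sum>b'\<in>Basis. (h \<bullet> b') *\<^sub>R of_real (b \<bullet> b'))" for h
    by (subst euclidean_inner) (simp add: scaleR_conv_of_real)
  ultimately show ?thesis by (simp add: has_grad_def)
qed

lemma has_grad_kern0: "has_grad (kern0 \<rho>) (\<lambda>b. kern1 \<rho> b y) y"
  using has_grad_bump[of \<rho> 2 y] by (simp add: kern0_def[abs_def] kern1_def numeral_eq_Suc mult_ac)

lemma has_grad_kern1: "has_grad (kern1 \<rho> b) (\<lambda>b'. kern2 \<rho> b b' y) y"
proof -
  have "has_grad (\<lambda>y. (- 8) * (complex_of_real (bump \<rho> (Suc (Suc 1)) y) * of_real (y \<bullet> b)))
     (\<lambda>b'. 0 * (complex_of_real (bump \<rho> (Suc (Suc 1)) y) * of_real (y \<bullet> b)) + (- 8) * ((- 2 * of_nat (Suc (Suc 1)) * of_real (bump \<rho> (Suc 1) y) * of_real (y \<bullet> b')) *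
       of_real (y \<bullet> b) + of_real (bump \<rho> (Suc (Suc 1)) y) * of_real (b \<bullet> b'))) y"
    by (intro has_grad_mult has_grad_const has_grad_bump has_grad_of_real_inner)
  then show ?thesis by (simp add: kern1_def[abs_def] kern2_def numeral_eq_Suc algebra_simps)
qed

lemma convolution_kern_grads:
  fixes W :: "'a::euclidean_space \<Rightarrow> complex"
  assumes "0 \<le> \<rho>" and W: "integrable lborel W"
  shows "has_grad (\<lambda>x. \<integral>z. W z * kern0 \<rho> (z - x) \<partial>lborel) (\<lambda>b. \<integral>z. W z * (- kern1 \<rho> b (z - x)) \<partial>lborel) x"
    and "b \<in> Basis \<Longrightarrow> has_grad (\<lambda>x. \<integral>z. W z * (- kern1 \<rho> b (z - x)) \<partial>lborel)
        (\<lambda>b'. \<integral>z. W z * kern2 \<rho> b b' (z - x) \<partial>lborel) x"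
    and "continuous_on S (\<lambda>x. \<integral>z. W z * kern2 \<rho> b b' (z - x) \<partial>lborel)"
proof -
  obtain C0 where C0: "\<And>y::'a. norm (kern0 \<rho> y) \<le> C0"
    using bounded_compact_support[OF continuous_on_kern(1) kern_outside(1)[OF assms(1)]] by metis
  have "\<exists>C. \<forall>y::'a. norm (kern1 \<rho> b y) \<le> C" for b
    using bounded_compact_support[OF continuous_on_kern(2) kern_outside(2)[OF assms(1)]] by metis
  then obtain C1 where C1: "\<And>b y::'a. norm (kern1 \<rho> b y) \<le> C1 b" by metis
  have "\<exists>C. \<forall>y::'a. norm (kern2 \<rho> b b' y) \<le> C" for b b'
    using bounded_compact_support[OF continuous_on_kern(3) kern_outside(3)[OF assms(1)]] by metis
  then obtain C2 where C2: "\<And>b b' y::'a. norm (kern2 \<rho> b b' y) \<le> C2 b b'" by metis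
  show "has_grad (\<lambda>x. \<integral>z. W z * kern0 \<rho> (z - x) \<partial>lborel) (\<lambda>b. \<integral>z. W z * (- kern1 \<rho> b (z - x)) \<partial>lborel) x"
    by (rule has_grad_convolution[OF W has_grad_kern0 C0 C1 continuous_on_kern(2)])
  have neg: "has_grad (\<lambda>y. - kern1 \<rho> b y) (\<lambda>b'. - kern2 \<rho> b b' y) y" for b y :: 'a
    using has_grad_diff[OF has_grad_const[of 0] has_grad_kern1] by simp
  show "has_grad (\<lambda>x. \<integral>z. W z * (- kern1 \<rho> b (z - x)) \<partial>lborel)
        (\<lambda>b'. \<integral>z. W z * kern2 \<rho> b b' (z - x) \<partial>lborel) x" if "b \<in> Basis"
    using has_grad_convolution[OF W neg, of b "C1 b" "C2 b" x] C1 C2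
    by (simp add: continuous_on_minus continuous_on_kern)
  show "continuous_on S (\<lambda>x. \<integral>z. W z * kern2 \<rho> b b' (z - x) \<partial>lborel)"
    by (rule continuous_convolution[OF W continuous_on_kern(3) C2])
qed

lemma integrable_zero_extension:
  fixes u :: "'a::euclidean_space \<Rightarrow> complex"
  assumes "continuous_on (ball x0 R) u" "\<And>x. x \<in> ball x0 R \<Longrightarrow> norm (u x) \<le> B"
  shows "integrable lborel (\<lambda>z. indicator (ball x0 R) z *\<^sub>R u z)"
  by (rule integrable_bounded_support[OF continuous_on_zero_extension_measurable[OF open_ball assms(1)], of x0 R B])
    (use assms(2) in auto)

text \<open>The mean value property read as reproduction of \<open>u\<close> by a convolution. For
  \<open>x\<close> in the half ball the kernel sees only points within \<open>R / 4\<close> of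
  \<open>x\<close>, where the cut-off has no effect.\<close>

lemma harmonic_convolution_kern0:
  fixes u :: "'a::euclidean_space \<Rightarrow> complex"
  assumes u: "harmonic_on (ball x0 R) u" and R: "0 < R" and x: "x \<in> ball x0 (R / 2)"
  shows "(\<integral>z. (indicator (ball x0 R) z *\<^sub>R u z) * kern0 (R / 4) (z - x) \<partial>lborel)
    = of_real (\<integral>y. bump (R / 4) 4 (y::'a) \<partial>lborel) * u x"
proof -
  have sub: "ball x (R / 2) \<subseteq> ball x0 R"
  proof
    fix z assume "z \<in> ball x (R / 2)"
    then show "z \<in> ball x0 R" using x dist_triangle[of x0 z x] by (simp add: dist_commute)
  qed
  have "(indicator (ball x0 R) z *\<^sub>R u z) * kern0 (R / 4) (z - x) = of_real (bump (R / 4) 4 (z - x)) * u z" for z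
  proof (cases "z \<in> ball x (R / 2)")
    case True
    then show ?thesis using sub by (auto simp: kern0_def)
  next
    case False
    then have "z - x \<notin> ball 0 (R / 4)" using R by (auto simp: dist_norm norm_minus_commute)
    then show ?thesis using bump_outside[of 4 "R / 4" "z - x"] R by (simp add: kern0_def)
  qed
  then show ?thesis
    using mean_value_bump[OF harmonic_on_subset[OF u sub], of "R / 4" 3] R by (simp add: numeral_eq_Suc)
qed

text \<open>A function that is merely known to be a convolution of an integrable \<open>W\<close>
  with \<open>kern0\<close> acquires two derivatives from the kernel. The second part serves for
  limits, whose harmonicity is not yet known.\<close>

lemma convolution_kern_representation:
  fixes u W :: "'a::euclidean_space \<Rightarrow> complex"
  assumes "open S" "0 \<le> \<rho>" and W: "integrable lborel W"
    and u: "\<And>x. x \<in> S \<Longrightarrow> u x = k * (\<integral>z. W z * kern0 \<rho> (z - x) \<partial>lborel)"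
  shows convolution_kern_partial2: "\<And>b b' x. b \<in> Basis \<Longrightarrow> b' \<in> Basis \<Longrightarrow> x \<in> S \<Longrightarrow>
      partial_deriv b' (partial_deriv b u) x = k * (\<integral>z. W z * kern2 \<rho> b b' (z - x) \<partial>lborel)"
    and convolution_kern_harmonic: "(\<And>x. x \<in> S \<Longrightarrow> k * (\<Sum>b\<in>Basis. \<integral>z. W z * kern2 \<rho> b b (z - x) \<partial>lborel) = 0) \<Longrightarrow>
      harmonic_on S u"
proof -
  note G = convolution_kern_grads[OF assms(2) W]
  have cm: "has_grad (\<lambda>x. k * f x) (\<lambda>b. k * F b) x" if "has_grad f F x" for f F and x :: 'a
    using has_grad_mult[OF has_grad_const[of k] that] by simp
  have 1: "(u has_derivative (\<lambda>h. \<Sum>b\<in>Basis. (h \<bullet> b) *\<^sub>R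
      (k * (\<integral>z. W z * (- kern1 \<rho> b (z - x)) \<partial>lborel)))) (at x)" if "x \<in> S" for x
    by (rule has_derivative_transform_within_open[OF cm[OF G(1), unfolded has_grad_def] assms(1) that])
      (use u in auto)
  have 2: "((\<lambda>x. k * (\<integral>z. W z * (- kern1 \<rho> b (z - x)) \<partial>lborel)) has_derivative
      (\<lambda>h. \<Sum>b'\<in>Basis. (h \<bullet> b') *\<^sub>R (k * (\<integral>z. W z * kern2 \<rho> b b' (z - x) \<partial>lborel)))) (at x)"
    if "b \<in> Basis" "x \<in> S" for b x
    by (rule cm[OF G(2)[OF that(1)], unfolded has_grad_def])
  have 3: "continuous_on S (\<lambda>x. k * (\<integral>z. W z * kern2 \<rho> b b' (z - x) \<partial>lborel))" for b b'
    by (intro continuous_intros G(3))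
  show "partial_deriv b' (partial_deriv b u) x = k * (\<integral>z. W z * kern2 \<rho> b b' (z - x) \<partial>lborel)"
    if "b \<in> Basis" "b' \<in> Basis" "x \<in> S" for b b' x
    using C2_onI_partial2[OF assms(1) 1 2 3 that] .
  show "harmonic_on S u" if "\<And>x. x \<in> S \<Longrightarrow> k * (\<Sum>b\<in>Basis. \<integral>z. W z * kern2 \<rho> b b (z - x) \<partial>lborel) = 0"
    by (rule harmonic_onI[OF assms(1) 1 2 3]) (use that in \<open>auto simp: sum_distrib_left\<close>)
qed

text \<open>Second derivatives are expressed through the values of \<open>u\<close> alone. Symmetry
  of mixed derivatives and stability under limits follow from these formulas, and the first one
  yields equicontinuity.\<close>

lemma harmonic_kern_representation:
  fixes u :: "'a::euclidean_space \<Rightarrow> complex"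
  assumes u: "harmonic_on (ball x0 R) u" and R: "0 < R" and B: "\<And>x. x \<in> ball x0 R \<Longrightarrow> norm (u x) \<le> B"
    and x: "x \<in> ball x0 (R / 2)"
  defines "k \<equiv> 1 / complex_of_real (\<integral>y. bump (R / 4) 4 (y::'a) \<partial>lborel)"
  defines "W \<equiv> \<lambda>z. indicator (ball x0 R) z *\<^sub>R u z"
  shows "u x = k * (\<integral>z. W z * kern0 (R / 4) (z - x) \<partial>lborel)"
    and "b \<in> Basis \<Longrightarrow> b' \<in> Basis \<Longrightarrow>
      partial_deriv b' (partial_deriv b u) x = k * (\<integral>z. W z * kern2 (R / 4) b b' (z - x) \<partial>lborel)"
proof -
  have "0 < (\<integral>y. bump (R / 4) (Suc 3) (y::'a) \<partial>lborel)" using R by (intro integral_bump_pos) simp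
  then have I: "(\<integral>y. bump (R / 4) 4 (y::'a) \<partial>lborel) \<noteq> 0" by (simp add: numeral_eq_Suc)
  have rep: "u x = k * (\<integral>z. W z * kern0 (R / 4) (z - x) \<partial>lborel)" if "x \<in> ball x0 (R / 2)" for x
    unfolding W_def harmonic_convolution_kern0[OF u R that] using I by (simp add: k_def)
  then show "u x = k * (\<integral>z. W z * kern0 (R / 4) (z - x) \<partial>lborel)" using x .
  have W: "integrable lborel W"
    unfolding W_def by (rule integrable_zero_extension[OF harmonic_on_continuous[OF u] B])
  show "partial_deriv b' (partial_deriv b u) x = k * (\<integral>z. W z * kern2 (R / 4) b b' (z - x) \<partial>lborel)"
    if "b \<in> Basis" "b' \<in> Basis"
    by (rule convolution_kern_partial2[OF open_ball _ W rep that x]) (use R in auto)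
qed

lemma ball_bounded_in_open:
  fixes u :: "'a::euclidean_space \<Rightarrow> complex"
  assumes "open \<Omega>" "x \<in> \<Omega>" "continuous_on \<Omega> u"
  obtains R C where "0 < R" "0 \<le> C" "cball x R \<subseteq> \<Omega>" "\<And>y. y \<in> cball x R \<Longrightarrow> norm (u y) \<le> C"
proof -
  obtain R where "0 < R" "cball x R \<subseteq> \<Omega>" using assms open_contains_cball by blast
  with bounded_continuous_on_cball[OF continuous_on_subset[OF assms(3)]] that show ?thesis by metis
qed

text \<open>The symmetry is inherited from \<open>kern2\<close>, which does not change when
  \<open>b\<close> and \<open>b'\<close> are exchanged.\<close>

lemma harmonic_partial_deriv_commute:
  fixes u :: "'a::euclidean_space \<Rightarrow> complex"
  assumes "open \<Omega>" "harmonic_on \<Omega> u" "x \<in> \<Omega>" "b \<in> Basis" "b' \<in> Basis"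
  shows "partial_deriv b' (partial_deriv b u) x = partial_deriv b (partial_deriv b' u) x"
proof -
  obtain R C where R: "0 < R" "cball x R \<subseteq> \<Omega>" "\<And>y. y \<in> cball x R \<Longrightarrow> norm (u y) \<le> C"
    using ball_bounded_in_open[OF assms(1,3) harmonic_on_continuous[OF assms(2)]] by metis
  have u: "harmonic_on (ball x R) u" using harmonic_on_subset[OF assms(2)] R(2) ball_subset_cball by blast
  have bd: "norm (u y) \<le> C" if "y \<in> ball x R" for y using R(3) that by auto
  note rep = harmonic_kern_representation(2)[OF u R(1) bd, of x]
  show ?thesis using rep[of b b'] rep[of b' b] assms R kern2_commute[of "R / 4" b b'] by simp
qed

text \<open>Bounded pointwise convergence suffices: dominated convergence carries over both the
  reproducing formula, which makes the limit twice differentiable, and the formula for the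
  Laplacian, which is zero along the sequence. The price is half of the radius.\<close>

lemma harmonic_on_limit_ball:
  fixes u :: "'a::euclidean_space \<Rightarrow> complex"
  assumes R: "0 < R" and f: "\<And>n::nat. harmonic_on (ball x0 R) (f n)"
    and B: "\<And>n x. x \<in> ball x0 R \<Longrightarrow> norm (f n x) \<le> B"
    and lim: "\<And>x. x \<in> ball x0 R \<Longrightarrow> (\<lambda>n. f n x) \<longlonglongrightarrow> u x"
  shows "harmonic_on (ball x0 (R / 2)) u"
proof -
  define k where "k = 1 / complex_of_real (\<integral>y. bump (R / 4) 4 (y::'a) \<partial>lborel)"
  define Wn where "Wn = (\<lambda>n z. indicator (ball x0 R) z *\<^sub>R f n z)"
  define W where "W = (\<lambda>z. indicator (ball x0 R) z *\<^sub>R u z)"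
  have B0: "0 \<le> B" using order_trans[OF norm_ge_zero B[of x0 0]] R by simp
  have Wn: "integrable lborel (Wn n)" for n
    unfolding Wn_def by (rule integrable_zero_extension[OF harmonic_on_continuous[OF f] B])
  have WnW: "(\<lambda>n. Wn n z) \<longlonglongrightarrow> W z" for z
    using lim[of z] by (cases "z \<in> ball x0 R") (auto simp: Wn_def W_def)
  have Wmeas: "W \<in> borel_measurable borel"
  proof (rule borel_measurable_LIMSEQ_metric)
    show "Wn n \<in> borel_measurable borel" for n
      using borel_measurable_integrable[OF Wn[of n]] by simp
  qed (rule WnW)
  have uB: "norm (u x) \<le> B" if "x \<in> ball x0 R" for x
    using LIMSEQ_le_const2[OF tendsto_norm[OF lim[OF that]]] B[OF that] by blast
  have W: "integrable lborel W"
    by (rule integrable_bounded_support[OF Wmeas, of x0 R B]) (use uB in \<open>auto simp: W_def\<close>)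
  define w where "w = (\<lambda>z::'a. indicator (ball x0 R) z * B)"
  have w: "integrable lborel w" unfolding w_def
    by (rule integrable_indicator_mult_const) auto
  have WB: "norm (Wn n z) \<le> w z" for n z using B B0 by (auto simp: Wn_def w_def indicator_def)
  have conv: "(\<lambda>n. \<integral>z. Wn n z * g (z - x) \<partial>lborel) \<longlonglongrightarrow> (\<integral>z. W z * g (z - x) \<partial>lborel)"
    if g: "continuous_on UNIV g" "\<And>y. y \<notin> ball 0 (R / 4) \<Longrightarrow> g y = 0" for g x
  proof -
    obtain C where C: "0 \<le> C" "\<And>y. norm (g y) \<le> C" using bounded_compact_support[OF g] by blast
    show ?thesis
    proof (rule integral_dominated_convergence[where w = "\<lambda>z. w z * C"])
      show "(\<lambda>z. W z * g (z - x)) \<in> borel_measurable lborel"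
        by (rule borel_measurable_integrable[OF integrable_mult_kernel[OF W g(1) C(2)]])
      show "(\<lambda>z. Wn n z * g (z - x)) \<in> borel_measurable lborel" for n
        by (rule borel_measurable_integrable[OF integrable_mult_kernel[OF Wn g(1) C(2)]])
      show "AE z in lborel. (\<lambda>n. Wn n z * g (z - x)) \<longlonglongrightarrow> W z * g (z - x)"
        by (intro AE_I2 tendsto_intros WnW)
      show "AE z in lborel. norm (Wn n z * g (z - x)) \<le> w z * C" for n
        unfolding norm_mult using WB C B0 by (intro AE_I2 mult_mono) (auto simp: w_def)
    qed (use w in simp)
  qed
  have rep: "u x = k * (\<integral>z. W z * kern0 (R / 4) (z - x) \<partial>lborel)" if x: "x \<in> ball x0 (R / 2)" for x
  proof -
    have "(\<lambda>n. k * (\<integral>z. Wn n z * kern0 (R / 4) (z - x) \<partial>lborel)) \<longlonglongrightarrow> k * (\<integral>z. W z * kern0 (R / 4) (z - x) \<partial>lborel)"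
      by (intro tendsto_intros conv continuous_on_kern kern_outside) (use R in auto)
    moreover have "k * (\<integral>z. Wn n z * kern0 (R / 4) (z - x) \<partial>lborel) = f n x" for n
      using harmonic_kern_representation(1)[OF f R B x] by (simp add: k_def Wn_def)
    ultimately show ?thesis using lim[of x] x R LIMSEQ_unique by force
  qed
  have lap: "k * (\<Sum>b\<in>Basis. \<integral>z. W z * kern2 (R / 4) b b (z - x) \<partial>lborel) = 0" if x: "x \<in> ball x0 (R / 2)" for x
  proof -
    have "(\<lambda>n. k * (\<Sum>b\<in>Basis. \<integral>z. Wn n z * kern2 (R / 4) b b (z - x) \<partial>lborel)) \<longlonglongrightarrow>
        k * (\<Sum>b\<in>Basis. \<integral>z. W z * kern2 (R / 4) b b (z - x) \<partial>lborel)"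
      by (intro tendsto_intros conv continuous_on_kern kern_outside) (use R in auto)
    moreover have "k * (\<Sum>b\<in>Basis. \<integral>z. Wn n z * kern2 (R / 4) b b (z - x) \<partial>lborel) = 0" for n
    proof -
      have "(\<Sum>b\<in>Basis. partial_deriv b (partial_deriv b (f n)) x) = 0"
        using harmonic_on_laplacian[OF f, of x] x R by auto
      then show ?thesis using harmonic_kern_representation(2)[OF f R B x]
        by (simp add: k_def Wn_def sum_distrib_left)
    qed
    ultimately show ?thesis by (simp add: LIMSEQ_const_iff)
  qed
  show ?thesis by (rule convolution_kern_harmonic[OF open_ball _ W rep lap]) (use R in auto)
qed

text \<open>\<open>C2_on\<close> gives no third derivatives, so the equation cannot simply be
  differentiated. Instead the difference quotients are harmonic, bounded by the gradient of
  \<open>u\<close> and pointwise convergent, and \<open>harmonic_on_limit_ball\<close>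
  applies.\<close>

lemma harmonic_on_partial_deriv:
  fixes u :: "'a::euclidean_space \<Rightarrow> complex"
  assumes "open \<Omega>" and u: "harmonic_on \<Omega> u" and b: "b \<in> Basis"
  shows "harmonic_on \<Omega> (partial_deriv b u)"
proof (rule harmonic_on_locally[OF assms(1)])
  fix x0 assume "x0 \<in> \<Omega>"
  then obtain R where R: "0 < R" "cball x0 R \<subseteq> \<Omega>" using assms(1) open_contains_cball by blast
  have "\<exists>C. 0 \<le> C \<and> (\<forall>y\<in>cball x0 R. norm (partial_deriv b u y) \<le> C)" if "b \<in> Basis" for b
    using bounded_continuous_on_cball[OF continuous_on_subset[OF harmonic_on_continuous1[OF u that] R(2)]] by metis
  then obtain C where C: "\<And>b. b \<in> Basis \<Longrightarrow> 0 \<le> C b"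
    "\<And>b y. b \<in> Basis \<Longrightarrow> y \<in> cball x0 R \<Longrightarrow> norm (partial_deriv b u y) \<le> C b" by metis
  \<comment> \<open>The sequence of increments starts late enough that translates of the half ball
    stay inside the ball of radius \<open>R\<close>.\<close>
  obtain N where N: "inverse (real (Suc N)) < R / 2" using reals_Archimedean[of "R / 2"] R by auto
  define s where "s = (\<lambda>n. inverse (real (Suc (n + N))))"
  have s: "0 < s n" "s n < R / 2" for n
  proof -
    have "s n \<le> inverse (real (Suc N))" by (simp add: s_def)
    then show "s n < R / 2" using N by simp
  qed (simp add: s_def)
  have s_lim: "s \<longlonglongrightarrow> 0" unfolding s_def by (rule LIMSEQ_ignore_initial_segment[OF LIMSEQ_inverse_real_of_nat])
  define f where "f = (\<lambda>n x. of_real (1 / s n) * (u (s n *\<^sub>R b + x) - u x))"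
  have nb: "norm (s n *\<^sub>R b) < R / 2" for n using s[of n] b by simp
  have inR: "s n *\<^sub>R b + x \<in> ball x0 R" "x \<in> ball x0 R" if "x \<in> ball x0 (R / 2)" for n x
    using that nb[of n] norm_triangle_ineq4[of "x0 - x" "s n *\<^sub>R b"] R by (auto simp: dist_norm algebra_simps)
  have u': "harmonic_on (ball x0 R) u" using harmonic_on_subset[OF u] R(2) ball_subset_cball by blast
  have "harmonic_on (ball x0 (R / 2 / 2)) (partial_deriv b u)"
  proof (rule harmonic_on_limit_ball[where f = f and B = "\<Sum>b\<in>Basis. C b"])
    show "harmonic_on (ball x0 (R / 2)) (f n)" for n
    proof -
      have "harmonic_on (ball x0 (R / 2)) (\<lambda>x. u (s n *\<^sub>R b + x))"
        using harmonic_on_subset[OF harmonic_on_translate[OF open_ball u', of "s n *\<^sub>R b"]] inR(1) by blast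
      moreover have "harmonic_on (ball x0 (R / 2)) u"
        using harmonic_on_subset[OF u'] inR(2) by blast
      ultimately show ?thesis unfolding f_def
        by (intro harmonic_on_cmult harmonic_on_diff open_ball)
    qed
    show "norm (f n x) \<le> (\<Sum>b\<in>Basis. C b)" if x: "x \<in> ball x0 (R / 2)" for n x
    proof -
      have "norm (u (s n *\<^sub>R b + x) - u x) \<le> (\<Sum>b\<in>Basis. C b) * norm (s n *\<^sub>R b + x - x)"
        using inR[OF x] C
        by (intro has_grad_lipschitz[of "ball x0 R", OF _ _ _ harmonic_has_grad[OF u']]) auto
      then show ?thesis using s[of n] b
        by (simp add: f_def norm_mult norm_divide pos_divide_le_eq mult.commute)
    qed
    show "(\<lambda>n. f n x) \<longlonglongrightarrow> partial_deriv b u x" if x: "x \<in> ball x0 (R / 2)" for x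
    proof -
      define X where "X = (\<lambda>n. s n *\<^sub>R b + x)"
      have X: "X \<longlonglongrightarrow> x" unfolding X_def by (rule tendsto_eq_intros s_lim | simp)+
      have Xne: "X n \<noteq> x" for n using s[of n] b by (auto simp: X_def)
      have der: "(u has_derivative frechet_derivative u (at x)) (at x)"
        using harmonic_on_has_derivative[OF u' inR(2)[OF x]] differentiableI frechet_derivative_works by blast
      have lin: "linear (frechet_derivative u (at x))" using der has_derivative_linear by blast
      have "(\<lambda>n. (1 / norm (X n - x)) *\<^sub>R (u (X n) - (u x + frechet_derivative u (at x) (X n - x))) + partial_deriv b u x)
          \<longlonglongrightarrow> 0 + partial_deriv b u x"
        by (intro tendsto_intros has_derivative_seq_quotient[OF der X Xne])
      moreover have "(1 / norm (X n - x)) *\<^sub>R (u (X n) - (u x + frechet_derivative u (at x) (X n - x))) + partial_deriv b u x = f n x" for n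
        using s[of n] b lin by (simp add: X_def f_def partial_deriv_def linear_scale scaleR_conv_of_real algebra_simps)
      ultimately show ?thesis by simp
    qed
  qed (use R in auto)
  then show "\<exists>S. open S \<and> x0 \<in> S \<and> harmonic_on S (partial_deriv b u)"
    using R by (intro exI[of _ "ball x0 (R / 2 / 2)"]) auto
qed

text \<open>The Lipschitz constant of \<open>kern0\<close> passes to every function it reproduces.
  \<open>L\<close> depends on the ball only, not on \<open>u\<close> or its bound \<open>B\<close>,
  so it serves a whole sequence.\<close>

lemma harmonic_equicontinuous:
  assumes R: "0 < R"
  obtains L where "0 \<le> L" "\<And>(u :: 'a::euclidean_space \<Rightarrow> complex) B x y. harmonic_on (ball x0 R) u \<Longrightarrow>
    (\<And>z. z \<in> ball x0 R \<Longrightarrow> norm (u z) \<le> B) \<Longrightarrow> x \<in> ball x0 (R / 2) \<Longrightarrow> y \<in> ball x0 (R / 2) \<Longrightarrow>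
    norm (u x - u y) \<le> L * B * norm (x - y)"
proof -
  have "\<exists>C\<ge>0. \<forall>y::'a. norm (kern1 (R / 4) b y) \<le> C" for b
  proof -
    have "kern1 (R / 4) b y = 0" if "y \<notin> ball 0 (R / 4)" for y
      using that R by (intro kern_outside) auto
    from bounded_compact_support[OF continuous_on_kern(2) this] show ?thesis by metis
  qed
  then obtain C where C: "\<And>b. 0 \<le> C b" "\<And>b y::'a. norm (kern1 (R / 4) b y) \<le> C b" by metis
  define S where "S = (\<Sum>b\<in>Basis. C b)"
  have S0: "0 \<le> S" unfolding S_def by (intro sum_nonneg C)
  have lip: "norm (kern0 (R / 4) x - kern0 (R / 4) y) \<le> S * norm (x - y)" for x y :: 'a
    unfolding S_def by (rule has_grad_lipschitz[OF convex_UNIV _ _ has_grad_kern0 C(2)]) auto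
  define I where "I = (\<integral>y. bump (R / 4) 4 (y::'a) \<partial>lborel)"
  have "0 < (\<integral>y. bump (R / 4) (Suc 3) (y::'a) \<partial>lborel)" using R by (intro integral_bump_pos) simp
  then have I: "0 < I" by (simp add: numeral_eq_Suc I_def)
  define vol where "vol = measure lborel (ball x0 R)"
  have "norm (u x - u y) \<le> (vol * S / I) * B * norm (x - y)"
    if u: "harmonic_on (ball x0 R) u" and B: "\<And>z. z \<in> ball x0 R \<Longrightarrow> norm (u z) \<le> B"
      and x: "x \<in> ball x0 (R / 2)" and y: "y \<in> ball x0 (R / 2)" for u B x y
  proof -
    define W where "W = (\<lambda>z. indicator (ball x0 R) z *\<^sub>R u z)"
    have W: "integrable lborel W"
      unfolding W_def by (rule integrable_zero_extension[OF harmonic_on_continuous[OF u] B])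
    have B0: "0 \<le> B" using order_trans[OF norm_ge_zero B[of x0]] R by simp
    obtain C0 where C0: "\<And>y::'a. norm (kern0 (R / 4) y) \<le> C0"
    proof -
      have "kern0 (R / 4) y = 0" if "y \<notin> ball 0 (R / 4)" for y :: 'a
        using that R by (intro kern_outside) auto
      from bounded_compact_support[OF continuous_on_kern(1) this] that show ?thesis by metis
    qed
    note int = integrable_mult_kernel[OF W continuous_on_kern(1) C0]
    have eq: "u x - u y = (\<integral>z. W z * kern0 (R / 4) (z - x) - W z * kern0 (R / 4) (z - y) \<partial>lborel) / of_real I"
      using harmonic_kern_representation(1)[OF u R B x] harmonic_kern_representation(1)[OF u R B y] int
      by (simp add: W_def I_def diff_divide_distrib)
    have "norm (\<integral>z. W z * kern0 (R / 4) (z - x) - W z * kern0 (R / 4) (z - y) \<partial>lborel)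
        \<le> (\<integral>z. indicator (ball x0 R) z * (B * (S * norm (x - y))) \<partial>lborel)"
    proof (rule order_trans[OF Bochner_Integration.integral_norm_bound], rule integral_mono)
      show "integrable lborel (\<lambda>z. norm (W z * kern0 (R / 4) (z - x) - W z * kern0 (R / 4) (z - y)))"
        by (intro integrable_norm Bochner_Integration.integrable_diff int)
      show "integrable lborel (\<lambda>z::'a. indicator (ball x0 R) z * (B * (S * norm (x - y))))"
        by (rule integrable_indicator_mult_const) auto
      show "norm (W z * kern0 (R / 4) (z - x) - W z * kern0 (R / 4) (z - y)) \<le>
          indicator (ball x0 R) z * (B * (S * norm (x - y)))" for z
      proof (cases "z \<in> ball x0 R")
        case True
        have "norm (u z * (kern0 (R / 4) (z - x) - kern0 (R / 4) (z - y))) \<le> B * (S * norm (x - y))"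
          unfolding norm_mult using B[OF True] B0 lip[of "z - x" "z - y"]
          by (intro mult_mono) (auto simp: norm_minus_commute)
        then show ?thesis using True by (simp add: W_def right_diff_distrib)
      qed (simp add: W_def)
    qed
    then show ?thesis unfolding eq norm_divide using I
      by (simp add: vol_def divide_right_mono mult_ac)
  qed
  moreover have "0 \<le> vol * S / I" using I S0 by (simp add: vol_def)
  ultimately show ?thesis using that by blast
qed

section \<open>The space of square-integrable harmonic functions\<close>

abbreviation unit_leb :: "'a::euclidean_space measure" where
  "unit_leb \<equiv> lebesgue_on (ball 0 1)"

abbreviation bergman :: "('a::euclidean_space \<Rightarrow> complex) set" where
  "bergman \<equiv> harmonic_L2 (ball 0 1)"

abbreviation ip :: "('a::euclidean_space \<Rightarrow> complex) \<Rightarrow> ('a \<Rightarrow> complex) \<Rightarrow> complex" where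
  "ip \<equiv> L2_inner (ball 0 1)"

definition nsq :: "('a::euclidean_space \<Rightarrow> complex) \<Rightarrow> real" where
  "nsq u = (LINT x|unit_leb. (cmod (u x))\<^sup>2)"

lemma finite_measure_unit_leb: "finite_measure (unit_leb :: 'a::euclidean_space measure)"
proof
  have "emeasure (unit_leb :: 'a measure) (space unit_leb) = emeasure lebesgue (ball (0::'a) 1)"
    by (simp add: emeasure_restrict_space)
  also have "\<dots> = emeasure lborel (ball (0::'a) 1)" by (simp add: emeasure_completion)
  also have "\<dots> < \<infinity>" by (intro emeasure_bounded_finite) auto
  finally show "emeasure (unit_leb :: 'a measure) (space unit_leb) \<noteq> \<infinity>" by simp
qed

lemma integrable_const_unit_leb: "integrable (unit_leb :: 'a::euclidean_space measure) (\<lambda>_. k :: real)"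
  using finite_measure.integrable_const[OF finite_measure_unit_leb] .

lemma borel_measurable_unit_leb:
  "u \<in> borel_measurable borel \<Longrightarrow> u \<in> borel_measurable (unit_leb :: 'a::euclidean_space measure)"
  by (intro measurable_restrict_space1 measurable_completion) simp

lemma lebesgue_on_integral_lborel:
  fixes f :: "'a::euclidean_space \<Rightarrow> 'b::{banach, second_countable_topology}"
  assumes "f \<in> borel_measurable borel" "S \<in> sets borel"
  shows "(LINT x|lebesgue_on S. f x) = (LINT x|lborel. indicator S x *\<^sub>R f x)"
    and "integrable (lebesgue_on S) f \<longleftrightarrow> integrable lborel (\<lambda>x. indicator S x *\<^sub>R f x)"
proof -
  have m: "(\<lambda>x. indicator S x *\<^sub>R f x) \<in> borel_measurable lborel" using assms by measurable
  have S: "S \<inter> space lebesgue \<in> sets lebesgue" using assms by simp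
  show "(LINT x|lebesgue_on S. f x) = (LINT x|lborel. indicator S x *\<^sub>R f x)"
    using integral_restrict_space[OF S, of f] integral_completion[OF m] by simp
  show "integrable (lebesgue_on S) f \<longleftrightarrow> integrable lborel (\<lambda>x. indicator S x *\<^sub>R f x)"
    using integrable_restrict_space[OF S, of f] integrable_completion[OF m] by simp
qed

text \<open>Vanishing off the ball makes \<open>u\<close> Borel measurable on the whole space.
  Integrals over \<open>unit_leb\<close> thereby become integrals over \<open>lborel\<close>, where
  translations and dilations are available.\<close>

lemma bergmanD:
  assumes "u \<in> bergman"
  shows bergman_harmonic: "harmonic_on (ball 0 1) u"
    and bergman_L2: "u \<in> L2 (ball 0 1)"
    and bergman_outside: "x \<notin> ball 0 1 \<Longrightarrow> u x = 0"
    and bergman_borel: "u \<in> borel_measurable borel"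
    and bergman_measurable: "u \<in> borel_measurable unit_leb"
    and bergman_square_integrable: "integrable unit_leb (\<lambda>x. (cmod (u x))\<^sup>2)"
    and bergman_square_integrable_lborel: "integrable lborel (\<lambda>x. (cmod (u x))\<^sup>2)"
    and bergman_nsq_lborel: "nsq u = (LINT x|lborel. (cmod (u x))\<^sup>2)"
proof -
  show h: "harmonic_on (ball 0 1) u" and L: "u \<in> L2 (ball 0 1)"
    and o: "x \<notin> ball 0 1 \<Longrightarrow> u x = 0" for x
    using assms by (auto simp: harmonic_L2_def)
  have eq: "u = (\<lambda>x. indicator (ball 0 1) x *\<^sub>R u x)"
    using o by (auto simp: indicator_def fun_eq_iff)
  show m: "u \<in> borel_measurable borel"
    by (subst eq) (intro continuous_on_zero_extension_measurable harmonic_on_continuous[OF h] open_ball)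
  then show "u \<in> borel_measurable unit_leb" by (rule borel_measurable_unit_leb)
  show i: "integrable unit_leb (\<lambda>x. (cmod (u x))\<^sup>2)" using L by (simp add: L2_def)
  have m2: "(\<lambda>x. (cmod (u x))\<^sup>2) \<in> borel_measurable borel" using m by measurable
  have eq2: "indicator (ball 0 1) x *\<^sub>R (cmod (u x))\<^sup>2 = (cmod (u x))\<^sup>2" for x
    using o[of x] by (auto simp: indicator_def)
  show "integrable lborel (\<lambda>x. (cmod (u x))\<^sup>2)"
    using i lebesgue_on_integral_lborel(2)[OF m2, of "ball 0 1"] unfolding eq2 by simp
  show "nsq u = (LINT x|lborel. (cmod (u x))\<^sup>2)"
    using lebesgue_on_integral_lborel(1)[OF m2, of "ball 0 1"] unfolding eq2 nsq_def by simp
qed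

lemma bergmanI:
  assumes "harmonic_on (ball 0 1) u" "\<And>x. x \<notin> ball 0 1 \<Longrightarrow> u x = 0"
    "integrable unit_leb (\<lambda>x. (cmod (u x))\<^sup>2)"
  shows "u \<in> bergman"
proof -
  have eq: "u = (\<lambda>x. indicator (ball 0 1) x *\<^sub>R u x)"
    using assms by (auto simp: indicator_def fun_eq_iff)
  have "u \<in> borel_measurable borel"
    by (subst eq) (intro continuous_on_zero_extension_measurable harmonic_on_continuous[OF assms(1)] open_ball)
  then show ?thesis
    using assms borel_measurable_unit_leb by (auto simp: harmonic_L2_def L2_def)
qed

lemma nsq_nonneg: "0 \<le> nsq u"
  by (simp add: nsq_def)

lemma borel_measurable_cnj' [measurable]:
  "f \<in> borel_measurable M \<Longrightarrow> (\<lambda>x. cnj (f x)) \<in> borel_measurable M"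
  by (rule borel_measurable_continuous_on[OF continuous_on_cnj[OF continuous_on_id]])

lemma L2_integrable_mult:
  assumes "f \<in> L2 (ball 0 1)" "g \<in> L2 (ball 0 1)"
  shows "integrable unit_leb (\<lambda>x. f x * cnj (g x))"
proof (rule Bochner_Integration.integrable_bound)
  show "integrable unit_leb (\<lambda>x. (cmod (f x))\<^sup>2 + (cmod (g x))\<^sup>2)"
    using assms by (auto simp: L2_def)
  show "(\<lambda>x. f x * cnj (g x)) \<in> borel_measurable unit_leb"
    using assms by (auto simp: L2_def)
  show "AE x in unit_leb. norm (f x * cnj (g x)) \<le> norm ((cmod (f x))\<^sup>2 + (cmod (g x))\<^sup>2)"
  proof (rule AE_I2)
    fix x
    have "0 \<le> (cmod (f x) - cmod (g x))\<^sup>2" "0 \<le> cmod (f x) * cmod (g x)" by simp_all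
    then have "cmod (f x) * cmod (g x) \<le> (cmod (f x))\<^sup>2 + (cmod (g x))\<^sup>2"
      unfolding power2_diff by linarith
    then show "norm (f x * cnj (g x)) \<le> norm ((cmod (f x))\<^sup>2 + (cmod (g x))\<^sup>2)"
      by (simp add: norm_mult)
  qed
qed

lemma L2_add:
  assumes "f \<in> L2 (ball 0 1)" "g \<in> L2 (ball 0 1)"
  shows "(\<lambda>x. f x + g x) \<in> L2 (ball 0 1)"
proof -
  have "integrable unit_leb (\<lambda>x. (cmod (f x + g x))\<^sup>2)"
  proof (rule Bochner_Integration.integrable_bound)
    show "integrable unit_leb (\<lambda>x. 2 * (cmod (f x))\<^sup>2 + 2 * (cmod (g x))\<^sup>2)"
      using assms by (auto simp: L2_def)
    show "(\<lambda>x. (cmod (f x + g x))\<^sup>2) \<in> borel_measurable unit_leb"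
      using assms by (auto simp: L2_def)
    show "AE x in unit_leb. norm ((cmod (f x + g x))\<^sup>2) \<le> norm (2 * (cmod (f x))\<^sup>2 + 2 * (cmod (g x))\<^sup>2)"
    proof (rule AE_I2)
      fix x
      have "(cmod (f x + g x))\<^sup>2 \<le> (cmod (f x) + cmod (g x))\<^sup>2"
        by (intro power_mono norm_triangle_ineq) simp
      also have "\<dots> \<le> 2 * (cmod (f x))\<^sup>2 + 2 * (cmod (g x))\<^sup>2"
        using zero_le_power2[of "cmod (f x) - cmod (g x)"] by (simp add: power2_sum power2_diff)
      finally show "norm ((cmod (f x + g x))\<^sup>2) \<le> norm (2 * (cmod (f x))\<^sup>2 + 2 * (cmod (g x))\<^sup>2)" by simp
    qed
  qed
  then show ?thesis using assms by (auto simp: L2_def)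
qed

lemma L2_cmult:
  assumes "f \<in> L2 (ball 0 1)"
  shows "(\<lambda>x. k * f x) \<in> L2 (ball 0 1)"
  using assms by (auto simp: L2_def norm_mult power_mult_distrib)

lemma ip_add_left:
  "f \<in> L2 (ball 0 1) \<Longrightarrow> g \<in> L2 (ball 0 1) \<Longrightarrow> h \<in> L2 (ball 0 1) \<Longrightarrow>
    ip (\<lambda>x. f x + g x) h = ip f h + ip g h"
  unfolding L2_inner_def using L2_integrable_mult[of f h] L2_integrable_mult[of g h]
  by (simp add: distrib_right)

lemma ip_diff_left:
  "f \<in> L2 (ball 0 1) \<Longrightarrow> g \<in> L2 (ball 0 1) \<Longrightarrow> h \<in> L2 (ball 0 1) \<Longrightarrow>
    ip (\<lambda>x. f x - g x) h = ip f h - ip g h"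
  unfolding L2_inner_def using L2_integrable_mult[of f h] L2_integrable_mult[of g h]
  by (simp add: left_diff_distrib)

lemma ip_cmult_left: "ip (\<lambda>x. k * f x) h = k * ip f h"
  unfolding L2_inner_def by (simp add: mult.assoc)

lemma ip_commute: "ip g f = cnj (ip f g)"
proof -
  have "cnj (ip f g) = (CLINT x|unit_leb. cnj (f x * cnj (g x)))"
    unfolding L2_inner_def by (rule Bochner_Integration.integral_cnj[symmetric])
  then show ?thesis by (simp add: L2_inner_def mult.commute)
qed

lemma ip_self: "ip u u = of_real (nsq u)"
  unfolding L2_inner_def nsq_def by (simp add: complex_norm_square[symmetric] flip: integral_complex_of_real)

lemma bergman_add: "u \<in> bergman \<Longrightarrow> v \<in> bergman \<Longrightarrow> (\<lambda>x. u x + v x) \<in> bergman"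
  by (auto simp: harmonic_L2_def intro: L2_add harmonic_on_add)

lemma bergman_cmult: "u \<in> bergman \<Longrightarrow> (\<lambda>x. k * u x) \<in> bergman"
  by (auto simp: harmonic_L2_def intro: L2_cmult harmonic_on_cmult)

lemma bergman_zero: "(\<lambda>_. 0) \<in> bergman"
  by (auto simp: harmonic_L2_def L2_def intro: harmonic_on_const)

lemma bergman_diff: "u \<in> bergman \<Longrightarrow> v \<in> bergman \<Longrightarrow> (\<lambda>x. u x - v x) \<in> bergman"
  using bergman_add[OF _ bergman_cmult[of v "-1"]] by simp

lemma bergman_sum: "(\<And>i. i \<in> I \<Longrightarrow> u i \<in> bergman) \<Longrightarrow> (\<lambda>x. \<Sum>i\<in>I. k i * u i x) \<in> bergman"
proof (induction I rule: infinite_finite_induct)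
  case (insert i I)
  then show ?case using bergman_add[OF bergman_cmult[of "u i" "k i"], of "\<lambda>x. \<Sum>i\<in>I. k i * u i x"] by simp
qed (auto intro: bergman_zero)

section \<open>Local bounds and compactness\<close>

text \<open>The mean value property over balls of radius \<open>(1 - r) / 2\<close>, which stay
  inside the unit ball. Estimating \<open>|u|\<close> by \<open>1 + |u|\<^sup>2\<close> instead of
  using the Cauchy-Schwarz inequality gives a bound that is not homogeneous but is uniform on
  bounded sets of functions.\<close>

lemma bergman_pointwise_bound:
  assumes r: "r < 1"
  obtains C where "0 \<le> C"
    "\<And>(u :: 'a::euclidean_space \<Rightarrow> complex) x. u \<in> bergman \<Longrightarrow> x \<in> cball 0 r \<Longrightarrow> norm (u x) \<le> C * (1 + nsq u)"
proof -
  define \<rho> where "\<rho> = (1 - r) / 2"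
  have \<rho>: "0 < \<rho>" "\<rho> < 1 - r" using r by (auto simp: \<rho>_def)
  define I where "I = (\<integral>y. bump \<rho> (Suc 0) (y::'a) \<partial>lborel)"
  have I: "0 < I" unfolding I_def by (rule integral_bump_pos[OF \<rho>(1)])
  define vol where "vol = measure lborel (ball (0::'a) 1)"
  define C where "C = \<rho>\<^sup>2 * (vol + 1) / I"
  have "norm (u x) \<le> C * (1 + nsq u)" if u: "u \<in> bergman" and x: "x \<in> cball 0 r" for u :: "'a \<Rightarrow> complex" and x
  proof -
    have sub: "ball x (1 - r) \<subseteq> ball 0 1"
    proof
      fix z assume "z \<in> ball x (1 - r)"
      then show "z \<in> ball 0 1" using x norm_triangle_ineq2[of z x] by (auto simp: dist_norm norm_minus_commute)
    qed
    have mv: "(\<integral>z. of_real (bump \<rho> (Suc 0) (z - x)) * u z \<partial>lborel) = of_real I * u x"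
      unfolding I_def by (rule mean_value_bump[OF harmonic_on_subset[OF bergman_harmonic[OF u] sub] \<rho>])
    have int: "integrable lborel (\<lambda>z. \<rho>\<^sup>2 * (indicator (ball (0::'a) 1) z + (cmod (u z))\<^sup>2))"
      by (intro integrable_mult_right Bochner_Integration.integrable_add integrable_real_indicator
          bergman_square_integrable_lborel[OF u]) (auto intro!: emeasure_bounded_finite[unfolded infinity_ennreal_def])
    have "I * norm (u x) = norm (\<integral>z. of_real (bump \<rho> (Suc 0) (z - x)) * u z \<partial>lborel)"
      unfolding mv using I by (simp add: norm_mult)
    also have "\<dots> \<le> (\<integral>z. norm (of_real (bump \<rho> (Suc 0) (z - x)) * u z) \<partial>lborel)"
      by (rule Bochner_Integration.integral_norm_bound)
    also have "\<dots> \<le> (\<integral>z. \<rho>\<^sup>2 * (indicator (ball (0::'a) 1) z + (cmod (u z))\<^sup>2) \<partial>lborel)"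
    proof (rule integral_mono'[OF int])
      fix z
      have "norm (u z) \<le> indicator (ball 0 1) z + (cmod (u z))\<^sup>2"
      proof (cases "z \<in> ball 0 1")
        case True
        have "0 \<le> (cmod (u z) - 1)\<^sup>2" by simp
        then have "2 * cmod (u z) \<le> (cmod (u z))\<^sup>2 + 1" by (simp add: power2_diff)
        then have "cmod (u z) \<le> (cmod (u z))\<^sup>2 + 1" using norm_ge_zero[of "u z"] by linarith
        then show ?thesis using True by simp
      qed (simp add: bergman_outside[OF u])
      then show "norm (of_real (bump \<rho> (Suc 0) (z - x)) * u z) \<le> \<rho>\<^sup>2 * (indicator (ball 0 1) z + (cmod (u z))\<^sup>2)"
        unfolding norm_mult using bump_le[of \<rho> "Suc 0" "z - x"] bump_nonneg[of \<rho> "Suc 0" "z - x"]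
        by (intro mult_mono) auto
    qed (simp add: indicator_def)
    also have "\<dots> = \<rho>\<^sup>2 * (vol + nsq u)"
      using bergman_square_integrable_lborel[OF u] bergman_nsq_lborel[OF u]
      by (simp add: vol_def integrable_real_indicator emeasure_bounded_finite[unfolded infinity_ennreal_def])
    also have "\<dots> \<le> \<rho>\<^sup>2 * ((vol + 1) * (1 + nsq u))"
      using nsq_nonneg[of u] measure_nonneg[of lborel "ball (0::'a) 1"]
      by (intro mult_left_mono) (auto simp: algebra_simps vol_def)
    finally show ?thesis using I by (simp add: C_def field_simps)
  qed
  moreover have "0 \<le> C" using I by (simp add: C_def vol_def)
  ultimately show ?thesis using that by blast
qed

lemma nsq_cmult: "nsq (\<lambda>x. k * u x) = (cmod k)\<^sup>2 * nsq u"
  by (simp add: nsq_def norm_mult power_mult_distrib)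

text \<open>The inhomogeneous pointwise bound applies to every multiple \<open>n * u\<close>, whose
  norm is zero too; hence \<open>n * |u x|\<close> stays below a fixed constant.\<close>

lemma nsq_eq_0:
  fixes u :: "'a::euclidean_space \<Rightarrow> complex"
  assumes u: "u \<in> bergman" and "nsq u = 0"
  shows "u = (\<lambda>_. 0)"
proof
  fix x
  show "u x = 0"
  proof (cases "x \<in> ball 0 1")
    case True
    then have "norm x < 1" by simp
    then obtain C where C: "\<And>(v :: 'a \<Rightarrow> complex) y. v \<in> bergman \<Longrightarrow> y \<in> cball 0 (norm x) \<Longrightarrow> norm (v y) \<le> C * (1 + nsq v)"
      using bergman_pointwise_bound by metis
    have le: "real n * norm (u x) \<le> C" for n :: nat
      using C[OF bergman_cmult[OF u, of "of_nat n"], of x] assms(2) by (simp add: nsq_cmult norm_mult)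
    show ?thesis
    proof (rule ccontr)
      assume "u x \<noteq> 0"
      then obtain n where "C < real n * norm (u x)" using reals_Archimedean3[of "norm (u x)"] by auto
      with le[of n] show False by simp
    qed
  qed (simp add: bergman_outside[OF u])
qed

lemma nsq_pos: "u \<in> bergman \<Longrightarrow> u \<noteq> (\<lambda>_. 0) \<Longrightarrow> 0 < nsq u"
  using nsq_eq_0[of u] nsq_nonneg[of u] by force

text \<open>Fatou's lemma plays the role of weak lower semicontinuity of the norm. The bound is
  required only eventually because in \<open>riesz\<close> it holds only from some index on.\<close>

lemma bergman_fatou:
  assumes f: "\<And>n. f n \<in> bergman" and lim: "\<And>x. (\<lambda>n. f n x) \<longlonglongrightarrow> u x"
    and h: "harmonic_on (ball 0 1) u" and L: "\<forall>\<^sub>F n in sequentially. nsq (f n) \<le> L"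
  shows "u \<in> bergman" "nsq u \<le> L"
proof -
  have o: "u x = 0" if "x \<notin> ball 0 1" for x
    using lim[of x] bergman_outside[OF f that] by (simp add: LIMSEQ_const_iff)
  have m: "u \<in> borel_measurable unit_leb"
    by (rule borel_measurable_LIMSEQ_metric[OF bergman_measurable[OF f] lim])
  obtain N where "nsq (f N) \<le> L" using eventually_happens[OF L] by auto
  then have L0: "0 \<le> L" using order_trans[OF nsq_nonneg] by blast
  have "(\<integral>\<^sup>+x. ennreal ((cmod (u x))\<^sup>2) \<partial>unit_leb) = (\<integral>\<^sup>+x. liminf (\<lambda>n. ennreal ((cmod (f n x))\<^sup>2)) \<partial>unit_leb)"
  proof (rule nn_integral_cong)
    fix x
    have "(\<lambda>n. ennreal ((cmod (f n x))\<^sup>2)) \<longlonglongrightarrow> ennreal ((cmod (u x))\<^sup>2)"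
      by (intro tendsto_intros lim)
    then show "ennreal ((cmod (u x))\<^sup>2) = liminf (\<lambda>n. ennreal ((cmod (f n x))\<^sup>2))"
      by (rule lim_imp_Liminf[OF sequentially_bot, symmetric])
  qed
  also have "\<dots> \<le> liminf (\<lambda>n. \<integral>\<^sup>+x. ennreal ((cmod (f n x))\<^sup>2) \<partial>unit_leb)"
    by (rule nn_integral_liminf) (use bergman_measurable[OF f] in measurable)
  also have "\<dots> = liminf (\<lambda>n. ennreal (nsq (f n)))"
    using bergman_square_integrable[OF f] by (simp add: nn_integral_eq_integral nsq_def)
  also have "\<dots> \<le> ennreal L"
    by (rule Liminf_le) (use L in \<open>auto elim!: eventually_mono intro: ennreal_leI\<close>)
  finally have le: "(\<integral>\<^sup>+x. ennreal ((cmod (u x))\<^sup>2) \<partial>unit_leb) \<le> ennreal L" .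
  have int: "integrable unit_leb (\<lambda>x. (cmod (u x))\<^sup>2)"
    unfolding integrable_iff_bounded using m le by (auto simp: le_less_trans)
  show "u \<in> bergman" by (rule bergmanI[OF h o int])
  show "nsq u \<le> L" using le int L0 by (simp add: nn_integral_eq_integral nsq_def)
qed

text \<open>Montel's theorem: a diagonal sequence converges on a countable dense set, equicontinuity
  extends the convergence to every point, local boundedness makes the limit harmonic, and Fatou's
  lemma puts it into the space. Convergence is pointwise only; norms may drop in the limit.\<close>

lemma bergman_compactness:
  fixes f :: "nat \<Rightarrow> 'a::euclidean_space \<Rightarrow> complex"
  assumes f: "\<And>n. f n \<in> bergman" and B: "\<And>n. nsq (f n) \<le> B"
  obtains k u where "strict_mono (k :: nat \<Rightarrow> nat)" "u \<in> bergman" "\<And>x. (\<lambda>n. f (k n) x) \<longlonglongrightarrow> u x"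
proof -
  have B0: "0 \<le> B" using B[of 0] nsq_nonneg[of "f 0"] by simp
  have "\<exists>C\<ge>0. \<forall>n. \<forall>x\<in>cball 0 r. norm (f n x) \<le> C" if r: "r < 1" for r
  proof -
    obtain C where C: "0 \<le> C" "\<And>(v :: 'a \<Rightarrow> complex) y. v \<in> bergman \<Longrightarrow> y \<in> cball 0 r \<Longrightarrow> norm (v y) \<le> C * (1 + nsq v)"
      using bergman_pointwise_bound[OF r] by metis
    have "norm (f n x) \<le> C * (1 + B)" if "x \<in> cball 0 r" for n x
      using C(2)[OF f[of n] that] mult_left_mono[OF add_left_mono[OF B[of n]] C(1), of 1] by linarith
    then show ?thesis using C(1) B0 by (intro exI[of _ "C * (1 + B)"]) auto
  qed
  then obtain C where C: "\<And>r. r < 1 \<Longrightarrow> 0 \<le> C r" "\<And>r n x. r < 1 \<Longrightarrow> x \<in> cball 0 r \<Longrightarrow> norm (f n x) \<le> C r"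
    by metis
  obtain S :: "'a set" where S: "countable S" "\<And>X. open X \<Longrightarrow> X \<noteq> {} \<Longrightarrow> \<exists>d\<in>S. d \<in> X"
    using countable_dense_setE by metis
  \<comment> \<open>The diagonal argument wants one bound for all points, whereas \<open>C\<close>
    depends on \<open>norm x\<close>. Adding 1 keeps the divisor positive, so that the scaling can
    be undone.\<close>
  define g where "g = (\<lambda>n x. f n x / of_real (1 + C (norm x)))"
  have gb: "norm (g n x) \<le> 1" if "x \<in> S \<inter> ball 0 1" for n x
  proof -
    have "norm (f n x) \<le> 1 + C (norm x)" "0 < 1 + C (norm x)"
      using C(1)[of "norm x"] C(2)[of "norm x" x n] that by auto
    then show ?thesis unfolding g_def norm_divide norm_of_real by (simp only: abs_of_pos divide_le_eq_1_pos)
  qed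
  obtain k where k: "strict_mono k" "\<And>x. x \<in> S \<inter> ball 0 1 \<Longrightarrow> \<exists>l. (\<lambda>n. g (k n) x) \<longlonglongrightarrow> l"
  proof (rule function_convergent_subsequence[of "S \<inter> ball 0 1" g 1])
    show "countable (S \<inter> ball 0 1)" using S(1) by simp
  qed (use gb in auto)
  have convS: "convergent (\<lambda>n. f (k n) x)" if x: "x \<in> S \<inter> ball 0 1" for x
  proof -
    from k(2)[OF x] obtain l where "(\<lambda>n. g (k n) x) \<longlonglongrightarrow> l" by blast
    then have "(\<lambda>n. g (k n) x * of_real (1 + C (norm x))) \<longlonglongrightarrow> l * of_real (1 + C (norm x))" by (intro tendsto_intros)
    moreover have "g n x * of_real (1 + C (norm x)) = f n x" for n
    proof -
      have "1 + C (norm x) \<noteq> 0" using C(1)[of "norm x"] x by auto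
      then have "complex_of_real (1 + C (norm x)) \<noteq> 0" by (simp only: of_real_eq_0_iff not_False_eq_True)
      then show ?thesis unfolding g_def by simp
    qed
    ultimately show ?thesis by (auto simp: convergent_def)
  qed
  have ball_sub: "ball x ((1 - norm x) / 2) \<subseteq> cball 0 ((1 + norm x) / 2)" for x :: 'a
  proof
    fix z assume "z \<in> ball x ((1 - norm x) / 2)"
    then have "norm (z - x) < (1 - norm x) / 2" by (simp add: dist_norm norm_minus_commute)
    then show "z \<in> cball 0 ((1 + norm x) / 2)" using norm_triangle_ineq2[of z x] by (simp add: field_simps)
  qed
  have conv: "convergent (\<lambda>n. f (k n) x)" for x
  proof (cases "x \<in> ball 0 1")
    case False
    then show ?thesis by (simp add: bergman_outside[OF f] convergent_const)
  next
    case True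
    define R where "R = (1 - norm x) / 2"
    have R: "0 < R" using True by (simp add: R_def)
    have r1: "(1 + norm x) / 2 < 1" using True by simp
    define D where "D = C ((1 + norm x) / 2)"
    have D: "0 \<le> D" "\<And>n z. z \<in> ball x R \<Longrightarrow> norm (f n z) \<le> D"
      using C(1)[OF r1] C(2)[OF r1] ball_sub[of x] by (auto simp: D_def R_def)
    have sub1: "ball x R \<subseteq> ball 0 1"
    proof -
      have "cball 0 ((1 + norm x) / 2) \<subseteq> ball (0::'a) 1" using r1 by auto
      then show ?thesis using ball_sub[of x] unfolding R_def by blast
    qed
    obtain L where L: "0 \<le> L" "\<And>(u :: 'a \<Rightarrow> complex) B y z. harmonic_on (ball x R) u \<Longrightarrow>
      (\<And>z. z \<in> ball x R \<Longrightarrow> norm (u z) \<le> B) \<Longrightarrow> y \<in> ball x (R / 2) \<Longrightarrow> z \<in> ball x (R / 2) \<Longrightarrow>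
      norm (u y - u z) \<le> L * B * norm (y - z)"
      using harmonic_equicontinuous[OF R] by metis
    have hf: "harmonic_on (ball x R) (f n)" for n
      using harmonic_on_subset[OF bergman_harmonic[OF f] sub1] .
    have "Cauchy (\<lambda>n. f (k n) x)"
    proof (rule metric_CauchyI)
      fix e :: real assume e: "0 < e"
      \<comment> \<open>Chosen so that moving from \<open>x\<close> to a point \<open>s\<close> of
        the dense set changes every function of the sequence by at most
        \<open>e / 3\<close>.\<close>
      define d where "d = min (R / 2) (e / (3 * (L * D + 1)))"
      have LD: "0 \<le> L * D" using L(1) D(1) by simp
      have d: "d \<le> R / 2" "d \<le> e / (3 * (L * D + 1))"
        unfolding d_def by (rule min.cobounded1 min.cobounded2)+
      have d0: "0 < d" using R e LD by (auto simp: d_def)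
      obtain s where s: "s \<in> S" "s \<in> ball x d" using S(2)[of "ball x d"] d0 by auto
      have sR: "s \<in> ball x (R / 2)" "x \<in> ball x (R / 2)" "s \<in> ball x R" using s d R by auto
      have close: "norm (f n x - f n s) \<le> e / 3" for n
      proof -
        have "norm (f n x - f n s) \<le> L * D * norm (x - s)" by (rule L(2)[OF hf D(2) sR(2,1)])
        also have "\<dots> \<le> (L * D + 1) * (e / (3 * (L * D + 1)))"
          using s d LD by (intro mult_mono) (auto simp: dist_norm)
        also have "\<dots> = e / 3"
        proof -
          have "L * D + 1 \<noteq> 0" using LD by linarith
          then show ?thesis by (simp only: divide_divide_eq_left[symmetric] times_divide_eq_right) (simp add: field_simps)
        qed
        finally show ?thesis .
      qed
      have "s \<in> S \<inter> ball 0 1" using s(1) sR(3) sub1 by blast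
      then have "Cauchy (\<lambda>n. f (k n) s)" by (rule convergent_Cauchy[OF convS])
      then obtain N where N: "\<And>m n. m \<ge> N \<Longrightarrow> n \<ge> N \<Longrightarrow> dist (f (k m) s) (f (k n) s) < e / 3"
        using e unfolding Cauchy_def by (metis divide_pos_pos zero_less_numeral)
      show "\<exists>N. \<forall>m\<ge>N. \<forall>n\<ge>N. dist (f (k m) x) (f (k n) x) < e"
      proof (intro exI[of _ N] allI impI)
        fix m n assume "N \<le> m" "N \<le> n"
        then have "norm (f (k m) s - f (k n) s) < e / 3" using N by (simp add: dist_norm)
        moreover have "f (k m) x - f (k n) x = (f (k m) x - f (k m) s) + (f (k m) s - f (k n) s) - (f (k n) x - f (k n) s)"
          by simp
        moreover have "norm ((f (k m) x - f (k m) s) + (f (k m) s - f (k n) s) - (f (k n) x - f (k n) s)) \<le>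
          norm (f (k m) x - f (k m) s) + norm (f (k m) s - f (k n) s) + norm (f (k n) x - f (k n) s)"
          by (meson add_right_mono norm_triangle_ineq norm_triangle_ineq4 order_trans)
        ultimately show "dist (f (k m) x) (f (k n) x) < e"
          using close[of "k m"] close[of "k n"] by (simp add: dist_norm)
      qed
    qed
    then show ?thesis by (simp add: Cauchy_convergent_iff)
  qed
  define u where "u = (\<lambda>x. lim (\<lambda>n. f (k n) x))"
  have lim: "(\<lambda>n. f (k n) x) \<longlonglongrightarrow> u x" for x
    using conv[of x] by (simp add: u_def convergent_LIMSEQ_iff)
  have "harmonic_on (ball 0 1) u"
  proof (rule harmonic_on_locally)
    fix x :: 'a assume x: "x \<in> ball 0 1"
    define R where "R = (1 - norm x) / 2"
    have R: "0 < R" using x by (simp add: R_def)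
    have r1: "(1 + norm x) / 2 < 1" using x by simp
    have sub1: "ball x R \<subseteq> ball 0 1"
    proof -
      have "cball 0 ((1 + norm x) / 2) \<subseteq> ball (0::'a) 1" using r1 by auto
      then show ?thesis using ball_sub[of x] unfolding R_def by blast
    qed
    have "harmonic_on (ball x (R / 2)) u"
    proof (rule harmonic_on_limit_ball[OF R])
      show "harmonic_on (ball x R) (f (k n))" for n
        using harmonic_on_subset[OF bergman_harmonic[OF f] sub1] .
      show "norm (f (k n) y) \<le> C ((1 + norm x) / 2)" if "y \<in> ball x R" for n y
        using C(2)[OF r1] ball_sub[of x] that by (auto simp: R_def)
    qed (rule lim)
    then show "\<exists>S. open S \<and> x \<in> S \<and> harmonic_on S u"
      using R by (intro exI[of _ "ball x (R / 2)"]) auto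
  qed simp
  from bergman_fatou(1)[of "\<lambda>n. f (k n)", OF f lim this, of B] B
  have "u \<in> bergman" by simp
  with k(1) lim that show ?thesis by blast
qed

section \<open>The Toeplitz operator\<close>

text \<open>The first-order condition at an extremum, used for all variational arguments below. With
  \<open>d > b\<close> and \<open>d > 0\<close> the value at \<open>t = - a / d\<close> would be
  negative unless \<open>a = 0\<close>.\<close>

lemma nonneg_quadratic_imp_zero:
  fixes a b :: real
  assumes "\<And>t. 0 \<le> 2 * t * a + t\<^sup>2 * b"
  shows "a = 0"
proof (rule ccontr)
  assume a: "a \<noteq> 0"
  define d where "d = \<bar>b\<bar> + 1"
  have d: "0 < d" "b < d" by (auto simp: d_def)
  have "0 \<le> 2 * (- a / d) * a + (- a / d)\<^sup>2 * b" by (rule assms)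
  also have "\<dots> = (a\<^sup>2 / d) * (b / d - 2)" using d by (simp add: field_simps power2_eq_square)
  finally have "0 \<le> (a\<^sup>2 / d) * (b / d - 2)" .
  moreover have "0 < a\<^sup>2 / d" using a d by simp
  ultimately have "0 \<le> b / d - 2" using mult_pos_neg[of "a\<^sup>2 / d" "b / d - 2"] by linarith
  moreover have "b / d < 1" using d by simp
  ultimately show False by simp
qed

lemma nsq_add:
  assumes "u \<in> L2 (ball 0 1)" "v \<in> L2 (ball 0 1)"
  shows "nsq (\<lambda>x. u x + v x) = nsq u + 2 * Re (ip u v) + nsq v"
proof -
  have r: "ip w (\<lambda>x. u x + v x) = ip w u + ip w v" if "w \<in> L2 (ball 0 1)" for w
    using ip_add_left[OF assms that] ip_commute[of w] by (metis complex_cnj_add)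
  have "of_real (nsq (\<lambda>x. u x + v x)) = ip (\<lambda>x. u x + v x) (\<lambda>x. u x + v x)" by (simp add: ip_self)
  also have "\<dots> = ip u u + ip u v + (ip v u + ip v v)"
    using assms by (simp add: ip_add_left L2_add r)
  finally have "Re (of_real (nsq (\<lambda>x. u x + v x))) = Re (ip u u + ip u v + (ip v u + ip v v))" by simp
  then show ?thesis by (simp add: ip_self ip_commute[of v u])
qed

lemma ip_cmult_right: "ip f (\<lambda>x. k * g x) = cnj k * ip f g"
  using ip_commute[of f "\<lambda>x. k * g x"] ip_commute[of f g] by (simp add: ip_cmult_left)

lemma ip_sum_left:
  assumes "finite I" "\<And>i. i \<in> I \<Longrightarrow> u i \<in> bergman" "g \<in> bergman"
  shows "ip (\<lambda>x. \<Sum>i\<in>I. k i * u i x) g = (\<Sum>i\<in>I. k i * ip (u i) g)"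
  using assms
proof (induction I rule: finite_induct)
  case empty
  then show ?case by (simp add: L2_inner_def)
next
  case (insert i I)
  have "ip (\<lambda>x. k i * u i x + (\<Sum>i\<in>I. k i * u i x)) g = ip (\<lambda>x. k i * u i x) g + ip (\<lambda>x. \<Sum>i\<in>I. k i * u i x) g"
    using insert.prems by (intro ip_add_left bergman_L2 bergman_cmult bergman_sum) auto
  then show ?case using insert by (simp add: ip_cmult_left)
qed

text \<open>Nonnegativity, boundedness and the support condition are merged into one inequality that
  holds almost everywhere. Lower bounds for \<open>V\<close> on smaller balls are supplied
  separately to the lower estimate.\<close>

locale weighted_bergman =
  fixes V :: "'a::euclidean_space \<Rightarrow> real" and c M :: real
  assumes V_measurable: "V \<in> borel_measurable unit_leb"
    and V_bounds: "AE x in unit_leb. 0 \<le> V x \<and> V x \<le> M * indicator (cball 0 c) x"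
    and c: "0 < c" "c < 1" and M: "0 < M"
begin

abbreviation T :: "('a \<Rightarrow> complex) \<Rightarrow> 'a \<Rightarrow> complex" where
  "T \<equiv> toeplitz (ball 0 1) V"

text \<open>The sesquilinear form of the operator. It is written without the projection, so its
  properties are available before the projection is known to exist.\<close>

definition q :: "('a \<Rightarrow> complex) \<Rightarrow> ('a \<Rightarrow> complex) \<Rightarrow> complex" where
  "q u v = ip (\<lambda>x. of_real (V x) * u x) v"

definition qs :: "('a \<Rightarrow> complex) \<Rightarrow> real" where
  "qs u = (LINT x|unit_leb. V x * (cmod (u x))\<^sup>2)"

lemma AE_V_abs: "AE x in unit_leb. \<bar>V x\<bar> \<le> M"
  using V_bounds
proof eventually_elim
  case (elim x)
  then show ?case using M by (cases "x \<in> cball 0 c") auto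
qed

lemma L2_V_mult:
  assumes "u \<in> L2 (ball 0 1)"
  shows "(\<lambda>x. of_real (V x) * u x) \<in> L2 (ball 0 1)"
proof -
  have u: "u \<in> borel_measurable unit_leb" "integrable unit_leb (\<lambda>x. (cmod (u x))\<^sup>2)"
    using assms by (auto simp: L2_def)
  have "integrable unit_leb (\<lambda>x. (cmod (of_real (V x) * u x))\<^sup>2)"
  proof (rule Bochner_Integration.integrable_bound[OF integrable_mult_right[OF u(2), of "M\<^sup>2"]])
    show "(\<lambda>x. (cmod (of_real (V x) * u x))\<^sup>2) \<in> borel_measurable unit_leb"
      using u V_measurable by measurable
    show "AE x in unit_leb. norm ((cmod (of_real (V x) * u x))\<^sup>2) \<le> norm (M\<^sup>2 * (cmod (u x))\<^sup>2)"
      using AE_V_abs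
    proof eventually_elim
      case (elim x)
      then have "\<bar>V x\<bar>\<^sup>2 \<le> M\<^sup>2" by (intro power_mono) auto
      then show ?case by (auto simp: norm_mult power_mult_distrib intro!: mult_right_mono)
    qed
  qed
  then show ?thesis using u V_measurable by (auto simp: L2_def)
qed

lemma integrable_qs:
  assumes "u \<in> L2 (ball 0 1)"
  shows "integrable unit_leb (\<lambda>x. V x * (cmod (u x))\<^sup>2)"
proof -
  have u: "u \<in> borel_measurable unit_leb" "integrable unit_leb (\<lambda>x. (cmod (u x))\<^sup>2)"
    using assms by (auto simp: L2_def)
  show ?thesis
  proof (rule Bochner_Integration.integrable_bound[OF integrable_mult_right[OF u(2), of M]])
    show "(\<lambda>x. V x * (cmod (u x))\<^sup>2) \<in> borel_measurable unit_leb" using u V_measurable by measurable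
    show "AE x in unit_leb. norm (V x * (cmod (u x))\<^sup>2) \<le> norm (M * (cmod (u x))\<^sup>2)"
      using AE_V_abs by eventually_elim (use M in \<open>auto simp: abs_mult intro!: mult_right_mono\<close>)
  qed
qed

lemma q_self: "q u u = of_real (qs u)"
proof -
  have eq: "of_real (V x) * u x * cnj (u x) = of_real (V x * (cmod (u x))\<^sup>2)" for x
    by (simp only: mult.assoc complex_norm_square[symmetric] of_real_mult)
  show ?thesis unfolding q_def L2_inner_def eq qs_def by (rule integral_complex_of_real)
qed

lemma q_commute: "q v u = cnj (q u v)"
proof -
  have "q v u = ip v (\<lambda>x. of_real (V x) * u x)"
    unfolding q_def L2_inner_def by (intro Bochner_Integration.integral_cong) (auto simp: mult_ac)
  then show ?thesis using ip_commute[of v] by (simp add: q_def)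
qed

lemma q_add_left:
  assumes "u \<in> L2 (ball 0 1)" "v \<in> L2 (ball 0 1)" "w \<in> L2 (ball 0 1)"
  shows "q (\<lambda>x. u x + v x) w = q u w + q v w"
  unfolding q_def distrib_left by (intro ip_add_left L2_V_mult assms)

lemma q_cmult_left: "q (\<lambda>x. k * u x) w = k * q u w"
  unfolding q_def using ip_cmult_left[of k "\<lambda>x. of_real (V x) * u x" w] by (simp add: mult.left_commute)

lemma q_cmult_right: "q w (\<lambda>x. k * u x) = cnj k * q w u"
  unfolding q_def by (rule ip_cmult_right)

lemma q_sum_left:
  assumes "finite I" "\<And>i. i \<in> I \<Longrightarrow> u i \<in> bergman" "g \<in> bergman"
  shows "q (\<lambda>x. \<Sum>i\<in>I. k i * u i x) g = (\<Sum>i\<in>I. k i * q (u i) g)"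
  using assms
proof (induction I rule: finite_induct)
  case empty
  then show ?case by (simp add: q_def L2_inner_def)
next
  case (insert i I)
  have "q (\<lambda>x. k i * u i x + (\<Sum>i\<in>I. k i * u i x)) g = q (\<lambda>x. k i * u i x) g + q (\<lambda>x. \<Sum>i\<in>I. k i * u i x) g"
    using insert.prems by (intro q_add_left bergman_L2 bergman_cmult bergman_sum) auto
  then show ?case using insert by (simp add: q_cmult_left)
qed

lemma qs_add:
  assumes "u \<in> L2 (ball 0 1)" "v \<in> L2 (ball 0 1)"
  shows "qs (\<lambda>x. u x + v x) = qs u + 2 * Re (q u v) + qs v"
proof -
  have r: "q w (\<lambda>x. u x + v x) = q w u + q w v" if "w \<in> L2 (ball 0 1)" for w
    using q_add_left[OF assms that] q_commute[of w] by (metis complex_cnj_add)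
  have "of_real (qs (\<lambda>x. u x + v x)) = q (\<lambda>x. u x + v x) (\<lambda>x. u x + v x)" by (simp add: q_self)
  also have "\<dots> = q u u + q u v + (q v u + q v v)"
    using assms by (simp add: q_add_left L2_add r)
  finally have "Re (of_real (qs (\<lambda>x. u x + v x))) = Re (q u u + q u v + (q v u + q v v))" by simp
  then show ?thesis by (simp add: q_self q_commute[of v u])
qed

lemma qs_cmult: "qs (\<lambda>x. k * u x) = (cmod k)\<^sup>2 * qs u"
proof -
  have "V x * (cmod (k * u x))\<^sup>2 = (cmod k)\<^sup>2 * (V x * (cmod (u x))\<^sup>2)" for x
    by (simp add: norm_mult power_mult_distrib)
  then show ?thesis unfolding qs_def by (simp only: integral_mult_right_zero)
qed

lemma qs_le:
  assumes "u \<in> L2 (ball 0 1)"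
  shows "qs u \<le> M * nsq u"
proof -
  have u: "integrable unit_leb (\<lambda>x. (cmod (u x))\<^sup>2)" using assms by (auto simp: L2_def)
  have "qs u \<le> (LINT x|unit_leb. M * (cmod (u x))\<^sup>2)"
    unfolding qs_def
  proof (rule integral_mono_AE[OF integrable_qs[OF assms] integrable_mult_right[OF u]])
    show "AE x in unit_leb. V x * (cmod (u x))\<^sup>2 \<le> M * (cmod (u x))\<^sup>2"
      using AE_V_abs by eventually_elim (auto intro!: mult_right_mono)
  qed
  then show ?thesis by (simp add: nsq_def)
qed

text \<open>Expand \<open>0 \<le> nsq (2 V u - v)\<close>. The weight 1/2 in front of
  \<open>nsq v\<close> leaves half of the norm in the functional \<open>J\<close> of
  \<open>riesz\<close> and so makes it bounded below and coercive.\<close>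

lemma q_bound:
  assumes "u \<in> L2 (ball 0 1)" "v \<in> L2 (ball 0 1)"
  shows "2 * Re (q u v) \<le> 2 * M\<^sup>2 * nsq u + nsq v / 2"
proof -
  have "0 \<le> nsq (\<lambda>x. 2 * (of_real (V x) * u x) + (- 1) * v x)" by (rule nsq_nonneg)
  also have "\<dots> = 4 * nsq (\<lambda>x. of_real (V x) * u x) - 4 * Re (q u v) + nsq v"
    using nsq_add[OF L2_cmult[OF L2_V_mult[OF assms(1)]] L2_cmult[OF assms(2)], of 2 "- 1"]
    by (simp add: nsq_cmult[of 2] nsq_cmult[of "-1", simplified] ip_cmult_left[of 2] ip_cmult_right[of _ "-1", simplified] q_def)
  also have "nsq (\<lambda>x. of_real (V x) * u x) \<le> M\<^sup>2 * nsq u"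
  proof -
    have u: "integrable unit_leb (\<lambda>x. (cmod (u x))\<^sup>2)" using assms by (auto simp: L2_def)
    have "nsq (\<lambda>x. of_real (V x) * u x) \<le> (LINT x|unit_leb. M\<^sup>2 * (cmod (u x))\<^sup>2)"
      unfolding nsq_def
    proof (rule integral_mono_AE[OF _ integrable_mult_right[OF u]])
      show "integrable unit_leb (\<lambda>x. (cmod (of_real (V x) * u x))\<^sup>2)"
        using L2_V_mult[OF assms(1)] by (simp add: L2_def)
      show "AE x in unit_leb. (cmod (of_real (V x) * u x))\<^sup>2 \<le> M\<^sup>2 * (cmod (u x))\<^sup>2"
        using AE_V_abs
      proof eventually_elim
        case (elim x)
        then have "\<bar>V x\<bar>\<^sup>2 \<le> M\<^sup>2" by (intro power_mono) auto
        then show ?case by (auto simp: norm_mult power_mult_distrib intro!: mult_right_mono)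
      qed
    qed
    then show ?thesis by (simp add: nsq_def)
  qed
  finally show ?thesis by simp
qed

text \<open>Compactness of the operator in a usable form. \<open>V\<close> lives on the ball of
  radius \<open>c < 1\<close>, where bounded sequences of the space are uniformly bounded, so
  dominated convergence applies to both forms, although \<open>nsq (f n)\<close> need not converge
  to \<open>nsq u\<close>.\<close>

lemma bounded_convergence:
  assumes f: "\<And>n::nat. f n \<in> bergman" and B: "\<And>n. nsq (f n) \<le> B"
    and lim: "\<And>x. (\<lambda>n. f n x) \<longlonglongrightarrow> u x" and u: "u \<in> bergman"
  shows q_convergence: "v \<in> bergman \<Longrightarrow> (\<lambda>n. q (f n) v) \<longlonglongrightarrow> q u v"
    and qs_convergence: "(\<lambda>n. qs (f n)) \<longlonglongrightarrow> qs u"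
proof -
  obtain C where C: "0 \<le> C" "\<And>(v :: 'a \<Rightarrow> complex) y. v \<in> bergman \<Longrightarrow> y \<in> cball 0 c \<Longrightarrow> norm (v y) \<le> C * (1 + nsq v)"
    using bergman_pointwise_bound[OF c(2)] by metis
  define D where "D = C * (1 + B)"
  have D: "norm (f n y) \<le> D" if "y \<in> cball 0 c" for n y
    using C(2)[OF f[of n] that] mult_left_mono[OF add_left_mono[OF B[of n]] C(1), of 1] by (simp add: D_def)
  have D0: "0 \<le> D" using order_trans[OF norm_ge_zero D[of 0 0]] c by simp
  have Vf: "AE x in unit_leb. \<forall>n. \<bar>V x\<bar> * norm (f n x) \<le> M * D"
    using V_bounds
  proof eventually_elim
    case (elim x)
    show ?case
    proof
      fix n
      show "\<bar>V x\<bar> * norm (f n x) \<le> M * D"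
      proof (cases "x \<in> cball 0 c")
        case True
        then show ?thesis using elim D[of x n] M D0 by (auto intro!: mult_mono)
      next
        case False
        then have "V x = 0" using elim by auto
        then show ?thesis using M D0 by simp
      qed
    qed
  qed
  note [measurable] = V_measurable bergman_measurable[OF f] bergman_measurable[OF u]
  show "(\<lambda>n. q (f n) v) \<longlonglongrightarrow> q u v" if v: "v \<in> bergman"
    unfolding q_def L2_inner_def
  proof (rule integral_dominated_convergence[where w = "\<lambda>x. M * D * (1 + (cmod (v x))\<^sup>2)"])
    note [measurable] = bergman_measurable[OF v]
    show "(\<lambda>x. of_real (V x) * u x * cnj (v x)) \<in> borel_measurable unit_leb" by measurable
    show "(\<lambda>x. of_real (V x) * f n x * cnj (v x)) \<in> borel_measurable unit_leb" for n by measurable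
    show "integrable unit_leb (\<lambda>x. M * D * (1 + (cmod (v x))\<^sup>2))"
      by (intro integrable_mult_right Bochner_Integration.integrable_add integrable_const_unit_leb
          bergman_square_integrable[OF v])
    show "AE x in unit_leb. (\<lambda>n. of_real (V x) * f n x * cnj (v x)) \<longlonglongrightarrow> of_real (V x) * u x * cnj (v x)"
      by (intro AE_I2 tendsto_intros lim)
    show "AE x in unit_leb. norm (of_real (V x) * f n x * cnj (v x)) \<le> M * D * (1 + (cmod (v x))\<^sup>2)" for n
      using Vf
    proof eventually_elim
      case (elim x)
      have "0 \<le> (cmod (v x) - 1)\<^sup>2" by simp
      then have "2 * cmod (v x) \<le> 1 + (cmod (v x))\<^sup>2" by (simp add: power2_diff)
      then have "cmod (v x) \<le> 1 + (cmod (v x))\<^sup>2" using norm_ge_zero[of "v x"] by linarith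
      then have "(\<bar>V x\<bar> * norm (f n x)) * cmod (v x) \<le> (M * D) * (1 + (cmod (v x))\<^sup>2)"
        using elim M D0 by - (rule mult_mono, auto)
      then show ?case by (simp add: norm_mult)
    qed
  qed
  show "(\<lambda>n. qs (f n)) \<longlonglongrightarrow> qs u"
    unfolding qs_def
  proof (rule integral_dominated_convergence[where w = "\<lambda>x. M * D * D"])
    show "AE x in unit_leb. (\<lambda>n. V x * (cmod (f n x))\<^sup>2) \<longlonglongrightarrow> V x * (cmod (u x))\<^sup>2"
      by (intro AE_I2 tendsto_intros lim)
    show "AE x in unit_leb. norm (V x * (cmod (f n x))\<^sup>2) \<le> M * D * D" for n
      using Vf V_bounds
    proof eventually_elim
      case (elim x)
      show ?case
      proof (cases "x \<in> cball 0 c")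
        case True
        have "(\<bar>V x\<bar> * norm (f n x)) * norm (f n x) \<le> (M * D) * D"
          using elim D[OF True, of n] M D0 by - (rule mult_mono, auto)
        then show ?thesis by (simp add: abs_mult power2_eq_square mult_ac)
      next
        case False
        then show ?thesis using elim M D0 by auto
      qed
    qed
    show "integrable unit_leb (\<lambda>x::'a. M * D * D)" by (rule integrable_const_unit_leb)
  qed measurable
qed

text \<open>Existence of the projection of \<open>V u\<close> by the Dirichlet principle: a
  minimising sequence of \<open>J\<close> is bounded by coercivity, has a pointwise convergent
  subsequence, and its limit is a minimiser. The Euler equation at the minimum is the claim.
  Compactness and Fatou's lemma replace completeness of the space.\<close>

lemma riesz:
  assumes u: "u \<in> bergman"
  obtains h where "h \<in> bergman" "\<And>g. g \<in> bergman \<Longrightarrow> ip h g = q u g"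
proof -
  define J where "J = (\<lambda>h. nsq h - 2 * Re (q u h))"
  have J_lower: "nsq h / 2 - 2 * M\<^sup>2 * nsq u \<le> J h" if "h \<in> bergman" for h
    using q_bound[OF bergman_L2[OF u] bergman_L2[OF that]] by (simp add: J_def)
  have bdd: "bdd_below (J ` bergman)"
  proof (rule bdd_belowI2)
    fix h :: "'a \<Rightarrow> complex" assume "h \<in> bergman"
    then show "- 2 * M\<^sup>2 * nsq u \<le> J h" using J_lower[of h] nsq_nonneg[of h] by simp
  qed
  define m where "m = Inf (J ` bergman)"
  have m_le: "m \<le> J h" if "h \<in> bergman" for h
    unfolding m_def using that bdd by (intro cInf_lower) auto
  have "\<exists>h\<in>bergman. J h < m + inverse (real (Suc n))" for n
  proof -
    have "Inf (J ` bergman) < m + inverse (real (Suc n))" by (simp add: m_def)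
    then show ?thesis using cInf_lessD[of "J ` bergman"] bergman_zero by blast
  qed
  then obtain h where h: "\<And>n. h n \<in> bergman" "\<And>n. J (h n) < m + inverse (real (Suc n))" by metis
  have hB: "nsq (h n) \<le> 2 * (m + 1 + 2 * M\<^sup>2 * nsq u)" for n
  proof -
    have "inverse (real (Suc n)) \<le> 1" by (simp add: field_simps)
    then show ?thesis using J_lower[OF h(1)[of n]] h(2)[of n] by simp
  qed
  obtain k h0 where k: "strict_mono k" and h0: "h0 \<in> bergman" and lim: "\<And>x. (\<lambda>n. h (k n) x) \<longlonglongrightarrow> h0 x"
    using bergman_compactness[of h, OF h(1) hB] by metis
  have qlim: "(\<lambda>n. q (h (k n)) u) \<longlonglongrightarrow> q h0 u"
    by (rule q_convergence[OF h(1) hB lim h0 u])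
  have "J h0 \<le> m"
  \<comment> \<open>The norms along the sequence need not converge; they are only eventually below
    the limit of the remaining terms plus \<open>e\<close>, which is what
    \<open>bergman_fatou\<close> accepts.\<close>
  proof (rule field_le_epsilon)
    fix e :: real assume e: "0 < e"
    have "(\<lambda>n. m + inverse (real (Suc (k n))) + 2 * Re (q (h (k n)) u)) \<longlonglongrightarrow> m + 0 + 2 * Re (q h0 u)"
      by (intro tendsto_intros qlim)
        (rule LIMSEQ_subseq_LIMSEQ[OF LIMSEQ_inverse_real_of_nat k, unfolded o_def])
    then have "\<forall>\<^sub>F n in sequentially. m + inverse (real (Suc (k n))) + 2 * Re (q (h (k n)) u) < m + 2 * Re (q h0 u) + e"
      using e by (intro order_tendstoD(2)) auto
    then have "\<forall>\<^sub>F n in sequentially. nsq (h (k n)) \<le> m + 2 * Re (q h0 u) + e"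
    proof eventually_elim
      case (elim n)
      have "Re (q u (h (k n))) = Re (q (h (k n)) u)" by (subst q_commute) simp
      then show ?case using elim h(2)[of "k n"] by (simp add: J_def)
    qed
    from bergman_fatou(2)[OF h(1) lim bergman_harmonic[OF h0] this]
    have "nsq h0 \<le> m + 2 * Re (q h0 u) + e" .
    moreover have "Re (q u h0) = Re (q h0 u)" by (subst q_commute) simp
    ultimately show "J h0 \<le> m + e" by (simp add: J_def)
  qed
  then have min: "J h0 \<le> J g" if "g \<in> bergman" for g using m_le[OF that] by simp
  have re: "Re (ip h0 g) = Re (q u g)" if g: "g \<in> bergman" for g
  proof -
    have "0 \<le> 2 * t * (Re (ip h0 g) - Re (q u g)) + t\<^sup>2 * nsq g" for t
    proof -
      have tg: "(\<lambda>x. of_real t * g x) \<in> bergman" by (rule bergman_cmult[OF g])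
      have "q u (\<lambda>x. h0 x + of_real t * g x) = q u h0 + of_real t * q u g"
        using q_add_left[OF bergman_L2[OF h0] bergman_L2[OF tg] bergman_L2[OF u]] q_commute[of u]
        by (simp add: q_cmult_left)
      moreover have "nsq (\<lambda>x. h0 x + of_real t * g x) = nsq h0 + 2 * t * Re (ip h0 g) + t\<^sup>2 * nsq g"
        using nsq_add[OF bergman_L2[OF h0] bergman_L2[OF tg]] by (simp add: nsq_cmult ip_cmult_right)
      moreover have "J h0 \<le> J (\<lambda>x. h0 x + of_real t * g x)" by (rule min[OF bergman_add[OF h0 tg]])
      ultimately show ?thesis by (simp add: J_def algebra_simps)
    qed
    from nonneg_quadratic_imp_zero[OF this] show ?thesis by simp
  qed
  \<comment> \<open>Testing with \<i> times \<open>g\<close> turns the identity of real parts into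
    that of imaginary parts.\<close>
  have "ip h0 g = q u g" if g: "g \<in> bergman" for g
    using re[OF g] re[OF bergman_cmult[OF g, of \<i>]] by (simp add: ip_cmult_right q_cmult_right complex_eq_iff)
  with h0 that show ?thesis by blast
qed

text \<open>Resolves the definite description in \<open>harmonic_proj\<close>: existence is
  \<open>riesz\<close>, and two candidates differ by an element orthogonal to itself.\<close>

lemma toeplitz_bergman:
  assumes u: "u \<in> bergman"
  shows ip_toeplitz: "g \<in> bergman \<Longrightarrow> ip (T u) g = q u g"
    and toeplitz_unique: "\<And>h. h \<in> bergman \<Longrightarrow> (\<And>g. g \<in> bergman \<Longrightarrow> ip h g = q u g) \<Longrightarrow> T u = h"
proof -
  let ?P = "\<lambda>h. h \<in> bergman \<and> (\<forall>g\<in>bergman. ip (\<lambda>x. of_real (V x) * u x - h x) g = 0)"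
  have P: "?P h \<longleftrightarrow> h \<in> bergman \<and> (\<forall>g\<in>bergman. ip h g = q u g)" for h
    using ip_diff_left[OF L2_V_mult[OF bergman_L2[OF u]] bergman_L2 bergman_L2, of h] by (auto simp: q_def)
  have uniq: "h = h'" if "?P h" "?P h'" for h h'
  proof -
    have h: "h \<in> bergman" "h' \<in> bergman" using that by auto
    then have d: "(\<lambda>x. h x - h' x) \<in> bergman" by (rule bergman_diff)
    have "ip (\<lambda>x. h x - h' x) (\<lambda>x. h x - h' x) = 0"
      using that[unfolded P] d ip_diff_left[OF bergman_L2[OF h(1)] bergman_L2[OF h(2)] bergman_L2[OF d]] by simp
    then have "nsq (\<lambda>x. h x - h' x) = 0" by (simp add: ip_self)
    from nsq_eq_0[OF d this] show ?thesis by (auto simp: fun_eq_iff)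
  qed
  obtain h where h: "h \<in> bergman" "\<And>g. g \<in> bergman \<Longrightarrow> ip h g = q u g" using riesz[OF u] by metis
  have The: "T u = h'" if "?P h'" for h'
    unfolding toeplitz_def harmonic_proj_def using that uniq by (intro the_equality) auto
  have The': "T u = h'" if "h' \<in> bergman" "\<And>g. g \<in> bergman \<Longrightarrow> ip h' g = q u g" for h'
    by (rule The, subst P) (use that in blast)
  have Tu: "T u = h" by (rule The') (use h in auto)
  show "ip (T u) g = q u g" if "g \<in> bergman" unfolding Tu by (rule h(2)[OF that])
  show "T u = h" if "h \<in> bergman" "\<And>g. g \<in> bergman \<Longrightarrow> ip h g = q u g" for h
    by (rule The') (use that in auto)
qed

text \<open>The weak form of the eigenvalue equation. From here on the projection enters only
  through this equivalence.\<close>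

lemma eigenspace_iff:
  "u \<in> eigenspace bergman T \<mu> \<longleftrightarrow> u \<in> bergman \<and> (\<forall>g\<in>bergman. q u g = of_real \<mu> * ip u g)"
proof
  assume "u \<in> eigenspace bergman T \<mu>"
  then have u: "u \<in> bergman" "T u = (\<lambda>x. of_real \<mu> * u x)" by (auto simp: eigenspace_def)
  then show "u \<in> bergman \<and> (\<forall>g\<in>bergman. q u g = of_real \<mu> * ip u g)"
    using ip_toeplitz[OF u(1)] by (simp add: ip_cmult_left)
next
  assume u: "u \<in> bergman \<and> (\<forall>g\<in>bergman. q u g = of_real \<mu> * ip u g)"
  then have "T u = (\<lambda>x. of_real \<mu> * u x)"
    by (intro toeplitz_unique bergman_cmult) (auto simp: ip_cmult_left)
  with u show "u \<in> eigenspace bergman T \<mu>" by (simp add: eigenspace_def)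
qed

end

section \<open>Counting eigenvalues\<close>

lemma sum_fun_eq: "(\<Sum>i\<in>I. f i) = (\<lambda>x. \<Sum>i\<in>I. f i x :: complex)"
proof
  fix x show "(\<Sum>i\<in>I. f i) x = (\<Sum>i\<in>I. f i x)"
    by (induction I rule: infinite_finite_induct) auto
qed

lemma cfun_independent_combination:
  assumes "cfun.independent B" "finite B" "(\<lambda>x. \<Sum>e\<in>B. a e * e x) = (\<lambda>_. 0)" "e \<in> B"
  shows "a e = 0"
proof -
  have "(\<Sum>e\<in>B. (\<lambda>x. a e * e x)) = 0" using assms(3) by (simp add: sum_fun_eq zero_fun_def)
  with assms cfun.dependent_finite[OF assms(2)] show ?thesis by blast
qed

lemma cfun_span_combination:
  assumes "finite B" "u \<in> cfun.span B"
  obtains a where "u = (\<lambda>x. \<Sum>e\<in>B. a e * e x)"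
  using assms cfun.span_finite[OF assms(1)] by (auto simp: sum_fun_eq)

context weighted_bergman
begin

lemma eigenspace_D:
  assumes "u \<in> eigenspace bergman T \<mu>"
  shows "u \<in> bergman" "g \<in> bergman \<Longrightarrow> q u g = of_real \<mu> * ip u g" "qs u = \<mu> * nsq u"
proof -
  show u: "u \<in> bergman" and e: "g \<in> bergman \<Longrightarrow> q u g = of_real \<mu> * ip u g" for g
    using assms eigenspace_iff by auto
  have "complex_of_real (qs u) = of_real (\<mu> * nsq u)" using e[OF u] by (simp add: q_self ip_self)
  then show "qs u = \<mu> * nsq u" by (simp only: of_real_eq_iff)
qed

lemma eigenspace_combination:
  assumes "finite B" "B \<subseteq> eigenspace bergman T \<mu>"
  shows "(\<lambda>x. \<Sum>e\<in>B. a e * e x) \<in> eigenspace bergman T \<mu>"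
proof -
  have b: "\<And>e. e \<in> B \<Longrightarrow> e \<in> bergman" using assms eigenspace_D(1) by blast
  show ?thesis
    unfolding eigenspace_iff
  proof (intro conjI ballI)
    show "(\<lambda>x. \<Sum>e\<in>B. a e * e x) \<in> bergman" using bergman_sum[of B "\<lambda>e. e" a] b by simp
    fix g :: "'a \<Rightarrow> complex" assume g: "g \<in> bergman"
    have "q (\<lambda>x. \<Sum>e\<in>B. a e * e x) g = (\<Sum>e\<in>B. a e * q e g)"
      using q_sum_left[OF assms(1) _ g, of "\<lambda>e. e" a] b by simp
    also have "\<dots> = (\<Sum>e\<in>B. of_real \<mu> * (a e * ip e g))"
      using assms(2) eigenspace_D(2)[OF _ g] by (intro sum.cong) (auto simp: mult_ac)
    also have "\<dots> = of_real \<mu> * ip (\<lambda>x. \<Sum>e\<in>B. a e * e x) g"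
      using ip_sum_left[OF assms(1) _ g, of "\<lambda>e. e" a] b by (simp add: sum_distrib_left)
    finally show "q (\<lambda>x. \<Sum>e\<in>B. a e * e x) g = of_real \<mu> * ip (\<lambda>x. \<Sum>e\<in>B. a e * e x) g" .
  qed
qed

lemma eigenspace_orthogonal:
  assumes "u \<in> eigenspace bergman T \<mu>" "v \<in> eigenspace bergman T \<nu>" "\<mu> \<noteq> \<nu>"
  shows "ip u v = 0"
proof -
  have "of_real \<mu> * ip u v = q u v" using eigenspace_D assms by metis
  also have "\<dots> = cnj (q v u)" by (rule q_commute)
  also have "\<dots> = cnj (of_real \<nu> * ip v u)" using eigenspace_D assms by metis
  also have "\<dots> = of_real \<nu> * ip u v" using ip_commute[of u v] by simp
  finally show ?thesis using assms(3) by simp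
qed

text \<open>Pythagoras across distinct eigenvalues. One vector \<open>w \<mu>\<close> per eigenvalue
  is enough, so no orthonormal basis inside an eigenspace has to be chosen.\<close>

lemma eigenvector_family:
  assumes "finite P" "\<And>\<mu>. \<mu> \<in> P \<Longrightarrow> w \<mu> \<in> eigenspace bergman T \<mu>"
  shows "nsq (\<lambda>x. \<Sum>\<mu>\<in>P. w \<mu> x) = (\<Sum>\<mu>\<in>P. nsq (w \<mu>))"
    and "qs (\<lambda>x. \<Sum>\<mu>\<in>P. w \<mu> x) = (\<Sum>\<mu>\<in>P. \<mu> * nsq (w \<mu>))"
proof -
  have "nsq (\<lambda>x. \<Sum>\<mu>\<in>P. w \<mu> x) = (\<Sum>\<mu>\<in>P. nsq (w \<mu>)) \<and> qs (\<lambda>x. \<Sum>\<mu>\<in>P. w \<mu> x) = (\<Sum>\<mu>\<in>P. \<mu> * nsq (w \<mu>))"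
    using assms
  proof (induction P rule: finite_induct)
    case empty
    then show ?case by (simp add: nsq_def qs_def)
  next
    case (insert \<nu> P)
    have wb: "w \<mu> \<in> bergman" if "\<mu> \<in> insert \<nu> P" for \<mu> using eigenspace_D(1) insert.prems that by blast
    have sb: "(\<lambda>x. \<Sum>\<mu>\<in>P. w \<mu> x) \<in> bergman" using bergman_sum[of P w "\<lambda>_. 1"] wb by simp
    have "ip (\<lambda>x. \<Sum>\<mu>\<in>P. 1 * w \<mu> x) (w \<nu>) = (\<Sum>\<mu>\<in>P. 1 * ip (w \<mu>) (w \<nu>))"
      using insert.hyps wb by (intro ip_sum_left) auto
    also have "\<dots> = 0" using insert by (intro sum.neutral) (auto intro!: eigenspace_orthogonal)
    finally have "ip (\<lambda>x. \<Sum>\<mu>\<in>P. w \<mu> x) (w \<nu>) = 0" by simp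
    then have 1: "ip (w \<nu>) (\<lambda>x. \<Sum>\<mu>\<in>P. w \<mu> x) = 0" by (subst ip_commute) simp
    then have 2: "q (w \<nu>) (\<lambda>x. \<Sum>\<mu>\<in>P. w \<mu> x) = 0"
      using eigenspace_D(2)[OF _ sb, of "w \<nu>" \<nu>] insert.prems by simp
    show ?case
      using insert wb sb 1 2 nsq_add[of "w \<nu>" "\<lambda>x. \<Sum>\<mu>\<in>P. w \<mu> x"] qs_add[of "w \<nu>" "\<lambda>x. \<Sum>\<mu>\<in>P. w \<mu> x"]
      by (simp add: bergman_L2 eigenspace_D(3))
  qed
  then show "nsq (\<lambda>x. \<Sum>\<mu>\<in>P. w \<mu> x) = (\<Sum>\<mu>\<in>P. nsq (w \<mu>))"
    "qs (\<lambda>x. \<Sum>\<mu>\<in>P. w \<mu> x) = (\<Sum>\<mu>\<in>P. \<mu> * nsq (w \<mu>))" by auto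
qed

definition eigenfamily :: "real set \<Rightarrow> (real \<Rightarrow> ('a \<Rightarrow> complex) set) \<Rightarrow> bool" where
  "eigenfamily P B \<longleftrightarrow> finite P \<and> (\<forall>\<mu>\<in>P. finite (B \<mu>) \<and> B \<mu> \<subseteq> eigenspace bergman T \<mu> \<and> cfun.independent (B \<mu>))"

text \<open>Certifies that no default value of \<open>sum\<close> or \<open>dim\<close> intervenes:
  there are finitely many eigenvalues above \<open>s\<close>, each eigenspace has a finite basis,
  and \<open>n_plus\<close> counts the basis vectors.\<close>

definition spectral_basis :: "real \<Rightarrow> (real \<Rightarrow> ('a \<Rightarrow> complex) set) \<Rightarrow> bool" where
  "spectral_basis s B \<longleftrightarrow> eigenfamily {\<mu> \<in> eigenvalues bergman T. s < \<mu>} B \<and>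
    (\<forall>\<mu>\<in>eigenvalues bergman T. s < \<mu> \<longrightarrow> eigenspace bergman T \<mu> \<subseteq> cfun.span (B \<mu>)) \<and>
    n_plus s bergman T = (\<Sum>\<mu>\<in>{\<mu> \<in> eigenvalues bergman T. s < \<mu>}. card (B \<mu>))"

text \<open>Grouping by eigenvalue turns the combination into a sum of orthogonal eigenvectors, each
  with Rayleigh quotient above \<open>s\<close>. A nonzero coefficient makes one group nonzero by
  independence, and the inequality becomes strict.\<close>

lemma eigenfamily_combination:
  assumes F: "eigenfamily P B" and s: "\<And>\<mu>. \<mu> \<in> P \<Longrightarrow> s < \<mu>"
  defines "w \<equiv> \<lambda>a x. \<Sum>i\<in>Sigma P B. a i * (snd i) x"
  shows eigenfamily_combination_in: "w a \<in> bergman"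
    and eigenfamily_combination_gt: "i \<in> Sigma P B \<Longrightarrow> a i \<noteq> 0 \<Longrightarrow> s * nsq (w a) < qs (w a)"
proof -
  have P: "finite P" "\<And>\<mu>. \<mu> \<in> P \<Longrightarrow> finite (B \<mu>)" "\<And>\<mu>. \<mu> \<in> P \<Longrightarrow> B \<mu> \<subseteq> eigenspace bergman T \<mu>"
    "\<And>\<mu>. \<mu> \<in> P \<Longrightarrow> cfun.independent (B \<mu>)" using F by (auto simp: eigenfamily_def)
  define v where "v = (\<lambda>\<mu> x. \<Sum>e\<in>B \<mu>. a (\<mu>, e) * e x)"
  have wv: "w a = (\<lambda>x. \<Sum>\<mu>\<in>P. v \<mu> x)"
    unfolding w_def v_def using P(1,2) by (simp add: sum.Sigma case_prod_beta)
  have v: "v \<mu> \<in> eigenspace bergman T \<mu>" if "\<mu> \<in> P" for \<mu>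
    unfolding v_def by (intro eigenspace_combination P that)
  have vb: "v \<mu> \<in> bergman" if "\<mu> \<in> P" for \<mu> using eigenspace_D(1)[OF v[OF that]] .
  show "w a \<in> bergman" unfolding wv using bergman_sum[of P v "\<lambda>_. 1"] vb by simp
  show "s * nsq (w a) < qs (w a)" if i: "i \<in> Sigma P B" "a i \<noteq> 0"
  proof -
    obtain \<mu> e where e: "i = (\<mu>, e)" "\<mu> \<in> P" "e \<in> B \<mu>" using i by auto
    have "v \<mu> \<noteq> (\<lambda>_. 0)"
      using cfun_independent_combination[OF P(4)[OF e(2)] P(2)[OF e(2)] _ e(3), of "\<lambda>e. a (\<mu>, e)"] i e
      by (auto simp: v_def)
    then have pos: "0 < nsq (v \<mu>)" by (rule nsq_pos[OF vb[OF e(2)]])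
    have "(\<Sum>\<mu>\<in>P. s * nsq (v \<mu>)) < (\<Sum>\<mu>\<in>P. \<mu> * nsq (v \<mu>))"
    proof (rule sum_strict_mono_ex1[OF P(1)])
      show "\<forall>\<mu>\<in>P. s * nsq (v \<mu>) \<le> \<mu> * nsq (v \<mu>)"
        using s nsq_nonneg by (intro ballI mult_right_mono) (auto intro: less_imp_le)
      show "\<exists>\<mu>\<in>P. s * nsq (v \<mu>) < \<mu> * nsq (v \<mu>)"
        using s[OF e(2)] pos e(2) by (intro bexI[of _ \<mu>]) auto
    qed
    then show ?thesis unfolding wv using eigenvector_family[of P v] P(1) v by (simp add: sum_distrib_left)
  qed
qed

text \<open>The upper half of the min-max principle. With more eigenfunctions than functionals, some
  nontrivial combination is annihilated by all functionals, and its Rayleigh quotient would be at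
  most \<open>s\<close> and greater than \<open>s\<close>. Linearity of \<open>lf\<close> is asked
  for only on combinations of elements of the space, as derivatives at a point are not linear on
  arbitrary functions.\<close>

lemma eigenfamily_card_le:
  assumes F: "eigenfamily P B" and s: "\<And>\<mu>. \<mu> \<in> P \<Longrightarrow> s < \<mu>"
    and J: "finite J"
    and lin: "\<And>j a (I :: (real \<times> ('a \<Rightarrow> complex)) set). j \<in> J \<Longrightarrow> finite I \<Longrightarrow> snd ` I \<subseteq> bergman \<Longrightarrow>
        lf j (\<lambda>x. \<Sum>i\<in>I. a i * (snd i) x) = (\<Sum>i\<in>I. a i * lf j (snd i))"
    and kill: "\<And>u. u \<in> bergman \<Longrightarrow> (\<And>j. j \<in> J \<Longrightarrow> lf j u = 0) \<Longrightarrow> qs u \<le> s * nsq u"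
  shows "(\<Sum>\<mu>\<in>P. card (B \<mu>)) \<le> card J"
proof (rule ccontr)
  assume neg: "\<not> (\<Sum>\<mu>\<in>P. card (B \<mu>)) \<le> card J"
  have P: "finite P" "\<And>\<mu>. \<mu> \<in> P \<Longrightarrow> finite (B \<mu>)" using F by (auto simp: eigenfamily_def)
  have fin: "finite (Sigma P B)" using P by auto
  have sub: "snd ` Sigma P B \<subseteq> bergman" using F eigenspace_D(1) by (force simp: eigenfamily_def)
  have "card J < card (Sigma P B)" using neg P by (simp add: card_SigmaI)
  from homogeneous_system_nontrivial[OF J fin this, of "\<lambda>j i. lf j (snd i)"]
  obtain a where a: "\<exists>i\<in>Sigma P B. a i \<noteq> 0" "\<And>j. j \<in> J \<Longrightarrow> (\<Sum>i\<in>Sigma P B. lf j (snd i) * a i) = 0" by blast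
  define w where "w = (\<lambda>x. \<Sum>i\<in>Sigma P B. a i * (snd i) x)"
  have "lf j w = 0" if "j \<in> J" for j
    unfolding w_def lin[OF that fin sub] using a(2)[OF that] by (simp add: mult.commute)
  moreover have "w \<in> bergman" unfolding w_def by (rule eigenfamily_combination_in[OF F s])
  ultimately have "qs w \<le> s * nsq w" by (intro kill)
  moreover obtain i where i: "i \<in> Sigma P B" "a i \<noteq> 0" using a(1) by blast
  have "s * nsq w < qs w" unfolding w_def by (rule eigenfamily_combination_gt[where a = a, OF F _ i]) (rule s)
  ultimately show False by simp
qed

text \<open>The cardinality bound holds for all finite subfamilies, so it also yields finiteness: an
  infinite basis or infinitely many eigenvalues above \<open>s\<close> would contain a subfamily
  with \<open>card J + 1\<close> members.\<close>

lemma eigenvalue_bases: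
  assumes J: "finite J"
    and lin: "\<And>j a (I :: (real \<times> ('a \<Rightarrow> complex)) set). j \<in> J \<Longrightarrow> finite I \<Longrightarrow> snd ` I \<subseteq> bergman \<Longrightarrow>
        lf j (\<lambda>x. \<Sum>i\<in>I. a i * (snd i) x) = (\<Sum>i\<in>I. a i * lf j (snd i))"
    and kill: "\<And>u. u \<in> bergman \<Longrightarrow> (\<And>j. j \<in> J \<Longrightarrow> lf j u = 0) \<Longrightarrow> qs u \<le> s * nsq u"
  obtains B where "spectral_basis s B" "n_plus s bergman T \<le> card J"
proof -
  note le = eigenfamily_card_le[OF _ _ J, where lf = lf and s = s, OF _ _ lin kill]
  have "\<exists>B. B \<subseteq> eigenspace bergman T \<mu> \<and> cfun.independent B \<and> eigenspace bergman T \<mu> \<subseteq> cfun.span B \<and>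
      card B = cfun.dim (eigenspace bergman T \<mu>)" for \<mu>
    using cfun.basis_exists[of "eigenspace bergman T \<mu>"] by metis
  then obtain B where B: "\<And>\<mu>. B \<mu> \<subseteq> eigenspace bergman T \<mu>" "\<And>\<mu>. cfun.independent (B \<mu>)"
    "\<And>\<mu>. eigenspace bergman T \<mu> \<subseteq> cfun.span (B \<mu>)" "\<And>\<mu>. card (B \<mu>) = cfun.dim (eigenspace bergman T \<mu>)"
    by metis
  define P where "P = {\<mu> \<in> eigenvalues bergman T. s < \<mu>}"
  have fam: "eigenfamily {\<mu>} (\<lambda>_. B')" if "B' \<subseteq> B \<mu>" "finite B'" for \<mu> B'
    using that(2) order_trans[OF that(1) B(1)] cfun.independent_mono[OF B(2) that(1)]
    by (simp add: eigenfamily_def)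
  have finB: "finite (B \<mu>)" if "s < \<mu>" for \<mu>
  proof (rule ccontr)
    assume "infinite (B \<mu>)"
    then obtain B' where B': "finite B'" "card B' = Suc (card J)" "B' \<subseteq> B \<mu>"
      using infinite_arbitrarily_large by metis
    have "(\<Sum>\<mu>\<in>{\<mu>}. card B') \<le> card J" by (rule le[OF fam[OF B'(3,1)]]) (use that in auto)
    then show False using B' by simp
  qed
  \<comment> \<open>Each eigenvalue contributes at least one basis vector, so a bound on vectors
    bounds the number of eigenvalues.\<close>
  have nonempty: "1 \<le> card (B \<mu>)" if "\<mu> \<in> P" for \<mu>
  proof -
    have "\<mu> \<in> eigenvalues bergman T" "s < \<mu>" using that by (auto simp: P_def)
    then obtain u where u: "u \<in> eigenspace bergman T \<mu>" "u \<noteq> (\<lambda>_. 0)" by (auto simp: eigenvalues_def)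
    have "B \<mu> \<noteq> {}"
    proof
      assume "B \<mu> = {}"
      then have "u \<in> {0}" using u(1) B(3)[of \<mu>] by auto
      then show False using u(2) by (simp add: zero_fun_def)
    qed
    then show ?thesis using finB[OF \<open>s < \<mu>\<close>] by (simp add: Suc_le_eq card_gt_0_iff)
  qed
  have famP: "eigenfamily P' B" if "finite P'" "P' \<subseteq> P" for P'
    using that B(1,2) finB by (auto simp: eigenfamily_def P_def)
  have finP: "finite P"
  proof (rule ccontr)
    assume "infinite P"
    then obtain P' where P': "finite P'" "card P' = Suc (card J)" "P' \<subseteq> P"
      using infinite_arbitrarily_large by metis
    have "card P' = (\<Sum>\<mu>\<in>P'. 1)" by simp
    also have "\<dots> \<le> (\<Sum>\<mu>\<in>P'. card (B \<mu>))" using nonempty P' by (intro sum_mono) auto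
    also have "\<dots> \<le> card J" by (rule le[OF famP[OF P'(1,3)]]) (use P'(3) in \<open>auto simp: P_def\<close>)
    finally show False using P' by simp
  qed
  have n: "n_plus s bergman T = (\<Sum>\<mu>\<in>P. card (B \<mu>))"
    unfolding n_plus_def P_def B(4) ..
  have "(\<Sum>\<mu>\<in>P. card (B \<mu>)) \<le> card J" by (rule le[OF famP[OF finP order_refl]]) (auto simp: P_def)
  then show ?thesis
    using that[of B] famP[OF finP order_refl] B(3) n unfolding P_def spectral_basis_def by simp
qed

text \<open>The lower half of the min-max principle, by contradiction. If fewer than
  \<open>N\<close> eigenfunctions span everything above \<open>s\<close>, \<open>test\<close> yields
  a function orthogonal to them with Rayleigh quotient above \<open>s\<close>. The supremum
  \<open>m\<close> of that quotient on their orthogonal complement \<open>S\<close> is then attained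
  at an eigenfunction for \<open>m > s\<close>; it lies in the span and in the complement at
  once.\<close>

lemma n_plus_lower:
  assumes s: "0 < s" and B: "spectral_basis s B"
    and test: "\<And>G. finite G \<Longrightarrow> G \<subseteq> bergman \<Longrightarrow> card G < N \<Longrightarrow>
      \<exists>u\<in>bergman. (\<forall>e\<in>G. ip u e = 0) \<and> s * nsq u < qs u"
  shows "N \<le> n_plus s bergman T"
proof (rule ccontr)
  assume neg: "\<not> N \<le> n_plus s bergman T"
  have F: "eigenfamily {\<mu> \<in> eigenvalues bergman T. s < \<mu>} B"
    and span: "\<And>\<mu>. \<mu> \<in> eigenvalues bergman T \<Longrightarrow> s < \<mu> \<Longrightarrow> eigenspace bergman T \<mu> \<subseteq> cfun.span (B \<mu>)"
    and n: "n_plus s bergman T = (\<Sum>\<mu>\<in>{\<mu> \<in> eigenvalues bergman T. s < \<mu>}. card (B \<mu>))"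
    using B by (auto simp: spectral_basis_def)
  define P where "P = {\<mu> \<in> eigenvalues bergman T. s < \<mu>}"
  define I where "I = Sigma P B"
  have P: "finite P" "\<And>\<mu>. \<mu> \<in> P \<Longrightarrow> finite (B \<mu>)" "\<And>\<mu>. \<mu> \<in> P \<Longrightarrow> B \<mu> \<subseteq> eigenspace bergman T \<mu>"
    using F by (auto simp: eigenfamily_def P_def)
  have finI: "finite I" using P by (auto simp: I_def)
  have I_eig: "snd i \<in> eigenspace bergman T (fst i)" "fst i \<in> P" if "i \<in> I" for i
    using that by (auto simp: I_def intro: subsetD[OF P(3)])
  have I_berg: "snd i \<in> bergman" if "i \<in> I" for i
    using eigenspace_D(1)[OF I_eig(1)[OF that]] .
  have I_q: "q u (snd i) = of_real (fst i) * ip u (snd i)" if "i \<in> I" "u \<in> bergman" for i u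
  proof -
    have "q u (snd i) = cnj (q (snd i) u)" by (rule q_commute)
    also have "\<dots> = cnj (of_real (fst i) * ip (snd i) u)"
      by (simp only: eigenspace_D(2)[OF I_eig(1)[OF that(1)] that(2)])
    also have "\<dots> = of_real (fst i) * ip u (snd i)" by (simp add: ip_commute[of u])
    finally show ?thesis .
  qed
  have I_pos: "fst i > 0" if "i \<in> I" for i using I_eig(2)[OF that] s by (simp add: P_def)
  define S where "S = {u \<in> bergman. \<forall>i\<in>I. ip u (snd i) = 0}"
  have S_q: "q u (snd i) = 0" if "u \<in> S" "i \<in> I" for u i using I_q that by (simp add: S_def)
  have S_add: "(\<lambda>x. u x + k * v x) \<in> S" if "u \<in> S" "v \<in> S" for u v k
    using that I_berg ip_add_left[OF bergman_L2 bergman_L2[OF bergman_cmult] bergman_L2, of u v _ k]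
    by (auto simp: S_def ip_cmult_left intro: bergman_add bergman_cmult)
  have zero_S: "(\<lambda>_. 0) \<in> S" by (simp add: S_def bergman_zero L2_inner_def)
  have S_cmult: "(\<lambda>x. k * v x) \<in> S" if "v \<in> S" for v k using S_add[OF zero_S that, of k] by simp
  obtain u0 where u0: "u0 \<in> S" "s * nsq u0 < qs u0"
  proof -
    have "card (snd ` I) \<le> card I" by (rule card_image_le[OF finI])
    also have "card I = n_plus s bergman T" unfolding n I_def P_def[symmetric] using P by (simp add: card_SigmaI)
    finally have "card (snd ` I) < N" using neg by simp
    from test[OF _ _ this] finI I_berg obtain u where "u \<in> bergman" "\<forall>e\<in>snd ` I. ip u e = 0" "s * nsq u < qs u" by blast
    with that show ?thesis by (simp add: S_def)
  qed
  have nsq_u0: "0 < nsq u0"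
  proof (rule ccontr)
    assume "\<not> 0 < nsq u0"
    then have "nsq u0 = 0" using nsq_nonneg[of u0] by simp
    moreover have "qs u0 \<le> M * nsq u0" using u0 by (intro qs_le bergman_L2) (simp add: S_def)
    ultimately show False using u0(2) by simp
  qed
  define X where "X = {u \<in> S. nsq u \<le> 1}"
  have X_le: "qs u \<le> M" if "u \<in> X" for u
  proof -
    have "qs u \<le> M * nsq u" using that by (intro qs_le bergman_L2) (simp add: X_def S_def)
    also have "\<dots> \<le> M * 1" using that M by (intro mult_left_mono) (auto simp: X_def)
    finally show ?thesis by simp
  qed
  have bdd: "bdd_above (qs ` X)" using X_le by (intro bdd_aboveI2) auto
  define m where "m = Sup (qs ` X)"
  have m_ge: "qs u \<le> m" if "u \<in> X" for u unfolding m_def using that bdd by (intro cSup_upper) auto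
  have m_hom: "qs u \<le> m * nsq u" if u: "u \<in> S" for u
  proof (cases "nsq u = 0")
    case True
    moreover have "qs u \<le> M * nsq u" using u by (intro qs_le bergman_L2) (simp add: S_def)
    ultimately show ?thesis by simp
  next
    case False
    then have pos: "0 < nsq u" using nsq_nonneg[of u] by simp
    define k where "k = complex_of_real (1 / sqrt (nsq u))"
    have k: "(cmod k)\<^sup>2 = 1 / nsq u" using pos by (simp add: k_def norm_divide power_divide)
    have "(\<lambda>x. k * u x) \<in> X" using S_cmult[OF u] pos by (simp add: X_def nsq_cmult k)
    from m_ge[OF this] show ?thesis using pos by (simp add: qs_cmult k field_simps)
  qed
  have sm: "s < m"
  proof -
    have "s * nsq u0 < m * nsq u0" using u0 m_hom[OF u0(1)] by simp
    then show ?thesis using nsq_u0 by simp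
  qed
  have "\<exists>u\<in>X. m - inverse (real (Suc n)) < qs u" for n
  proof -
    have "m - inverse (real (Suc n)) < Sup (qs ` X)" by (simp add: m_def)
    moreover have "(\<lambda>_. 0) \<in> X" using zero_S by (simp add: X_def nsq_def)
    ultimately show ?thesis using less_cSupD[of "qs ` X"] by blast
  qed
  then obtain f where f: "\<And>n. f n \<in> X" "\<And>n. m - inverse (real (Suc n)) < qs (f n)" by metis
  have fb: "f n \<in> bergman" "nsq (f n) \<le> 1" for n using f(1)[of n] by (auto simp: X_def S_def)
  obtain k u where k: "strict_mono k" and u: "u \<in> bergman" and lim: "\<And>x. (\<lambda>n. f (k n) x) \<longlonglongrightarrow> u x"
    using bergman_compactness[of f, OF fb] by metis
  have nsq_u: "nsq u \<le> 1"
    by (rule bergman_fatou(2)[OF fb(1) lim bergman_harmonic[OF u]]) (simp add: fb)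
  have uS: "u \<in> S"
    unfolding S_def
  proof (intro CollectI conjI ballI u)
    fix i assume i: "i \<in> I"
    \<comment> \<open>Pointwise convergence does not control \<open>ip\<close>, but it controls
      \<open>q\<close>. On eigenfunctions the two differ by the factor \<open>fst i\<close>, which
      is positive, so orthogonality passes to the limit through \<open>q\<close>.\<close>
    have "(\<lambda>n. q (f (k n)) (snd i)) \<longlonglongrightarrow> q u (snd i)"
      by (rule q_convergence[OF fb(1) fb(2) lim u I_berg[OF i]])
    moreover have "q (f (k n)) (snd i) = 0" for n using S_q i f(1)[of "k n"] by (simp add: X_def)
    ultimately have "q u (snd i) = 0" by (simp add: LIMSEQ_const_iff)
    then show "ip u (snd i) = 0" using I_q[OF i u] I_pos[OF i] by simp
  qed
  have "m \<le> qs u"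
  proof (rule LIMSEQ_le)
    show "(\<lambda>n. qs (f (k n))) \<longlonglongrightarrow> qs u" by (rule qs_convergence[OF fb(1) fb(2) lim u])
    have "(\<lambda>n. m - inverse (real (Suc (k n)))) \<longlonglongrightarrow> m - 0"
      by (intro tendsto_intros) (rule LIMSEQ_subseq_LIMSEQ[OF LIMSEQ_inverse_real_of_nat k, unfolded o_def])
    then show "(\<lambda>n. m - inverse (real (Suc (k n)))) \<longlonglongrightarrow> m" by simp
    show "\<exists>N. \<forall>n\<ge>N. m - inverse (real (Suc (k n))) \<le> qs (f (k n))"
      using f(2) less_imp_le by blast
  qed
  \<comment> \<open>Together with \<open>m_hom\<close> this closes the chain
    \<open>m \<le> qs u \<le> m * nsq u \<le> m\<close>, so \<open>u\<close> attains the
    supremum.\<close>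
  moreover have "m * nsq u \<le> m" using nsq_u sm s mult_left_mono[of "nsq u" 1 m] by simp
  ultimately have qs_u: "qs u = m * nsq u" "m \<le> m * nsq u" using m_hom[OF uS] by auto
  have nsq_u1: "0 < nsq u" using qs_u(2) sm s nsq_nonneg[of u] by (cases "nsq u = 0") auto
  \<comment> \<open>First variation of \<open>m * nsq - qs\<close>, which is nonnegative on
    \<open>S\<close> and zero at \<open>u\<close>.\<close>
  have re: "Re (q u v) = m * Re (ip u v)" if v: "v \<in> S" for v
  proof -
    have "0 \<le> 2 * t * (m * Re (ip u v) - Re (q u v)) + t\<^sup>2 * (m * nsq v - qs v)" for t
    proof -
      have tv: "(\<lambda>x. of_real t * v x) \<in> S" by (rule S_cmult[OF v])
      have b: "u \<in> L2 (ball 0 1)" "(\<lambda>x. of_real t * v x) \<in> L2 (ball 0 1)"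
        using uS tv by (auto simp: S_def bergman_L2)
      have "qs (\<lambda>x. u x + of_real t * v x) \<le> m * nsq (\<lambda>x. u x + of_real t * v x)"
        by (rule m_hom[OF S_add[OF uS v]])
      then show ?thesis unfolding nsq_add[OF b] qs_add[OF b] using qs_u(1)
        by (simp add: nsq_cmult qs_cmult ip_cmult_right q_cmult_right algebra_simps)
    qed
    from nonneg_quadratic_imp_zero[OF this] show ?thesis by simp
  qed
  have eigS: "q u v = of_real m * ip u v" if v: "v \<in> S" for v
    using re[OF v] re[OF S_cmult[OF v, of \<i>]] by (simp add: ip_cmult_right q_cmult_right complex_eq_iff)
  have "q u v = of_real m * ip u v" if v: "v \<in> bergman" for v
  proof -
    \<comment> \<open>To extend the eigenvalue equation from \<open>S\<close> to an arbitrary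
      \<open>v\<close>, a combination of the eigenfunctions must be added that makes
      \<open>v\<close> orthogonal to all of them. The system has one equation per eigenfunction and
      one extra unknown, \<open>None\<close>, for the coefficient of \<open>v\<close>.\<close>
    define A where "A = (\<lambda>(i :: real \<times> ('a \<Rightarrow> complex)) (j :: (real \<times> ('a \<Rightarrow> complex)) option). case j of None \<Rightarrow> ip v (snd i) | Some j \<Rightarrow> ip (snd j) (snd i))"
    have card: "card I < card (insert None (Some ` I))"
      using finI by (simp add: card_image)
    obtain a where a: "\<exists>j\<in>insert None (Some ` I). a j \<noteq> 0"
      "\<And>i. i \<in> I \<Longrightarrow> (\<Sum>j\<in>insert None (Some ` I). A i j * a j) = 0"
      using homogeneous_system_nontrivial[OF finI _ card, of A] finI by blast
    define w where "w = (\<lambda>x. \<Sum>j\<in>I. a (Some j) * (snd j) x)"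
    have w: "w \<in> bergman" unfolding w_def I_def
      by (rule eigenfamily_combination_in[of P B s "\<lambda>j. a (Some j)"]) (use F in \<open>auto simp: P_def\<close>)
    have ip_w: "ip w g = (\<Sum>j\<in>I. a (Some j) * ip (snd j) g)" if "g \<in> bergman" for g
      unfolding w_def using finI I_berg that by (intro ip_sum_left) auto
    have ortho: "a None * ip v (snd i) + ip w (snd i) = 0" if "i \<in> I" for i
      using a(2)[OF that] finI ip_w[OF I_berg[OF that]]
      by (simp add: A_def sum.reindex mult.commute)
    \<comment> \<open>Otherwise \<open>w\<close> would be a nontrivial combination of the
      eigenfunctions orthogonal to itself, against their independence.\<close>
    have "a None \<noteq> 0"
    proof
      assume a0: "a None = 0"
      then have w0: "ip w (snd i) = 0" if "i \<in> I" for i using ortho[OF that] by simp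
      have "ip w w = (\<Sum>j\<in>I. a (Some j) * ip (snd j) w)" by (rule ip_w[OF w])
      also have "\<dots> = 0" using w0 ip_commute[of _ w] by (intro sum.neutral) auto
      finally have "nsq w = 0" by (simp add: ip_self)
      moreover from a(1) a0 obtain i where i: "i \<in> Sigma P B" "a (Some i) \<noteq> 0" by (auto simp: I_def)
      have "s * nsq w < qs w" unfolding w_def I_def
        by (rule eigenfamily_combination_gt[where a = "\<lambda>j. a (Some j)", OF _ _ i]) (use F in \<open>auto simp: P_def\<close>)
      ultimately show False using qs_le[OF bergman_L2[OF w]] by simp
    qed
    define w' where "w' = (\<lambda>x. (1 / a None) * w x)"
    have w'_ip: "ip w' g = (1 / a None) * ip w g" "q w' g = (1 / a None) * q w g" for g
      unfolding w'_def by (rule ip_cmult_left q_cmult_left)+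
    have w': "w' \<in> bergman" unfolding w'_def by (rule bergman_cmult[OF w])
    have "(\<lambda>x. v x + w' x) \<in> S"
      unfolding S_def
    proof (intro CollectI conjI ballI bergman_add v w')
      fix i assume i: "i \<in> I"
      have "ip (\<lambda>x. v x + w' x) (snd i) = ip v (snd i) + (1 / a None) * ip w (snd i)"
        using ip_add_left[OF bergman_L2[OF v] bergman_L2[OF w'] bergman_L2[OF I_berg[OF i]]]
        by (simp add: w'_ip)
      then show "ip (\<lambda>x. v x + w' x) (snd i) = 0" using ortho[OF i] \<open>a None \<noteq> 0\<close> by (simp add: field_simps)
    qed
    from eigS[OF this] have eq: "q u (\<lambda>x. v x + w' x) = of_real m * ip u (\<lambda>x. v x + w' x)" .
    have "ip w u = 0" "q w u = 0"
    proof -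
      have "ip (snd i) u = 0" "q (snd i) u = 0" if "i \<in> I" for i
        using uS S_q[OF uS that] that ip_commute[of "snd i" u] q_commute[of "snd i" u] by (auto simp: S_def)
      then show "ip w u = 0" "q w u = 0"
        using ip_w[OF u] q_sum_left[of I snd u "\<lambda>j. a (Some j)"] finI I_berg u by (auto simp: w_def)
    qed
    then have z: "ip w' u = 0" "q w' u = 0" by (simp_all add: w'_ip)
    have "ip u (\<lambda>x. v x + w' x) = ip u v"
      using ip_add_left[OF bergman_L2[OF v] bergman_L2[OF w'] bergman_L2[OF u]] z ip_commute[of u]
      by simp
    moreover have "q u (\<lambda>x. v x + w' x) = q u v"
      using q_add_left[OF bergman_L2[OF v] bergman_L2[OF w'] bergman_L2[OF u]] z q_commute[of u]
      by simp
    ultimately show ?thesis using eq by simp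
  qed
  then have um: "u \<in> eigenspace bergman T m" using u eigenspace_iff by blast
  moreover have "u \<noteq> (\<lambda>_. 0)" using nsq_u1 by (auto simp: nsq_def)
  ultimately have mP: "m \<in> P" using sm by (auto simp: P_def eigenvalues_def)
  then have "u \<in> cfun.span (B m)" using span um by (auto simp: P_def)
  then obtain a where a: "u = (\<lambda>x. \<Sum>e\<in>B m. a e * e x)" using cfun_span_combination[OF P(2)[OF mP]] by blast
  have "ip u u = (\<Sum>e\<in>B m. a e * ip e u)"
    by (subst (1) a) (use P(2,3)[OF mP] eigenspace_D(1) u in \<open>auto intro!: ip_sum_left[where u = "\<lambda>e. e"]\<close>)
  also have "\<dots> = 0"
  proof (intro sum.neutral ballI)
    fix e assume "e \<in> B m"
    then have "(m, e) \<in> I" using mP by (simp add: I_def)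
    then have "ip u e = 0" using uS by (force simp: S_def)
    then show "a e * ip e u = 0" using ip_commute[of e u] by simp
  qed
  finally show False using nsq_u1 by (simp add: ip_self)
qed

end

section \<open>Three-balls inequality and growth\<close>

lemma lborel_integral_dilate:
  fixes f :: "'a::euclidean_space \<Rightarrow> real"
  assumes f: "integrable lborel f" and r: "0 < r"
  shows "integrable lborel (\<lambda>x. f (r *\<^sub>R x))"
    and "(\<integral>x. f x \<partial>lborel) = r ^ DIM('a) * (\<integral>x. f (r *\<^sub>R x) \<partial>lborel)"
proof -
  have m: "f \<in> borel_measurable borel" using borel_measurable_integrable[OF f] by simp
  have L: "lborel = density (distr lborel borel (\<lambda>x::'a. r *\<^sub>R x)) (\<lambda>_. ennreal (r ^ DIM('a)))"
    using lborel_affine[of r "0::'a"] r by simp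
  have "integrable (density (distr lborel borel (\<lambda>x::'a. r *\<^sub>R x)) (\<lambda>_. ennreal (r ^ DIM('a)))) f"
    using f by (subst (asm) L)
  then have "integrable (distr lborel borel (\<lambda>x::'a. r *\<^sub>R x)) (\<lambda>x. r ^ DIM('a) * f x)"
    using m r by (subst (asm) integrable_density) auto
  then have "integrable lborel (\<lambda>x. r ^ DIM('a) * f (r *\<^sub>R x))"
    using m by (subst (asm) integrable_distr_eq) auto
  then show "integrable lborel (\<lambda>x. f (r *\<^sub>R x))" using r by simp
  have "(\<integral>x. f x \<partial>lborel) = (\<integral>x. f x \<partial>density (distr lborel borel (\<lambda>x::'a. r *\<^sub>R x)) (\<lambda>_. ennreal (r ^ DIM('a))))"
    by (subst L) (rule refl)
  also have "\<dots> = (\<integral>x. r ^ DIM('a) * f x \<partial>distr lborel borel (\<lambda>x::'a. r *\<^sub>R x))"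
    using m r by (subst integral_density) auto
  also have "\<dots> = (\<integral>x. r ^ DIM('a) * f (r *\<^sub>R x) \<partial>lborel)"
    using m by (subst integral_distr) auto
  finally show "(\<integral>x. f x \<partial>lborel) = r ^ DIM('a) * (\<integral>x. f (r *\<^sub>R x) \<partial>lborel)" by simp
qed

text \<open>The Cauchy-Schwarz inequality in discriminant form. For \<open>a = 0\<close> the
  expression is affine in \<open>t\<close>, and nonnegativity forces \<open>y = 0\<close>.\<close>

lemma quadratic_discriminant_bound:
  fixes a b y :: real
  assumes "\<And>t. 0 \<le> t\<^sup>2 * a - 2 * t * y + b" "0 \<le> a"
  shows "y\<^sup>2 \<le> a * b"
proof (cases "a = 0")
  case True
  have "y = 0"
  proof (rule ccontr)
    assume "y \<noteq> 0"
    then show False using assms(1)[of "(b + 1) / (2 * y)"] True by simp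
  qed
  then show ?thesis using True by simp
next
  case False
  then have a: "0 < a" using assms by simp
  have "0 \<le> a * ((y / a)\<^sup>2 * a - 2 * (y / a) * y + b)" using assms(1)[of "y / a"] a by simp
  also have "\<dots> = a * b - y\<^sup>2" using a by (simp add: field_simps power2_eq_square)
  finally show ?thesis by simp
qed

text \<open>A solid mean with weight \<open>1 - |x|\<^sup>2\<close> in place of the mean over a
  sphere of radius \<open>r\<close>. A homogeneous \<open>u\<close> of degree k gives a multiple of
  \<open>r ^ (2 * k)\<close>.\<close>

definition bump_mean :: "('a::euclidean_space \<Rightarrow> complex) \<Rightarrow> real \<Rightarrow> real" where
  "bump_mean u r = (\<integral>x. bump 1 1 x * (cmod (u (r *\<^sub>R x)))\<^sup>2 \<partial>lborel)"

lemma bump_mean_nonneg: "0 \<le> bump_mean u r"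
  unfolding bump_mean_def by (intro Bochner_Integration.integral_nonneg) (simp add: bump_nonneg)

lemma integrable_bump_mult_real:
  fixes w :: "'a::euclidean_space \<Rightarrow> real"
  assumes "continuous_on (cball 0 1) w"
  shows "integrable lborel (\<lambda>x. bump 1 1 x * w x)"
proof -
  have "integrable lborel (\<lambda>x. of_real (bump 1 (Suc 0) x) * complex_of_real (w x))"
    by (intro integrable_bump_mult continuous_intros assms) auto
  then have "integrable lborel (\<lambda>x. complex_of_real (bump 1 1 x * w x))" by simp
  then show ?thesis by (simp only: complex_of_real_integrable_eq)
qed

lemma three_balls:
  fixes u :: "'a::euclidean_space \<Rightarrow> complex"
  assumes u: "harmonic_on (ball 0 A) u" and r: "0 < r" "r < A" and s: "0 < s" "s < A"
    and t: "0 < t" "t * t = r * s"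
  shows "(bump_mean u t)\<^sup>2 \<le> bump_mean u r * bump_mean u s"
proof -
  have tA: "t < A"
  proof (rule ccontr)
    assume "\<not> t < A"
    then have "r * s < t * t" using r s by (intro mult_strict_mono) auto
    then show False using t by simp
  qed
  define f where "f = (\<lambda>x. u (r *\<^sub>R x))"
  define g where "g = (\<lambda>x. u (s *\<^sub>R x))"
  have cont: "continuous_on (cball 0 1) f" "continuous_on (cball 0 1) g"
    unfolding f_def g_def using continuous_on_dilate[OF harmonic_on_continuous[OF u], of _ 1] r s by auto
  define Y where "Y = (\<integral>x. bump 1 1 x * (cmod (f x) * cmod (g x)) \<partial>lborel)"
  have int: "integrable lborel (\<lambda>x. bump 1 1 x * (cmod (f x))\<^sup>2)" "integrable lborel (\<lambda>x. bump 1 1 x * (cmod (g x))\<^sup>2)"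
    "integrable lborel (\<lambda>x. bump 1 1 x * (cmod (f x) * cmod (g x)))"
    by (intro integrable_bump_mult_real continuous_intros cont)+
  have "of_real (bump_mean u t) = (\<integral>x. complex_of_real (bump 1 1 x * (cmod (u (t *\<^sub>R x)))\<^sup>2) \<partial>lborel)"
    unfolding bump_mean_def by (rule integral_complex_of_real[symmetric])
  also have "\<dots> = (\<integral>x. of_real (bump 1 (Suc 0) x) * (u (t *\<^sub>R x) * cnj (u (t *\<^sub>R x))) \<partial>lborel)"
    by (simp only: complex_norm_square of_real_mult One_nat_def)
  also have "\<dots> = (\<integral>x. of_real (bump 1 (Suc 0) x) * (u (r *\<^sub>R x) * cnj (u (s *\<^sub>R x))) \<partial>lborel)"
    by (rule dilation_pairing[OF u harmonic_on_cnj[OF open_ball u]]) (use r s t tA in auto)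
  finally have "\<bar>bump_mean u t\<bar> = norm (\<integral>x. of_real (bump 1 (Suc 0) x) * (u (r *\<^sub>R x) * cnj (u (s *\<^sub>R x))) \<partial>lborel)"
    by (metis norm_of_real)
  also have "\<dots> \<le> (\<integral>x. norm (of_real (bump 1 (Suc 0) x) * (u (r *\<^sub>R x) * cnj (u (s *\<^sub>R x)))) \<partial>lborel)"
    by (rule Bochner_Integration.integral_norm_bound)
  also have "\<dots> = Y"
    unfolding Y_def f_def g_def by (simp add: norm_mult bump_nonneg)
  finally have le: "\<bar>bump_mean u t\<bar> \<le> Y" .
  have "Y\<^sup>2 \<le> bump_mean u r * bump_mean u s"
  proof (rule quadratic_discriminant_bound)
    fix z :: real
    have "0 \<le> (\<integral>x. bump 1 1 x * (z * cmod (f x) - cmod (g x))\<^sup>2 \<partial>lborel)"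
      by (intro Bochner_Integration.integral_nonneg) (simp add: bump_nonneg)
    also have "\<dots> = (\<integral>x. z\<^sup>2 * (bump 1 1 x * (cmod (f x))\<^sup>2) - 2 * z * (bump 1 1 x * (cmod (f x) * cmod (g x)))
        + bump 1 1 x * (cmod (g x))\<^sup>2 \<partial>lborel)"
      by (intro Bochner_Integration.integral_cong) (auto simp: power2_eq_square algebra_simps)
    also have "\<dots> = z\<^sup>2 * bump_mean u r - 2 * z * Y + bump_mean u s"
      using int by (simp add: bump_mean_def Y_def f_def g_def)
    finally show "0 \<le> z\<^sup>2 * bump_mean u r - 2 * z * Y + bump_mean u s" .
  qed (rule bump_mean_nonneg)
  moreover have "(bump_mean u t)\<^sup>2 \<le> Y\<^sup>2" using le by (rule power2_le_iff_abs_le[THEN iffD2, rotated]) (use le in auto)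
  ultimately show ?thesis by simp
qed

text \<open>The radii \<open>r * \<theta> ^ n\<close> form a geometric sequence, so
  \<open>three_balls\<close> makes the means log-convex in \<open>n\<close>. Taking \<theta> below 1
  approaches the origin, taking it above 1 approaches infinity; letting \<open>A\<close> depend on
  \<open>n\<close> covers functions on the unit ball as well as entire ones.\<close>

lemma bump_mean_growth:
  fixes u :: "'a::euclidean_space \<Rightarrow> complex"
  assumes A: "\<And>n. \<exists>A. harmonic_on (ball 0 A) u \<and> r * \<theta> ^ n < A \<and> r * \<theta> ^ Suc (Suc n) < A"
    and r: "0 < r" and \<theta>: "0 < \<theta>"
    and bound: "\<And>n. bump_mean u (r * \<theta> ^ n) \<le> C * q ^ n" and q: "0 < q"
  shows "bump_mean u (r * \<theta>) \<le> q * bump_mean u r"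
proof -
  have "bump_mean u (r * \<theta> ^ 1) \<le> q * bump_mean u (r * \<theta> ^ 0)"
  proof (rule geometric_growth_bound[of "\<lambda>n. bump_mean u (r * \<theta> ^ n)" C q])
    show "(bump_mean u (r * \<theta> ^ Suc n))\<^sup>2 \<le> bump_mean u (r * \<theta> ^ n) * bump_mean u (r * \<theta> ^ Suc (Suc n))" for n
    proof -
      obtain A where "harmonic_on (ball 0 A) u" "r * \<theta> ^ n < A" "r * \<theta> ^ Suc (Suc n) < A" using A by blast
      then show ?thesis by (intro three_balls[where A = A]) (use r \<theta> in \<open>auto simp: mult_ac\<close>)
    qed
  qed (use bound q bump_mean_nonneg in auto)
  then show ?thesis by simp
qed

lemma bump_mean_power_bound:
  fixes u :: "'a::euclidean_space \<Rightarrow> complex"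
  assumes "continuous_on (ball 0 A) u" "0 < r" "r < A" "\<And>x. x \<in> ball 0 1 \<Longrightarrow> cmod (u (r *\<^sub>R x)) \<le> D"
  shows "bump_mean u r \<le> D\<^sup>2 * (\<integral>x. bump 1 1 (x::'a) \<partial>lborel)"
proof -
  have cu: "continuous_on (cball 0 1) (\<lambda>x. u (r *\<^sub>R x))"
    using continuous_on_dilate[OF assms(1), of r 1] assms by simp
  have "bump_mean u r \<le> (\<integral>x. bump 1 1 (x::'a) * D\<^sup>2 \<partial>lborel)"
    unfolding bump_mean_def
  proof (rule integral_mono)
    show "integrable lborel (\<lambda>x. bump 1 1 x * (cmod (u (r *\<^sub>R x)))\<^sup>2)"
      by (intro integrable_bump_mult_real continuous_intros cu)
    show "integrable lborel (\<lambda>x::'a. bump 1 1 x * D\<^sup>2)"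
      by (intro integrable_bump_mult_real continuous_intros)
    show "bump 1 1 x * (cmod (u (r *\<^sub>R x)))\<^sup>2 \<le> bump 1 1 x * D\<^sup>2" for x
      using assms(4)[of x] bump_outside[of 1 1 x]
      by (cases "x \<in> ball 0 1") (auto intro!: mult_left_mono power_mono simp: bump_nonneg)
  qed
  then show ?thesis by (simp add: mult.commute)
qed

section \<open>From weighted means to Rayleigh quotients\<close>

definition sqint :: "('a::euclidean_space \<Rightarrow> complex) \<Rightarrow> 'a set \<Rightarrow> real" where
  "sqint u S = (\<integral>x. indicator S x * (cmod (u x))\<^sup>2 \<partial>lborel)"

lemma integrable_sqint:
  fixes u :: "'a::euclidean_space \<Rightarrow> complex"
  assumes "continuous_on (cball 0 r) u" "S \<subseteq> cball 0 r" "S \<in> sets borel"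
  shows "integrable lborel (\<lambda>x. indicator S x * (cmod (u x))\<^sup>2)"
proof -
  obtain C where C: "0 \<le> C" "\<And>y. y \<in> cball 0 r \<Longrightarrow> norm (u y) \<le> C"
    using bounded_continuous_on_cball[OF assms(1)] by blast
  have m: "(\<lambda>x. indicator (cball 0 r) x *\<^sub>R u x) \<in> borel_measurable borel"
    by (intro borel_measurable_continuous_on_indicator assms) auto
  have eq: "indicator S x * (cmod (u x))\<^sup>2 = indicator S x * (cmod (indicator (cball 0 r) x *\<^sub>R u x))\<^sup>2" for x
    using assms(2) by (auto simp: indicator_def)
  show ?thesis
  proof (rule Bochner_Integration.integrable_bound)
    show "integrable lborel (\<lambda>x::'a. indicator (cball 0 r) x * C\<^sup>2)"
      by (rule integrable_indicator_mult_const) auto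
    show "(\<lambda>x. indicator S x * (cmod (u x))\<^sup>2) \<in> borel_measurable lborel"
      unfolding eq using m assms(3) by measurable
    show "AE x in lborel. norm (indicator S x * (cmod (u x))\<^sup>2) \<le> norm (indicator (cball 0 r) x * C\<^sup>2)"
    proof (rule AE_I2)
      fix x
      show "norm (indicator S x * (cmod (u x))\<^sup>2) \<le> norm (indicator (cball 0 r) x * C\<^sup>2)"
      proof (cases "x \<in> S")
        case True
        then have "x \<in> cball 0 r" using assms(2) by auto
        then show ?thesis using C True by (auto intro!: power_mono)
      qed simp
    qed
  qed
qed

lemma borel_measurable_indicator_square:
  fixes u :: "'a::euclidean_space \<Rightarrow> complex"
  assumes "u \<in> borel_measurable borel" "S \<in> sets borel"
  shows "(\<lambda>x. indicator S x * (cmod (u x))\<^sup>2) \<in> borel_measurable borel"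
  by (intro borel_measurable_times borel_measurable_indicator borel_measurable_power measurable_compose[OF _ borel_measurable_norm] assms)

lemma bump_mean_le_sqint:
  fixes u :: "'a::euclidean_space \<Rightarrow> complex"
  assumes u: "continuous_on (ball 0 A) u" and r: "0 < r" "r < A"
  shows "r ^ DIM('a) * bump_mean u r \<le> sqint u (ball 0 r)"
proof -
  have "cball 0 r \<subseteq> ball (0::'a) A" using r by auto
  then have cu: "continuous_on (cball 0 r) u" by (rule continuous_on_subset[OF u])
  have int: "integrable lborel (\<lambda>x. indicator (ball 0 r) x * (cmod (u x))\<^sup>2)"
    by (rule integrable_sqint[OF cu]) auto
  note D = lborel_integral_dilate[OF int r(1)]
  have "bump_mean u r \<le> (\<integral>x. indicator (ball 0 r) (r *\<^sub>R x) * (cmod (u (r *\<^sub>R x)))\<^sup>2 \<partial>lborel)"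
    unfolding bump_mean_def
  proof (rule integral_mono[OF _ D(1)])
    show "integrable lborel (\<lambda>x. bump 1 1 x * (cmod (u (r *\<^sub>R x)))\<^sup>2)"
      using continuous_on_dilate[OF u, of r 1] r by (intro integrable_bump_mult_real continuous_intros) auto
    show "bump 1 1 x * (cmod (u (r *\<^sub>R x)))\<^sup>2 \<le> indicator (ball 0 r) (r *\<^sub>R x) * (cmod (u (r *\<^sub>R x)))\<^sup>2" for x
    proof (cases "x \<in> ball 0 1")
      case True
      then have "r *\<^sub>R x \<in> ball 0 r" using r by simp
      then show ?thesis using bump_le[of 1 1 x] by (simp add: mult_left_le_one_le bump_nonneg)
    next
      case False
      then show ?thesis using bump_outside[of 1 1 x] by simp
    qed
  qed
  then show ?thesis unfolding sqint_def D(2) using r by (intro mult_left_mono) auto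
qed

text \<open>The weight vanishes on the sphere, so a mean over a strictly larger ball is needed:
  after rescaling, the weight is at least \<open>1 - (c / r)\<^sup>2\<close> on the smaller ball.
  The loss does not depend on the degree and disappears in the logarithmic asymptotics.\<close>

lemma sqint_le_bump_mean:
  fixes u :: "'a::euclidean_space \<Rightarrow> complex"
  assumes u: "continuous_on (ball 0 A) u" and c: "0 \<le> c" "c < r" "r < A"
  shows "sqint u (cball 0 c) \<le> r ^ DIM('a) / (1 - (c / r)\<^sup>2) * bump_mean u r"
proof -
  have r: "0 < r" using c by simp
  define \<kappa> where "\<kappa> = 1 - (c / r)\<^sup>2"
  have "c / r < 1" "0 \<le> c / r" using c r by auto
  then have "(c / r)\<^sup>2 < 1" by (simp add: power_less_one_iff)
  then have \<kappa>: "0 < \<kappa>" by (simp add: \<kappa>_def)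
  have sub: "cball 0 c \<subseteq> ball (0::'a) A" using c by auto
  have int: "integrable lborel (\<lambda>x. indicator (cball 0 c) x * (cmod (u x))\<^sup>2)"
    by (rule integrable_sqint[OF continuous_on_subset[OF u sub]]) auto
  note D = lborel_integral_dilate[OF int r]
  have "(\<integral>x. indicator (cball 0 c) (r *\<^sub>R x) * (cmod (u (r *\<^sub>R x)))\<^sup>2 \<partial>lborel)
      \<le> (\<integral>x. (1 / \<kappa>) * (bump 1 1 x * (cmod (u (r *\<^sub>R x)))\<^sup>2) \<partial>lborel)"
  proof (rule integral_mono[OF D(1)])
    show "integrable lborel (\<lambda>x. (1 / \<kappa>) * (bump 1 1 x * (cmod (u (r *\<^sub>R x)))\<^sup>2))"
      using continuous_on_dilate[OF u, of r 1] c r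
      by (intro integrable_mult_right integrable_bump_mult_real continuous_intros) auto
    show "indicator (cball 0 c) (r *\<^sub>R x) * (cmod (u (r *\<^sub>R x)))\<^sup>2 \<le> (1 / \<kappa>) * (bump 1 1 x * (cmod (u (r *\<^sub>R x)))\<^sup>2)" for x
    proof (cases "r *\<^sub>R x \<in> cball 0 c")
      case True
      then have "norm x \<le> c / r" using r by (simp add: field_simps)
      then have "x \<bullet> x \<le> (c / r)\<^sup>2" unfolding dot_square_norm by (intro power_mono) auto
      then have "\<kappa> \<le> bump 1 1 x" by (simp add: bump_def \<kappa>_def)
      then have "1 \<le> bump 1 1 x / \<kappa>" using \<kappa> by simp
      then have "1 * (cmod (u (r *\<^sub>R x)))\<^sup>2 \<le> bump 1 1 x / \<kappa> * (cmod (u (r *\<^sub>R x)))\<^sup>2" by (intro mult_right_mono) auto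
      then show ?thesis using True by simp
    qed (use \<kappa> in \<open>simp add: bump_nonneg\<close>)
  qed
  then have "(\<integral>x. indicator (cball 0 c) (r *\<^sub>R x) * (cmod (u (r *\<^sub>R x)))\<^sup>2 \<partial>lborel) \<le> (1 / \<kappa>) * bump_mean u r"
    by (simp add: bump_mean_def)
  then have "sqint u (cball 0 c) \<le> r ^ DIM('a) * ((1 / \<kappa>) * bump_mean u r)"
    unfolding sqint_def D(2) using r by (intro mult_left_mono) auto
  then show ?thesis by (simp add: \<kappa>_def)
qed

lemma nsq_eq_sqint:
  assumes "\<And>x. x \<in> ball 0 1 \<Longrightarrow> u x = v x" "v \<in> borel_measurable borel"
  shows "nsq u = sqint v (ball 0 1)"
proof -
  have "nsq u = (LINT x|unit_leb. (cmod (v x))\<^sup>2)"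
    unfolding nsq_def by (intro Bochner_Integration.integral_cong) (use assms in auto)
  also have "\<dots> = sqint v (ball 0 1)"
    unfolding sqint_def using lebesgue_on_integral_lborel(1)[of "\<lambda>x. (cmod (v x))\<^sup>2" "ball 0 1"] assms(2) by simp
  finally show ?thesis .
qed

context weighted_bergman
begin

lemma qs_le_sqint:
  assumes u: "u \<in> bergman"
  shows "qs u \<le> M * sqint u (cball 0 c)"
proof -
  have sub: "cball 0 c \<subseteq> ball (0::'a) 1" using c by auto
  have m: "(\<lambda>x. indicator (cball 0 c) x * (cmod (u x))\<^sup>2) \<in> borel_measurable borel"
    by (intro borel_measurable_indicator_square bergman_borel[OF u]) auto
  have eq: "indicator (ball 0 1) x *\<^sub>R (indicator (cball 0 c) x * (cmod (u x))\<^sup>2) = indicator (cball 0 c) x * (cmod (u x))\<^sup>2" for x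
    using sub by (auto simp: indicator_def)
  have L: "(LINT x|unit_leb. indicator (cball 0 c) x * (cmod (u x))\<^sup>2) = sqint u (cball 0 c)"
    using lebesgue_on_integral_lborel(1)[OF m, of "ball 0 1"] unfolding eq sqint_def by simp
  have "qs u \<le> (LINT x|unit_leb. M * (indicator (cball 0 c) x * (cmod (u x))\<^sup>2))"
    unfolding qs_def
  proof (rule integral_mono_AE[OF integrable_qs[OF bergman_L2[OF u]]])
    show "integrable unit_leb (\<lambda>x. M * (indicator (cball 0 c) x * (cmod (u x))\<^sup>2))"
    proof (rule integrable_mult_right, rule Bochner_Integration.integrable_bound[OF bergman_square_integrable[OF u]])
      show "(\<lambda>x. indicator (cball 0 c) x * (cmod (u x))\<^sup>2) \<in> borel_measurable unit_leb"
        by (rule borel_measurable_unit_leb[OF m])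
    qed (auto simp: indicator_def)
    show "AE x in unit_leb. V x * (cmod (u x))\<^sup>2 \<le> M * (indicator (cball 0 c) x * (cmod (u x))\<^sup>2)"
      using V_bounds
    proof eventually_elim
      case (elim x)
      have "V x * (cmod (u x))\<^sup>2 \<le> (M * indicator (cball 0 c) x) * (cmod (u x))\<^sup>2"
        using elim by (intro mult_right_mono) auto
      then show ?case by (simp add: mult.assoc)
    qed
  qed
  then show ?thesis using L by simp
qed

text \<open>The form is bounded by the mean at radius \<open>r > c\<close>, the norm bounds the mean
  at radius \<open>\<rho> < 1\<close>, and vanishing to order \<open>k\<close> relates the two means
  by \<open>(r / \<rho>) ^ (2 * k)\<close>. The ratio \<open>r / \<rho>\<close> can be brought as
  close to \<open>c\<close> as desired.\<close>

lemma qs_decay: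
  assumes u: "u \<in> bergman" and r: "c < r" "r < \<rho>" "\<rho> < 1"
    and C: "\<And>x. x \<in> cball 0 \<rho> \<Longrightarrow> norm (u x) \<le> C * norm x ^ k"
  shows "qs u \<le> M / (1 - (c / r)\<^sup>2) * (r / \<rho>) ^ (2 * k) * nsq u"
proof -
  have pos: "0 < r" "0 < \<rho>" using c r by auto
  have h: "harmonic_on (ball 0 1) u" by (rule bergman_harmonic[OF u])
  note cont = harmonic_on_continuous[OF h]
  define \<theta> where "\<theta> = r / \<rho>"
  have \<theta>: "0 < \<theta>" "\<theta> < 1" using pos r by (auto simp: \<theta>_def)
  \<comment> \<open>The sign of \<open>C\<close> is not given; it is read off from the hypothesis at
    a multiple of a unit vector.\<close>
  have C0: "0 \<le> C * t ^ k" if "0 < t" "t \<le> \<rho>" for t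
  proof -
    obtain b :: 'a where b: "b \<in> Basis" using nonempty_Basis by blast
    have "norm (u (t *\<^sub>R b)) \<le> C * norm (t *\<^sub>R b) ^ k" using that b by (intro C) auto
    then show ?thesis using that b by (simp add: order_trans[OF norm_ge_zero])
  qed
  have "bump_mean u (\<rho> * \<theta>) \<le> \<theta> ^ (2 * k) * bump_mean u \<rho>"
  proof (rule bump_mean_growth[OF _ pos(2) \<theta>(1)])
    fix n
    have t: "0 < \<rho> * \<theta> ^ n" "\<rho> * \<theta> ^ n \<le> \<rho>" for n
      using pos \<theta> by (auto simp: mult_left_le power_le_one)
    then have A: "\<rho> * \<theta> ^ n < 1" for n using r by (meson le_less_trans)
    show "\<exists>A. harmonic_on (ball 0 A) u \<and> \<rho> * \<theta> ^ n < A \<and> \<rho> * \<theta> ^ Suc (Suc n) < A"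
      using h A by blast
    have "bump_mean u (\<rho> * \<theta> ^ n) \<le> (C * (\<rho> * \<theta> ^ n) ^ k)\<^sup>2 * (\<integral>x. bump 1 1 (x::'a) \<partial>lborel)"
    proof (rule bump_mean_power_bound[OF cont t(1) A])
      fix x :: 'a assume x: "x \<in> ball 0 1"
      have nx: "norm ((\<rho> * \<theta> ^ n) *\<^sub>R x) = \<rho> * \<theta> ^ n * norm x" by (simp only: norm_scaleR abs_of_pos[OF t(1)])
      also have "\<dots> \<le> \<rho> * \<theta> ^ n" using x t(1)[of n] by (intro mult_left_le) auto
      finally have "norm ((\<rho> * \<theta> ^ n) *\<^sub>R x) \<le> \<rho>" using t(2)[of n] by linarith
      then have "norm (u ((\<rho> * \<theta> ^ n) *\<^sub>R x)) \<le> C * norm ((\<rho> * \<theta> ^ n) *\<^sub>R x) ^ k" by (intro C) simp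
      also have "\<dots> = (C * (\<rho> * \<theta> ^ n) ^ k) * norm x ^ k" unfolding nx by (simp add: power_mult_distrib)
      also have "\<dots> \<le> C * (\<rho> * \<theta> ^ n) ^ k"
        using x C0[OF t] by (intro mult_left_le) (auto intro: power_le_one)
      finally show "norm (u ((\<rho> * \<theta> ^ n) *\<^sub>R x)) \<le> C * (\<rho> * \<theta> ^ n) ^ k" .
    qed
    also have "\<dots> = ((C * \<rho> ^ k)\<^sup>2 * (\<integral>x. bump 1 1 (x::'a) \<partial>lborel)) * (\<theta> ^ (2 * k)) ^ n"
      by (simp add: power_mult_distrib power_mult[symmetric] mult_ac)
    finally show "bump_mean u (\<rho> * \<theta> ^ n) \<le> ((C * \<rho> ^ k)\<^sup>2 * (\<integral>x. bump 1 1 (x::'a) \<partial>lborel)) * (\<theta> ^ (2 * k)) ^ n" .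
  qed (use \<theta> in auto)
  then have growth: "bump_mean u r \<le> \<theta> ^ (2 * k) * bump_mean u \<rho>" using pos by (simp add: \<theta>_def)
  have "\<rho> ^ DIM('a) * bump_mean u \<rho> \<le> sqint u (ball 0 \<rho>)"
    by (rule bump_mean_le_sqint[OF cont pos(2) r(3)])
  also have "\<dots> \<le> nsq u"
    unfolding sqint_def bergman_nsq_lborel[OF u]
  proof (rule integral_mono[OF _ bergman_square_integrable_lborel[OF u]])
    show "integrable lborel (\<lambda>x. indicator (ball 0 \<rho>) x * (cmod (u x))\<^sup>2)"
    proof (rule integrable_sqint)
      have "cball 0 \<rho> \<subseteq> ball (0::'a) 1" using r by auto
      then show "continuous_on (cball 0 \<rho>) u" by (rule continuous_on_subset[OF cont])
    qed auto
  qed (auto simp: indicator_def)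
  finally have nsq: "\<rho> ^ DIM('a) * bump_mean u \<rho> \<le> nsq u" .
  have \<kappa>: "0 < 1 - (c / r)\<^sup>2"
  proof -
    have "c / r < 1" "0 \<le> c / r" using c r pos by auto
    then show ?thesis by (simp add: power_less_one_iff)
  qed
  have "qs u \<le> M * sqint u (cball 0 c)" by (rule qs_le_sqint[OF u])
  also have "\<dots> \<le> M * (r ^ DIM('a) / (1 - (c / r)\<^sup>2) * bump_mean u r)"
    using sqint_le_bump_mean[OF cont, of c r] c r M by (intro mult_left_mono) auto
  also have "\<dots> \<le> M * (r ^ DIM('a) / (1 - (c / r)\<^sup>2) * (\<theta> ^ (2 * k) * bump_mean u \<rho>))"
    using M pos \<kappa> by (intro mult_left_mono growth) auto
  also have "\<dots> \<le> M * (\<rho> ^ DIM('a) / (1 - (c / r)\<^sup>2) * (\<theta> ^ (2 * k) * bump_mean u \<rho>))"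
    using M pos \<kappa> \<theta> r bump_mean_nonneg[of u \<rho>]
    by (intro mult_left_mono mult_right_mono divide_right_mono power_mono) auto
  also have "\<dots> = (M / (1 - (c / r)\<^sup>2) * \<theta> ^ (2 * k)) * (\<rho> ^ DIM('a) * bump_mean u \<rho>)" by simp
  also have "\<dots> \<le> (M / (1 - (c / r)\<^sup>2) * \<theta> ^ (2 * k)) * nsq u"
    using M \<kappa> \<theta> by (intro mult_left_mono nsq) auto
  finally show ?thesis by (simp add: \<theta>_def)
qed

text \<open>Counterpart of \<open>qs_decay\<close> for restrictions of entire harmonic functions of
  growth at most \<open>k\<close>. The mean is compared between radius \<delta>, inside the region
  where \<open>V\<close> is bounded below, and radius \<open>\<rho> > 1\<close>; the latter is
  possible because \<open>v\<close> is harmonic beyond the unit ball.\<close>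

lemma qs_lower:
  assumes v: "harmonic_on UNIV v" and u: "u \<in> bergman" "\<And>x. x \<in> ball 0 1 \<Longrightarrow> u x = v x"
    and C: "\<And>x. norm (v x) \<le> C * (1 + norm x) ^ k"
    and \<delta>: "0 < \<delta>" "\<delta> < 1" and \<rho>: "1 < \<rho>"
    and \<epsilon>: "0 < \<epsilon>" "AE x in unit_leb. x \<in> ball 0 \<delta> \<longrightarrow> \<epsilon> \<le> V x"
  shows "\<epsilon> * (\<delta> / \<rho>) ^ DIM('a) * (1 - (1 / \<rho>)\<^sup>2) * nsq u \<le> (\<rho> / \<delta>) ^ (2 * k) * qs u"
proof -
  define \<theta> where "\<theta> = \<rho> / \<delta>"
  have \<theta>: "1 < \<theta>" using \<delta> \<rho> by (simp add: \<theta>_def)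
  have C0: "0 \<le> C" using C[of 0] order_trans[OF norm_ge_zero] by simp
  have hv: "harmonic_on (ball 0 A) v" for A by (rule harmonic_on_subset[OF v]) simp
  note cont = harmonic_on_continuous[OF hv]
  have "bump_mean v (\<delta> * \<theta>) \<le> \<theta> ^ (2 * k) * bump_mean v \<delta>"
  proof -
    define q where "q = \<theta> ^ (2 * k)"
    define D where "D = (C * (1 + \<delta>) ^ k)\<^sup>2 * (\<integral>x. bump 1 1 (x::'a) \<partial>lborel)"
    \<comment> \<open>Since \<open>1 \<le> \<theta> ^ n\<close>, the 1 in \<open>1 + norm x\<close>
      is absorbed and the bound becomes purely geometric in \<open>n\<close>.\<close>
    have b: "bump_mean v (\<delta> * \<theta> ^ n) \<le> D * q ^ n" for n
    proof -
      have "bump_mean v (\<delta> * \<theta> ^ n) \<le> (C * ((1 + \<delta>) * \<theta> ^ n) ^ k)\<^sup>2 * (\<integral>x. bump 1 1 (x::'a) \<partial>lborel)"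
      proof (rule bump_mean_power_bound[OF cont, where A = "\<delta> * \<theta> ^ n + 1"])
        fix x :: 'a assume x: "x \<in> ball 0 1"
        have "norm ((\<delta> * \<theta> ^ n) *\<^sub>R x) = \<delta> * \<theta> ^ n * norm x" using \<delta> \<theta> by (simp add: abs_mult)
        also have "\<dots> \<le> \<delta> * \<theta> ^ n" using x \<delta> \<theta> by (intro mult_left_le) auto
        finally have "1 + norm ((\<delta> * \<theta> ^ n) *\<^sub>R x) \<le> \<theta> ^ n + \<delta> * \<theta> ^ n"
          using \<theta> one_le_power[of \<theta> n] by linarith
        then have le: "1 + norm ((\<delta> * \<theta> ^ n) *\<^sub>R x) \<le> (1 + \<delta>) * \<theta> ^ n" by (simp add: distrib_right)
        have "norm (v ((\<delta> * \<theta> ^ n) *\<^sub>R x)) \<le> C * (1 + norm ((\<delta> * \<theta> ^ n) *\<^sub>R x)) ^ k" by (rule C)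
        also have "\<dots> \<le> C * ((1 + \<delta>) * \<theta> ^ n) ^ k"
          using le C0 by (intro mult_left_mono power_mono) auto
        finally show "norm (v ((\<delta> * \<theta> ^ n) *\<^sub>R x)) \<le> C * ((1 + \<delta>) * \<theta> ^ n) ^ k" .
      qed (use \<delta> \<theta> in auto)
      also have "\<dots> = D * q ^ n"
        by (simp add: D_def q_def power_mult_distrib power_mult[symmetric] mult_ac)
      finally show ?thesis .
    qed
    have q: "1 \<le> q" unfolding q_def using \<theta> by (intro one_le_power) simp
    have "bump_mean v (\<delta> * \<theta>) \<le> q * bump_mean v \<delta>"
    proof (rule bump_mean_growth[OF _ \<delta>(1) _ b])
      show "\<exists>A. harmonic_on (ball 0 A) v \<and> \<delta> * \<theta> ^ n < A \<and> \<delta> * \<theta> ^ Suc (Suc n) < A" for n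
        using hv by (meson gt_ex less_trans max_less_iff_conj)
    qed (use \<theta> q in auto)
    then show ?thesis by (simp add: q_def)
  qed
  then have growth: "bump_mean v \<rho> \<le> \<theta> ^ (2 * k) * bump_mean v \<delta>" using \<delta> by (simp add: \<theta>_def)
  have vm: "v \<in> borel_measurable borel"
    using harmonic_on_continuous[OF v] by (rule borel_measurable_continuous_onI)
  have \<kappa>: "0 < 1 - (1 / \<rho>)\<^sup>2" using \<rho> by (simp add: power_less_one_iff)
  have "nsq u = sqint v (ball 0 1)" by (rule nsq_eq_sqint[OF u(2) vm])
  also have "\<dots> \<le> sqint v (cball 0 1)"
    unfolding sqint_def
    by (intro integral_mono integrable_sqint[where r = 1] continuous_on_subset[OF harmonic_on_continuous[OF v]])
      (auto simp: indicator_def)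
  also have "\<dots> \<le> \<rho> ^ DIM('a) / (1 - (1 / \<rho>)\<^sup>2) * bump_mean v \<rho>"
    by (rule sqint_le_bump_mean[OF cont[of "\<rho> + 1"]]) (use \<rho> in auto)
  finally have "(1 - (1 / \<rho>)\<^sup>2) * nsq u \<le> \<rho> ^ DIM('a) * bump_mean v \<rho>"
    using \<kappa> by (simp add: pos_le_divide_eq mult.commute)
  also have "\<dots> \<le> \<rho> ^ DIM('a) * (\<theta> ^ (2 * k) * bump_mean v \<delta>)"
    using \<rho> by (intro mult_left_mono growth) auto
  finally have 1: "(\<delta> / \<rho>) ^ DIM('a) * ((1 - (1 / \<rho>)\<^sup>2) * nsq u) \<le> (\<delta> / \<rho>) ^ DIM('a) * (\<rho> ^ DIM('a) * (\<theta> ^ (2 * k) * bump_mean v \<delta>))"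
    using \<delta> \<rho> by (intro mult_left_mono) auto
  also have "\<dots> = \<theta> ^ (2 * k) * (\<delta> ^ DIM('a) * bump_mean v \<delta>)"
    using \<rho> by (simp add: power_divide)
  also have "\<dots> \<le> \<theta> ^ (2 * k) * sqint v (ball 0 \<delta>)"
    using \<theta> bump_mean_le_sqint[OF cont[of "\<delta> + 1"] \<delta>(1)] by (intro mult_left_mono) auto
  finally have 2: "(\<delta> / \<rho>) ^ DIM('a) * ((1 - (1 / \<rho>)\<^sup>2) * nsq u) \<le> \<theta> ^ (2 * k) * sqint v (ball 0 \<delta>)" .
  have 3: "\<epsilon> * sqint v (ball 0 \<delta>) \<le> qs u"
  proof -
    have m: "(\<lambda>x. indicator (ball 0 \<delta>) x * (cmod (u x))\<^sup>2) \<in> borel_measurable borel"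
      by (intro borel_measurable_indicator_square bergman_borel[OF u(1)]) auto
    have sub: "ball 0 \<delta> \<subseteq> ball (0::'a) 1" using \<delta> by auto
    have eq: "indicator (ball 0 1) x *\<^sub>R (indicator (ball 0 \<delta>) x * (cmod (u x))\<^sup>2) = indicator (ball 0 \<delta>) x * (cmod (v x))\<^sup>2" for x
      using sub u(2)[of x] by (auto simp: indicator_def)
    have L: "(LINT x|unit_leb. indicator (ball 0 \<delta>) x * (cmod (u x))\<^sup>2) = sqint v (ball 0 \<delta>)"
      using lebesgue_on_integral_lborel(1)[OF m, of "ball 0 1"] unfolding eq sqint_def by simp
    have "(LINT x|unit_leb. \<epsilon> * (indicator (ball 0 \<delta>) x * (cmod (u x))\<^sup>2)) \<le> qs u"
      unfolding qs_def
    proof (rule integral_mono_AE[OF _ integrable_qs[OF bergman_L2[OF u(1)]]])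
      show "integrable unit_leb (\<lambda>x. \<epsilon> * (indicator (ball 0 \<delta>) x * (cmod (u x))\<^sup>2))"
      proof (rule integrable_mult_right, rule Bochner_Integration.integrable_bound[OF bergman_square_integrable[OF u(1)]])
        show "(\<lambda>x. indicator (ball 0 \<delta>) x * (cmod (u x))\<^sup>2) \<in> borel_measurable unit_leb"
          by (rule borel_measurable_unit_leb[OF m])
      qed (auto simp: indicator_def)
      show "AE x in unit_leb. \<epsilon> * (indicator (ball 0 \<delta>) x * (cmod (u x))\<^sup>2) \<le> V x * (cmod (u x))\<^sup>2"
        using \<epsilon>(2) V_bounds
        by eventually_elim (auto simp: indicator_def intro!: mult_right_mono)
    qed
    then show ?thesis using L by simp
  qed
  have "\<epsilon> * ((\<delta> / \<rho>) ^ DIM('a) * ((1 - (1 / \<rho>)\<^sup>2) * nsq u)) \<le> \<epsilon> * (\<theta> ^ (2 * k) * sqint v (ball 0 \<delta>))"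
    using 2 \<epsilon>(1) by (intro mult_left_mono) auto
  also have "\<dots> = \<theta> ^ (2 * k) * (\<epsilon> * sqint v (ball 0 \<delta>))" by simp
  also have "\<dots> \<le> \<theta> ^ (2 * k) * qs u" using \<theta> 3 by (intro mult_left_mono) auto
  finally show ?thesis by (simp add: \<theta>_def mult.assoc)
qed

end

section \<open>Jets and harmonic polynomials\<close>

fun partial_derivs :: "'a::euclidean_space list \<Rightarrow> ('a \<Rightarrow> complex) \<Rightarrow> 'a \<Rightarrow> complex" where
  "partial_derivs [] u = u"
| "partial_derivs (b # L) u = partial_deriv b (partial_derivs L u)"

lemma harmonic_partial_derivs:
  "open \<Omega> \<Longrightarrow> harmonic_on \<Omega> u \<Longrightarrow> set L \<subseteq> Basis \<Longrightarrow> harmonic_on \<Omega> (partial_derivs L u)"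
  by (induction L) (auto intro: harmonic_on_partial_deriv)

lemma partial_derivs_append_single: "partial_derivs (L @ [b]) u = partial_derivs L (partial_deriv b u)"
  by (induction L) auto

lemma partial_derivs_sum:
  assumes "open \<Omega>" "finite I" "\<And>i. i \<in> I \<Longrightarrow> harmonic_on \<Omega> (u i)" "set L \<subseteq> Basis" "x \<in> \<Omega>"
  shows "partial_derivs L (\<lambda>x. \<Sum>i\<in>I. a i * u i x) x = (\<Sum>i\<in>I. a i * partial_derivs L (u i) x)"
  using assms(4,5)
proof (induction L arbitrary: x)
  case (Cons b L)
  have "partial_derivs (b # L) (\<lambda>x. \<Sum>i\<in>I. a i * u i x) x = partial_deriv b (\<lambda>x. \<Sum>i\<in>I. a i * partial_derivs L (u i) x) x"
    using Cons by (auto intro!: partial_deriv_cong_open[OF assms(1)])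
  also have "\<dots> = (\<Sum>i\<in>I. a i * partial_derivs (b # L) (u i) x)"
  proof -
    have "(partial_derivs L (u i) has_derivative frechet_derivative (partial_derivs L (u i)) (at x)) (at x)" if "i \<in> I" for i
    proof -
      have h: "harmonic_on \<Omega> (partial_derivs L (u i))"
        by (rule harmonic_partial_derivs[OF assms(1) assms(3)[OF that]]) (use Cons.prems in auto)
      have "partial_derivs L (u i) differentiable at x"
        using harmonic_on_has_derivative[OF h Cons.prems(2)] by (rule differentiableI)
      then show ?thesis by (simp add: frechet_derivative_works)
    qed
    then have "((\<lambda>x. \<Sum>i\<in>I. a i * partial_derivs L (u i) x) has_derivative
        (\<lambda>h. \<Sum>i\<in>I. a i * frechet_derivative (partial_derivs L (u i)) (at x) h)) (at x)"
      by (intro has_derivative_sum has_derivative_mult_right)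
    from partial_deriv_eqI[OF this, of b] show ?thesis by (simp add: partial_deriv_def)
  qed
  finally show ?case .
qed simp

lemma partial_derivs_move_front:
  assumes "open \<Omega>" "harmonic_on \<Omega> u" "set (ys @ b # zs) \<subseteq> Basis" "x \<in> \<Omega>"
  shows "partial_derivs (ys @ b # zs) u x = partial_derivs (b # ys @ zs) u x"
  using assms(3,4)
proof (induction ys arbitrary: x)
  case (Cons y ys)
  have h: "harmonic_on \<Omega> (partial_derivs (ys @ zs) u)"
    using Cons.prems by (intro harmonic_partial_derivs assms) auto
  have "partial_derivs ((y # ys) @ b # zs) u x = partial_deriv y (partial_derivs (b # ys @ zs) u) x"
    using Cons by (auto intro!: partial_deriv_cong_open[OF assms(1)])
  also have "\<dots> = partial_deriv b (partial_deriv y (partial_derivs (ys @ zs) u)) x"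
    using harmonic_partial_deriv_commute[OF assms(1) h Cons.prems(2), of b y] Cons.prems by simp
  finally show ?case by simp
qed simp

text \<open>Harmonicity makes mixed derivatives commute at every order, so an iterated derivative
  depends only on the multiset of directions; the head of one list is moved to the front of the
  other.\<close>

lemma partial_derivs_mset:
  assumes "open \<Omega>" "harmonic_on \<Omega> u" "set L \<subseteq> Basis" "mset L = mset L'" "x \<in> \<Omega>"
  shows "partial_derivs L u x = partial_derivs L' u x"
  using assms(3-5)
proof (induction L arbitrary: L' x)
  case (Cons b L)
  then have "b \<in> set L'" by (metis list.set_intros(1) set_mset_mset)
  then obtain ys zs where L': "L' = ys @ b # zs" by (meson split_list)
  have sL': "set (ys @ b # zs) \<subseteq> Basis" using Cons.prems L' by (metis set_mset_mset)
  have m: "mset L = mset (ys @ zs)" using Cons.prems L' by simp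
  have "partial_derivs (b # L) u x = partial_derivs (b # ys @ zs) u x"
    using Cons.IH[OF _ m] Cons.prems by (auto intro!: partial_deriv_cong_open[OF assms(1)])
  also have "\<dots> = partial_derivs L' u x"
    unfolding L' by (rule partial_derivs_move_front[OF assms(1,2) sL' Cons.prems(3), symmetric])
  finally show ?case .
qed simp

text \<open>Two derivatives in direction \<open>b0\<close> can be traded for derivatives in the other directions by
  harmonicity, so the jets with at most one \<open>b0\<close> already determine all jets.\<close>

lemma jets_vanish:
  fixes u :: "'a::euclidean_space \<Rightarrow> complex"
  assumes "open \<Omega>" "harmonic_on \<Omega> u" "x \<in> \<Omega>" and b0: "b0 \<in> Basis"
    and van: "\<And>L. set L \<subseteq> Basis \<Longrightarrow> length L \<le> K \<Longrightarrow> count (mset L) b0 \<le> 1 \<Longrightarrow> partial_derivs L u x = 0"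
    and L: "set L \<subseteq> Basis" "length L \<le> K"
  shows "partial_derivs L u x = 0"
  using L
proof (induction "count (mset L) b0" arbitrary: L rule: less_induct)
  case less
  show ?case
  proof (cases "count (mset L) b0 \<le> 1")
    case True
    then show ?thesis using van less.prems by blast
  next
    case False
    then have "{#b0, b0#} \<subseteq># mset L"
      by (auto simp: subseteq_mset_def)
    then obtain N where N: "mset L = {#b0, b0#} + N" by (metis subset_mset.add_diff_inverse)
    obtain L1 where L1: "mset L1 = N" using ex_mset by blast
    have m: "mset L = mset (b0 # b0 # L1)" using N L1 by simp
    have sL: "set (b0 # b0 # L1) = set L" using m by (metis set_mset_mset)
    have len: "length L = Suc (Suc (length L1))" using m by (metis length_Cons size_mset)
    have sL1: "set L1 \<subseteq> Basis" using sL less.prems by auto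
    have h: "harmonic_on \<Omega> (partial_derivs L1 u)" by (rule harmonic_partial_derivs[OF assms(1,2) sL1])
    have z: "partial_derivs (b # b # L1) u x = 0" if b: "b \<in> Basis" "b \<noteq> b0" for b
    proof (rule less.hyps)
      show "count (mset (b # b # L1)) b0 < count (mset L) b0" using m b by simp
      show "set (b # b # L1) \<subseteq> Basis" "length (b # b # L1) \<le> K" using sL1 b len less.prems by auto
    qed
    have "0 = (\<Sum>b\<in>Basis. partial_derivs (b # b # L1) u x)"
      using harmonic_on_laplacian[OF h assms(3)] by simp
    also have "\<dots> = partial_derivs (b0 # b0 # L1) u x + (\<Sum>b\<in>Basis - {b0}. partial_derivs (b # b # L1) u x)"
      by (rule sum.remove[OF finite_Basis b0])
    also have "(\<Sum>b\<in>Basis - {b0}. partial_derivs (b # b # L1) u x) = 0"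
      using z by (intro sum.neutral) auto
    finally have "partial_derivs (b0 # b0 # L1) u x = 0" by simp
    then show ?thesis using partial_derivs_mset[OF assms(1,2) less.prems(1) m assms(3)] by simp
  qed
qed

text \<open>A Taylor estimate without Taylor's formula: by induction all first partial derivatives
  are \<open>O(|x|^k)\<close>, and the mean value inequality on the segment from 0 to
  \<open>x\<close> gains one power.\<close>

lemma vanishing_order:
  fixes u :: "'a::euclidean_space \<Rightarrow> complex"
  assumes "harmonic_on (ball 0 1) u" "r < 1"
    and "\<And>L. set L \<subseteq> Basis \<Longrightarrow> length L < k \<Longrightarrow> partial_derivs L u 0 = 0"
  shows "\<exists>C. \<forall>x\<in>cball 0 r. norm (u x) \<le> C * norm x ^ k"
  using assms(1,3)
proof (induction k arbitrary: u)
  case 0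
  have "cball 0 r \<subseteq> ball (0::'a) 1" using assms(2) by auto
  from bounded_continuous_on_cball[OF continuous_on_subset[OF harmonic_on_continuous[OF 0(1)] this]]
  show ?case by (metis mult.right_neutral power_0)
next
  case (Suc k)
  have "\<exists>C. \<forall>x\<in>cball 0 r. norm (partial_deriv b u x) \<le> C * norm x ^ k" if b: "b \<in> Basis" for b
  proof (rule Suc.IH)
    show "harmonic_on (ball 0 1) (partial_deriv b u)" by (rule harmonic_on_partial_deriv[OF open_ball Suc.prems(1) b])
    show "partial_derivs L (partial_deriv b u) 0 = 0" if "set L \<subseteq> Basis" "length L < k" for L
      using Suc.prems(2)[of "L @ [b]"] that b by (simp add: partial_derivs_append_single)
  qed
  then obtain C where C: "\<And>b x. b \<in> Basis \<Longrightarrow> x \<in> cball 0 r \<Longrightarrow> norm (partial_deriv b u x) \<le> C b * norm x ^ k" by metis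
  define D where "D = (\<Sum>b\<in>Basis. \<bar>C b\<bar>)"
  have "norm (u x) \<le> D * norm x ^ Suc k" if x: "x \<in> cball 0 r" for x
  proof -
    have "norm (u x - u 0) \<le> (\<Sum>b\<in>Basis. \<bar>C b\<bar> * norm x ^ k) * norm (x - 0)"
    proof (rule has_grad_lipschitz[of "closed_segment 0 x"])
      fix y assume y: "y \<in> closed_segment 0 x"
      then have ny: "norm y \<le> norm x" using segment_bound1[of y 0 x] by simp
      then have yr: "y \<in> cball 0 r" using x by simp
      then have "y \<in> ball 0 1" using assms(2) by simp
      then show "has_grad u (\<lambda>b. partial_deriv b u y) y" by (rule harmonic_has_grad[OF Suc.prems(1)])
      fix b :: 'a assume b: "b \<in> Basis"
      have "norm (partial_deriv b u y) \<le> C b * norm y ^ k" by (rule C[OF b yr])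
      also have "\<dots> \<le> \<bar>C b\<bar> * norm x ^ k" using ny by (intro mult_mono power_mono) auto
      finally show "norm (partial_deriv b u y) \<le> \<bar>C b\<bar> * norm x ^ k" .
    qed auto
    moreover have "u 0 = 0" using Suc.prems(2)[of "[]"] by simp
    moreover have "(\<Sum>b\<in>Basis. \<bar>C b\<bar> * norm x ^ k) = D * norm x ^ k"
      by (simp add: D_def sum_distrib_right)
    ultimately show ?thesis by (simp add: mult_ac)
  qed
  then show ?case by blast
qed

text \<open>The second part contains derivatives of order up to \<open>K + 1\<close>. This slight
  excess is harmless and lets both parts have the same binomial size.\<close>

definition jet_index :: "'a::euclidean_space \<Rightarrow> nat \<Rightarrow> 'a multiset set" where
  "jet_index b0 K = msets_upto (Basis - {b0}) K \<union> add_mset b0 ` msets_upto (Basis - {b0}) K"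

text \<open>The arbitrary ordering does not affect the value when \<open>u\<close> is harmonic and
  the directions lie in \<open>Basis\<close>, by \<open>partial_derivs_mset\<close>.\<close>

definition jet :: "'a::euclidean_space multiset \<Rightarrow> ('a \<Rightarrow> complex) \<Rightarrow> complex" where
  "jet N u = partial_derivs (SOME L. mset L = N) u 0"

lemma jet_index_Basis:
  assumes "b0 \<in> Basis" "N \<in> jet_index b0 K"
  shows "set_mset N \<subseteq> Basis"
  using assms by (auto simp: jet_index_def msets_upto_def)

lemma mset_SOME: "mset (SOME L. mset L = N) = N"
  using someI_ex[OF ex_mset] .

lemma finite_jet_index: "finite (jet_index (b0 :: 'a::euclidean_space) K)"
  by (simp add: jet_index_def finite_msets_upto)

lemma card_jet_index:
  fixes b0 :: "'a::euclidean_space"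
  assumes "b0 \<in> Basis"
  shows "card (jet_index b0 K) \<le> 2 * ((K + (DIM('a) - 1)) choose (DIM('a) - 1))"
proof -
  have c: "card (msets_upto (Basis - {b0}) K) = (K + (DIM('a) - 1)) choose (DIM('a) - 1)"
    using card_msets_upto[of "Basis - {b0}" K] assms by (simp add: card_Diff_singleton)
  have "card (jet_index b0 K) \<le> card (msets_upto (Basis - {b0}) K) + card (add_mset b0 ` msets_upto (Basis - {b0}) K)"
    unfolding jet_index_def by (rule card_Un_le)
  also have "card (add_mset b0 ` msets_upto (Basis - {b0}) K) \<le> card (msets_upto (Basis - {b0}) K)"
    by (rule card_image_le) (simp add: finite_msets_upto)
  finally show ?thesis using c by simp
qed

lemma jet_sum:
  fixes b0 :: "'a::euclidean_space"
  assumes "b0 \<in> Basis" "N \<in> jet_index b0 K" "finite I" "\<And>i. i \<in> I \<Longrightarrow> harmonic_on (ball 0 1) (u i)"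
  shows "jet N (\<lambda>x. \<Sum>i\<in>I. a i * u i x) = (\<Sum>i\<in>I. a i * jet N (u i))"
  unfolding jet_def
proof (rule partial_derivs_sum[OF open_ball assms(3,4)])
  show "set (SOME L. mset L = N) \<subseteq> Basis"
    using jet_index_Basis[OF assms(1,2)] mset_SOME[of N] by (metis set_mset_mset)
qed auto

lemma jets_vanish_order:
  fixes b0 :: "'a::euclidean_space"
  assumes "b0 \<in> Basis" "harmonic_on (ball 0 1) u" "r < 1"
    and van: "\<And>N. N \<in> jet_index b0 K \<Longrightarrow> jet N u = 0"
  shows "\<exists>C. \<forall>x\<in>cball 0 r. norm (u x) \<le> C * norm x ^ Suc K"
proof (rule vanishing_order[OF assms(2,3)])
  fix L :: "'a list" assume L: "set L \<subseteq> Basis" "length L < Suc K"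
  show "partial_derivs L u 0 = 0"
  proof (rule jets_vanish[OF open_ball assms(2) _ assms(1), of _ K])
    fix L :: "'a list" assume L: "set L \<subseteq> Basis" "length L \<le> K" "count (mset L) b0 \<le> 1"
    have "mset L \<in> jet_index b0 K"
    proof (cases "b0 \<in> set L")
      case False
      then show ?thesis using L by (auto simp: jet_index_def msets_upto_def)
    next
      case True
      then obtain N where N: "mset L = add_mset b0 N" by (metis insert_DiffM set_mset_mset)
      then have "b0 \<notin># N" using L(3) by (simp add: not_in_iff)
      moreover have "set_mset N \<subseteq> Basis" using L(1) N by (metis set_mset_add_mset_insert set_mset_mset insert_subset)
      moreover have "size N \<le> K" using L(2) N by (metis size_mset size_add_mset Suc_leD)
      ultimately show ?thesis using N by (auto simp: jet_index_def msets_upto_def)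
    qed
    from van[OF this] have "partial_derivs (SOME L'. mset L' = mset L) u 0 = 0" by (simp add: jet_def)
    moreover have "partial_derivs L u 0 = partial_derivs (SOME L'. mset L' = mset L) u 0"
      by (rule partial_derivs_mset[OF open_ball assms(2) L(1)]) (simp_all add: mset_SOME)
    ultimately show "partial_derivs L u 0 = 0" by simp
  qed (use L in auto)
qed

section \<open>Polynomials in the kernel of the Laplacian\<close>

definition mon :: "'a::euclidean_space multiset \<Rightarrow> 'a \<Rightarrow> complex" where
  "mon N x = (\<Prod>b\<in>#N. of_real (x \<bullet> b))"

lemma mon_empty: "mon {#} x = 1" and mon_add_mset: "mon (add_mset b N) x = of_real (x \<bullet> b) * mon N x"
  by (simp_all add: mon_def)

lemma has_grad_cong:
  assumes "has_grad f F x" "\<And>b. b \<in> Basis \<Longrightarrow> F b = G b"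
  shows "has_grad f G x"
  using assms unfolding has_grad_def by simp

text \<open>If \<open>b\<close> does not occur in \<open>N\<close>, then \<open>N - {#b#}\<close> is
  \<open>N\<close> itself and the factor \<open>count N b = 0\<close> removes the term.\<close>

lemma has_grad_mon:
  assumes "set_mset N \<subseteq> Basis"
  shows "has_grad (mon N) (\<lambda>b. of_nat (count N b) * mon (N - {#b#}) x) x"
  using assms
proof (induction N)
  case empty
  then show ?case using has_grad_const[of 1 x] by (simp add: mon_empty[abs_def])
next
  case (add a N)
  have "has_grad (\<lambda>x. of_real (x \<bullet> a) * mon N x)
     (\<lambda>b. of_real (a \<bullet> b) * mon N x + of_real (x \<bullet> a) * (of_nat (count N b) * mon (N - {#b#}) x)) x"
    using add by (intro has_grad_mult has_grad_of_real_inner) auto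
  then show ?case
    unfolding mon_add_mset[abs_def]
  proof (rule has_grad_cong)
    fix b :: 'a assume b: "b \<in> Basis"
    show "of_real (a \<bullet> b) * mon N x + of_real (x \<bullet> a) * (of_nat (count N b) * mon (N - {#b#}) x) =
       of_nat (count (add_mset a N) b) * mon (add_mset a N - {#b#}) x"
    proof (cases "a = b")
      case True
      have "of_real (x \<bullet> a) * (of_nat (count N a) * mon (N - {#a#}) x) = of_nat (count N a) * mon N x"
      proof (cases "a \<in># N")
        case True
        then have "mon N x = of_real (x \<bullet> a) * mon (N - {#a#}) x" by (metis insert_DiffM mon_add_mset)
        then show ?thesis by simp
      qed (simp add: not_in_iff)
      then show ?thesis using True b by (simp add: distrib_right)
    next
      case False
      then have ab: "a \<bullet> b = 0" using b add.prems by (simp add: inner_Basis)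
      show ?thesis
      proof (cases "b \<in># N")
        case True
        then have "add_mset a N - {#b#} = add_mset a (N - {#b#})" by (intro diff_union_swap[symmetric]) (use \<open>a \<noteq> b\<close> in simp)
        then show ?thesis using ab False by (simp add: mon_add_mset)
      next
        case False
        then show ?thesis using ab \<open>a \<noteq> b\<close> by (simp add: not_in_iff)
      qed
    qed
  qed
qed

lemma has_grad_sum:
  assumes "\<And>i. i \<in> I \<Longrightarrow> has_grad (f i) (F i) x"
  shows "has_grad (\<lambda>x. \<Sum>i\<in>I. f i x) (\<lambda>b. \<Sum>i\<in>I. F i b) x"
proof -
  have "((\<lambda>x. \<Sum>i\<in>I. f i x) has_derivative (\<lambda>h. \<Sum>i\<in>I. \<Sum>b\<in>Basis. (h \<bullet> b) *\<^sub>R F i b)) (at x)"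
    using assms unfolding has_grad_def by (intro has_derivative_sum)
  then show ?thesis unfolding has_grad_def
    by (rule has_derivative_eq_rhs) (simp add: fun_eq_iff scaleR_sum_right sum.swap[of _ I])
qed

lemma has_grad_cmult:
  assumes "has_grad f F x"
  shows "has_grad (\<lambda>x. k * f x) (\<lambda>b. k * F b) x"
  using has_grad_mult[OF has_grad_const assms] by simp

lemma continuous_on_mon: "continuous_on S (mon N)"
  unfolding mon_def[abs_def] by (induction N) (auto intro!: continuous_intros)

text \<open>The Laplacian of \<open>\<Sum>M. a M * mon M\<close> is \<open>\<Sum>N. (\<Sum>M. laplace_coeff N M * a M) * mon N\<close>.\<close>

definition laplace_coeff :: "'a::euclidean_space multiset \<Rightarrow> 'a multiset \<Rightarrow> complex" where
  "laplace_coeff N M = (\<Sum>b\<in>Basis. if M = N + {#b, b#} then of_nat (count M b * count (M - {#b#}) b) else 0)"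

text \<open>One linear equation for each monomial of degree at most \<open>K\<close>: the
  coefficients of the Laplacian, collected by the resulting monomial, are required to vanish. This
  turns harmonicity into a homogeneous system for the coefficients.\<close>

lemma harmonic_monomials:
  fixes a :: "'a::euclidean_space multiset \<Rightarrow> complex"
  assumes van: "\<And>N. N \<in> msets_upto Basis K \<Longrightarrow> (\<Sum>M\<in>msets_upto Basis (K + 2). laplace_coeff N M * a M) = 0"
  shows "harmonic_on UNIV (\<lambda>x. \<Sum>M\<in>msets_upto Basis (K + 2). a M * mon M x)"
proof -
  define S where "S = (msets_upto Basis (K + 2) :: 'a multiset set)"
  have SB: "set_mset M \<subseteq> Basis" "size M \<le> K + 2" if "M \<in> S" for M using that by (auto simp: S_def msets_upto_def)
  define cc :: "'a multiset \<Rightarrow> 'a \<Rightarrow> 'a \<Rightarrow> complex" where "cc = (\<lambda>(M :: 'a multiset) b b'. of_nat (count M b) * of_nat (count (M - {#b#}) b'))"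
  have lap: "(\<Sum>b\<in>Basis. \<Sum>M\<in>S. a M * (cc M b b * mon (M - {#b#} - {#b#}) x)) = 0" for x
  proof -
    \<comment> \<open>For fixed \<open>M\<close> and \<open>b\<close> at most one \<open>N\<close>
      contributes, namely \<open>M\<close> with two copies of \<open>b\<close> removed; if there are
      fewer than two copies, both sides are zero.\<close>
    have lap_term: "cc M b b * mon (M - {#b#} - {#b#}) x =
        (\<Sum>N\<in>msets_upto Basis K. mon N x * (if M = N + {#b, b#} then of_nat (count M b * count (M - {#b#}) b) else 0))"
      if M: "M \<in> S" and b: "b \<in> Basis" for M b
    proof (cases "2 \<le> count M b")
      case False
      then have "cc M b b = 0" by (auto simp: cc_def)
      moreover have "M \<noteq> N + {#b, b#}" for N using False by auto
      ultimately show ?thesis by simp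
    next
      case True
      define N0 where "N0 = M - {#b, b#}"
      have sub: "{#b, b#} \<subseteq># M" using True by (auto simp: subseteq_mset_def)
      have M_eq: "M = N0 + {#b, b#}" unfolding N0_def using subset_mset.add_diff_inverse[OF sub] by (simp only: union_commute)
      have N0: "N0 \<in> msets_upto Basis K" using SB[OF M] unfolding M_eq by (auto simp: msets_upto_def)
      have "(\<Sum>N\<in>msets_upto Basis K. mon N x * (if M = N + {#b, b#} then of_nat (count M b * count (M - {#b#}) b) else 0))
          = (\<Sum>N\<in>msets_upto Basis K. if N = N0 then mon N x * of_nat (count M b * count (M - {#b#}) b) else 0)"
        by (intro sum.cong) (auto simp: M_eq)
      also have "\<dots> = mon N0 x * of_nat (count M b * count (M - {#b#}) b)"
        using N0 by (simp add: finite_msets_upto)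
      finally show ?thesis by (simp add: cc_def N0_def mult.commute)
    qed
    have "(\<Sum>b\<in>Basis. \<Sum>M\<in>S. a M * (cc M b b * mon (M - {#b#} - {#b#}) x)) =
      (\<Sum>b\<in>Basis. \<Sum>M\<in>S. \<Sum>N\<in>msets_upto Basis K.
         mon N x * ((if M = N + {#b, b#} then of_nat (count M b * count (M - {#b#}) b) else 0) * a M))"
    proof (intro sum.cong refl)
      fix b :: 'a and M assume b: "b \<in> Basis" and M: "M \<in> S"
      show "a M * (cc M b b * mon (M - {#b#} - {#b#}) x) = (\<Sum>N\<in>msets_upto Basis K.
         mon N x * ((if M = N + {#b, b#} then of_nat (count M b * count (M - {#b#}) b) else 0) * a M))"
        unfolding lap_term[OF M b] sum_distrib_left by (intro sum.cong refl) (simp only: mult_ac)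
    qed
    also have "\<dots> = (\<Sum>N\<in>msets_upto Basis K. mon N x * (\<Sum>M\<in>S. laplace_coeff N M * a M))"
      unfolding laplace_coeff_def sum_distrib_left sum_distrib_right
      by (subst sum.swap, subst (2) sum.swap, subst sum.swap) (rule refl)
    also have "\<dots> = 0" using van by (intro sum.neutral) (auto simp: S_def)
    finally show ?thesis .
  qed
  have g1: "has_grad (\<lambda>x. \<Sum>M\<in>S. a M * mon M x) (\<lambda>b. \<Sum>M\<in>S. a M * (of_nat (count M b) * mon (M - {#b#}) x)) x" for x
    by (intro has_grad_sum has_grad_cmult has_grad_mon SB(1))
  have g2: "has_grad (\<lambda>x. \<Sum>M\<in>S. a M * (of_nat (count M b) * mon (M - {#b#}) x))
      (\<lambda>b'. \<Sum>M\<in>S. a M * (cc M b b' * mon (M - {#b#} - {#b'#}) x)) x" for b x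
  proof -
    have "has_grad (\<lambda>x. \<Sum>M\<in>S. a M * (of_nat (count M b) * mon (M - {#b#}) x))
      (\<lambda>b'. \<Sum>M\<in>S. a M * (of_nat (count M b) * (of_nat (count (M - {#b#}) b') * mon (M - {#b#} - {#b'#}) x))) x"
      by (intro has_grad_sum has_grad_cmult has_grad_mon) (use SB(1) in \<open>auto dest: in_diffD\<close>)
    then show ?thesis by (simp add: cc_def mult.assoc)
  qed
  have "harmonic_on UNIV (\<lambda>x. \<Sum>M\<in>S. a M * mon M x)"
    by (rule harmonic_onI[OF open_UNIV g1[unfolded has_grad_def] g2[unfolded has_grad_def] _ lap])
      (intro continuous_intros continuous_on_mon)
  then show ?thesis by (simp add: S_def)
qed

lemma norm_mon_le:
  assumes "set_mset N \<subseteq> Basis"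
  shows "norm (mon N x) \<le> norm x ^ size N"
  using assms
proof (induction N)
  case (add b N)
  have "norm (mon (add_mset b N) x) = \<bar>x \<bullet> b\<bar> * norm (mon N x)" by (simp add: mon_add_mset norm_mult)
  also have "\<dots> \<le> norm x * norm x ^ size N" using add by (intro mult_mono) (auto simp: Basis_le_norm)
  finally show ?case by simp
qed (simp add: mon_empty)

lemma monomials_growth:
  fixes a :: "'a::euclidean_space multiset \<Rightarrow> complex"
  obtains C where "\<And>x. norm (\<Sum>M\<in>msets_upto Basis K. a M * mon M x) \<le> C * (1 + norm x) ^ K"
proof
  fix x :: 'a
  have "norm (\<Sum>M\<in>msets_upto Basis K. a M * mon M x) \<le> (\<Sum>M\<in>msets_upto Basis K. norm (a M) * (1 + norm x) ^ K)"
  proof (rule sum_norm_le)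
    fix M :: "'a multiset" assume M: "M \<in> msets_upto Basis K"
    then have "norm (mon M x) \<le> norm x ^ size M" by (intro norm_mon_le) (simp add: msets_upto_def)
    also have "\<dots> \<le> (1 + norm x) ^ size M" by (intro power_mono) auto
    also have "\<dots> \<le> (1 + norm x) ^ K" using M by (intro power_increasing) (auto simp: msets_upto_def)
    finally show "norm (a M * mon M x) \<le> norm (a M) * (1 + norm x) ^ K"
      unfolding norm_mult by (intro mult_left_mono) auto
  qed
  then show "norm (\<Sum>M\<in>msets_upto Basis K. a M * mon M x) \<le> (\<Sum>M\<in>msets_upto Basis K. norm (a M)) * (1 + norm x) ^ K"
    by (simp add: sum_distrib_right)
qed

text \<open>Differentiating in direction \<open>b\<close> gives a vanishing combination of lower
  degree, so by induction every coefficient of a monomial containing some \<open>b\<close> is zero.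
  The constant term is then the value at 0.\<close>

lemma monomials_independent:
  fixes a :: "'a::euclidean_space multiset \<Rightarrow> complex"
  assumes "\<And>x. x \<in> ball 0 1 \<Longrightarrow> (\<Sum>M\<in>msets_upto Basis K. a M * mon M x) = 0" "M \<in> msets_upto Basis K"
  shows "a M = 0"
  using assms
proof (induction K arbitrary: a M)
  case 0
  then show ?case using 0(1)[of 0] by (simp add: msets_upto_0 mon_empty)
next
  case (Suc K)
  define S where "S = (msets_upto Basis (Suc K) :: 'a multiset set)"
  have fin: "finite S" "finite (msets_upto Basis K :: 'a multiset set)" by (auto simp: S_def finite_msets_upto)
  have SB: "set_mset M \<subseteq> Basis" if "M \<in> S" for M using that by (auto simp: S_def msets_upto_def)
  have a_add: "a (add_mset b N) = 0" if b: "b \<in> Basis" and N: "N \<in> msets_upto Basis K" for b N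
  proof -
    have zero: "(\<Sum>N\<in>msets_upto Basis K. (a (add_mset b N) * of_nat (Suc (count N b))) * mon N x) = 0"
      if x: "x \<in> ball 0 1" for x
    proof -
      have "((\<lambda>x. 0) has_derivative (\<lambda>h. \<Sum>b\<in>Basis. (h \<bullet> b) *\<^sub>R (\<Sum>M\<in>S. a M * (of_nat (count M b) * mon (M - {#b#}) x)))) (at x)"
      proof (rule has_derivative_transform_within_open[OF _ open_ball x])
        show "((\<lambda>x. \<Sum>M\<in>S. a M * mon M x) has_derivative (\<lambda>h. \<Sum>b\<in>Basis. (h \<bullet> b) *\<^sub>R (\<Sum>M\<in>S. a M * (of_nat (count M b) * mon (M - {#b#}) x)))) (at x)"
          using has_grad_sum[of S "\<lambda>M x. a M * mon M x" "\<lambda>M b. a M * (of_nat (count M b) * mon (M - {#b#}) x)" x]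
            has_grad_cmult[OF has_grad_mon[OF SB]] unfolding has_grad_def by blast
      qed (use Suc.prems(1) in \<open>auto simp: S_def\<close>)
      then have "(\<lambda>h. \<Sum>b\<in>Basis. (h \<bullet> b) *\<^sub>R (\<Sum>M\<in>S. a M * (of_nat (count M b) * mon (M - {#b#}) x))) = (\<lambda>h. 0)"
        using has_derivative_unique has_derivative_const by blast
      from fun_cong[OF this, of b]
      have "(\<Sum>b'\<in>Basis. if b' = b then (\<Sum>M\<in>S. a M * (of_nat (count M b') * mon (M - {#b'#}) x)) else 0) = 0"
        using b by (subst (asm) sum.cong[OF refl, of _ _ "\<lambda>b'. if b' = b then (\<Sum>M\<in>S. a M * (of_nat (count M b') * mon (M - {#b'#}) x)) else 0"])
          (auto simp: inner_Basis)
      then have "0 = (\<Sum>M\<in>S. a M * (of_nat (count M b) * mon (M - {#b#}) x))" using b by simp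
      also have "\<dots> = (\<Sum>M\<in>add_mset b ` msets_upto Basis K. a M * (of_nat (count M b) * mon (M - {#b#}) x))"
      proof (rule sum.mono_neutral_right[OF fin(1)])
        show "add_mset b ` msets_upto Basis K \<subseteq> S" using b by (auto simp: S_def msets_upto_def)
        show "\<forall>M\<in>S - add_mset b ` msets_upto Basis K. a M * (of_nat (count M b) * mon (M - {#b#}) x) = 0"
        proof
          fix M assume M: "M \<in> S - add_mset b ` msets_upto Basis K"
          have "b \<notin># M"
          proof
            assume "b \<in># M"
            then obtain N where N: "M = add_mset b N" by (metis insert_DiffM)
            then have "N \<in> msets_upto Basis K" using M by (auto simp: S_def msets_upto_def)
            with N M show False by blast
          qed
          then show "a M * (of_nat (count M b) * mon (M - {#b#}) x) = 0" by (simp add: not_in_iff)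
        qed
      qed
      also have "\<dots> = (\<Sum>N\<in>msets_upto Basis K. (a (add_mset b N) * of_nat (Suc (count N b))) * mon N x)"
        by (subst sum.reindex) (auto simp: inj_on_def mult.assoc)
      finally show ?thesis by simp
    qed
    from Suc.IH[OF zero N] show ?thesis by (simp del: of_nat_Suc)
  qed
  have nonempty: "a M = 0" if M: "M \<in> S" "M \<noteq> {#}" for M
  proof -
    obtain b N where N: "M = add_mset b N" using M(2) by (metis multiset_cases)
    then have "b \<in> Basis" "N \<in> msets_upto Basis K" using M(1) by (auto simp: S_def msets_upto_def)
    then show ?thesis using a_add N by simp
  qed
  show ?case
  proof (cases "M = {#}")
    case False
    then show ?thesis using nonempty Suc.prems(2) by (simp add: S_def)
  next
    case True
    have "0 = (\<Sum>M\<in>S. a M * mon M 0)" using Suc.prems(1)[of 0] by (simp add: S_def)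
    also have "\<dots> = (\<Sum>M\<in>{{#}}. a M * mon M 0)"
      by (rule sum.mono_neutral_right[OF fin(1)]) (use nonempty in \<open>auto simp: S_def msets_upto_def\<close>)
    finally show ?thesis using True by (simp add: mon_empty)
  qed
qed

section \<open>Asymptotics\<close>

lemma fact_mult_binomial_le: "fact m * real ((K + m) choose m) \<le> real (K + m) ^ m"
proof -
  have "((K + m) choose m) * fact m \<le> (K + m) ^ m" by (rule binomial_fact_pow)
  then have "real (((K + m) choose m) * fact m) \<le> real ((K + m) ^ m)" by (simp only: of_nat_le_iff)
  then show ?thesis by (simp add: mult.commute)
qed

text \<open>The product of \<open>K + 1\<close> up to \<open>K + m\<close> has \<open>m\<close>
  factors, each at least \<open>K + 1\<close>. With the preceding bound the binomial coefficient is
  asymptotic to \<open>K ^ m / fact m\<close>.\<close>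

lemma power_le_fact_mult_binomial: "(K + 1) ^ m \<le> fact m * ((K + m) choose m)"
proof (induction m)
  case (Suc m)
  have "(K + 1) ^ Suc m \<le> (K + Suc m) * (fact m * ((K + m) choose m))"
    using mult_mono[OF _ Suc, of "K + 1" "K + Suc m"] by simp
  also have "\<dots> = fact m * (Suc (K + m) * ((K + m) choose m))" by (simp only: add_Suc_right mult_ac)
  also have "\<dots> = fact m * (Suc m * (Suc (K + m) choose Suc m))"
    by (simp only: Suc_times_binomial_eq mult.commute)
  also have "\<dots> = fact (Suc m) * ((K + Suc m) choose Suc m)" by (simp only: fact_Suc add_Suc_right of_nat_id mult_ac)
  finally show ?case .
qed simp

text \<open>Unknowns minus equations in the Laplacian system. Pascal's rule, applied twice, leaves
  two binomial coefficients; replacing the larger by the smaller brings the count into the shape of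
  the upper bound.\<close>

lemma monomial_count_difference:
  assumes "DIM('a) = Suc m"
  shows "2 * ((K + 1 + m) choose m) \<le>
    card (msets_upto (Basis :: 'a::euclidean_space set) (K + 2)) - card (msets_upto (Basis :: 'a set) K)"
proof -
  have c: "card (msets_upto (Basis :: 'a set) k) = (k + Suc m) choose Suc m" for k
    using card_msets_upto[of "Basis :: 'a set" k] assms by simp
  have "((K + 2 + Suc m) choose Suc m) = ((K + 2 + m) choose m) + ((K + 2 + m) choose Suc m)" by simp
  also have "((K + 2 + m) choose Suc m) = ((K + 1 + m) choose m) + ((K + Suc m) choose Suc m)" by simp
  finally have "card (msets_upto (Basis :: 'a set) (K + 2)) - card (msets_upto (Basis :: 'a set) K) =
      ((K + 2 + m) choose m) + ((K + 1 + m) choose m)"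
    unfolding c by simp
  moreover have "((K + 1 + m) choose m) \<le> ((K + 2 + m) choose m)" by (rule binomial_right_mono) simp
  ultimately show ?thesis by simp
qed

text \<open>Slopes arbitrarily close to \<open>a0\<close> from either side suffice by continuity of
  the power. The intercept \<open>b\<close> may depend on the slope, being negligible against
  \<open>\<bar>ln s\<bar>\<close>, and the side condition in \<open>low\<close> holds for all small
  \<open>s\<close>.\<close>

lemma tendsto_squeeze_power:
  fixes n :: "real \<Rightarrow> real" and a0 :: real
  assumes a0: "0 < a0"
    and up: "\<And>a. a0 < a \<Longrightarrow> \<exists>b. \<forall>s\<in>{0<..<1}. n s \<le> 2 * (a * \<bar>ln s\<bar> + b) ^ m / fact m"
    and low: "\<And>a. 0 < a \<Longrightarrow> a < a0 \<Longrightarrow> \<exists>b. \<forall>s\<in>{0<..<1}. 2 \<le> a * \<bar>ln s\<bar> - b \<longrightarrow>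
      2 * (a * \<bar>ln s\<bar> - b) ^ m / fact m \<le> n s"
  shows "((\<lambda>s. n s / \<bar>ln s\<bar> ^ m) \<longlongrightarrow> 2 * a0 ^ m / fact m) (at_right 0)"
proof (rule order_tendstoI)
  have ev: "\<forall>\<^sub>F s :: real in at_right 0. s \<in> {0<..<1}" by (rule eventually_at_right_real) simp
  have L: "filterlim (\<lambda>s :: real. \<bar>ln s\<bar>) at_top (at_right 0)" by real_asymp
  have lim: "((\<lambda>s. 2 * (a + b / \<bar>ln s\<bar>) ^ m / fact m) \<longlongrightarrow> 2 * a ^ m / fact m) (at_right 0)" for a b :: real
  proof -
    have "((\<lambda>s. b / \<bar>ln s\<bar>) \<longlongrightarrow> 0) (at_right 0)" by (rule tendsto_divide_0[OF tendsto_const filterlim_at_top_imp_at_infinity[OF L]])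
    then have "((\<lambda>s. 2 * (a + b / \<bar>ln s\<bar>) ^ m / fact m) \<longlongrightarrow> 2 * (a + 0) ^ m / fact m) (at_right 0)"
      by (intro tendsto_intros) auto
    then show ?thesis by simp
  qed
  have div: "2 * (a * l + b) ^ m / fact m / l ^ m = 2 * (a + b / l) ^ m / fact m" if "0 < l" for a b l :: real
  proof -
    have "a * l + b = (a + b / l) * l" using that by (simp add: field_simps)
    then show ?thesis using that by (simp add: power_mult_distrib)
  qed
  fix y :: real
  {
    assume y: "2 * a0 ^ m / fact m < y"
    have "((\<lambda>a. 2 * a ^ m / fact m) \<longlongrightarrow> 2 * a0 ^ m / fact m) (at_right a0)" by (intro tendsto_intros) auto
    then have "\<forall>\<^sub>F a in at_right a0. 2 * a ^ m / fact m < y" using y by (rule order_tendstoD)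
    moreover have "\<forall>\<^sub>F a in at_right a0. a0 < a" by (simp add: eventually_at_right_less)
    ultimately have "\<forall>\<^sub>F a in at_right a0. 2 * a ^ m / fact m < y \<and> a0 < a" by (rule eventually_conj)
    then obtain a where a: "2 * a ^ m / fact m < y" "a0 < a"
      using eventually_happens[of _ "at_right a0"] by force
    obtain b where b: "\<And>s. s \<in> {0<..<1} \<Longrightarrow> n s \<le> 2 * (a * \<bar>ln s\<bar> + b) ^ m / fact m" using up[OF a(2)] by blast
    from order_tendstoD(2)[OF lim[of a b] a(1)] ev
    show "\<forall>\<^sub>F s in at_right 0. n s / \<bar>ln s\<bar> ^ m < y"
    proof eventually_elim
      case (elim s)
      then have l: "0 < \<bar>ln s\<bar>" by simp
      have "n s / \<bar>ln s\<bar> ^ m \<le> 2 * (a * \<bar>ln s\<bar> + b) ^ m / fact m / \<bar>ln s\<bar> ^ m"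
        using b[OF elim(2)] by (intro divide_right_mono) auto
      then show ?case using elim(1) unfolding div[OF l] by simp
    qed
  }
  {
    assume y: "y < 2 * a0 ^ m / fact m"
    have "((\<lambda>a. 2 * a ^ m / fact m) \<longlongrightarrow> 2 * a0 ^ m / fact m) (at_left a0)" by (intro tendsto_intros) auto
    then have "\<forall>\<^sub>F a in at_left a0. y < 2 * a ^ m / fact m" using y by (rule order_tendstoD)
    moreover have "\<forall>\<^sub>F a in at_left a0. a \<in> {0<..<a0}" by (rule eventually_at_left_real[OF a0])
    ultimately have "\<forall>\<^sub>F a in at_left a0. y < 2 * a ^ m / fact m \<and> a \<in> {0<..<a0}" by (rule eventually_conj)
    then obtain a where a: "y < 2 * a ^ m / fact m" "0 < a" "a < a0"
      using eventually_happens[of _ "at_left a0"] by force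
    obtain b where b: "\<And>s. s \<in> {0<..<1} \<Longrightarrow> 2 \<le> a * \<bar>ln s\<bar> - b \<Longrightarrow> 2 * (a * \<bar>ln s\<bar> - b) ^ m / fact m \<le> n s"
      using low[OF a(2,3)] by blast
    have "\<forall>\<^sub>F s in at_right 0. (2 + b) / a \<le> \<bar>ln s\<bar>" using L by (simp add: filterlim_at_top)
    with order_tendstoD(1)[OF lim[of a "- b"] a(1)] ev
    show "\<forall>\<^sub>F s in at_right 0. y < n s / \<bar>ln s\<bar> ^ m"
    proof eventually_elim
      case (elim s)
      then have l: "0 < \<bar>ln s\<bar>" by simp
      have "2 \<le> a * \<bar>ln s\<bar> - b" using elim(3) a(2) by (simp add: field_simps)
      from b[OF elim(2) this]
      have "2 * (a * \<bar>ln s\<bar> + - b) ^ m / fact m / \<bar>ln s\<bar> ^ m \<le> n s / \<bar>ln s\<bar> ^ m"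
        by (intro divide_right_mono) auto
      then show ?case using elim(1) unfolding div[OF l] by simp
    qed
  }
qed

lemma bounded_L2:
  assumes "f \<in> borel_measurable borel" "\<And>x. x \<in> ball 0 1 \<Longrightarrow> cmod (f x) \<le> C"
  shows "f \<in> L2 (ball 0 1)"
proof -
  have m: "f \<in> borel_measurable unit_leb" by (rule borel_measurable_unit_leb[OF assms(1)])
  have "integrable unit_leb (\<lambda>x. (cmod (f x))\<^sup>2)"
  proof (rule Bochner_Integration.integrable_bound[OF integrable_const_unit_leb[of "C\<^sup>2"]])
    show "(\<lambda>x. (cmod (f x))\<^sup>2) \<in> borel_measurable unit_leb" using m by measurable
    show "AE x in unit_leb. norm ((cmod (f x))\<^sup>2) \<le> norm (C\<^sup>2)"
      using assms(2) by (intro AE_I2) (auto intro!: power_mono)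
  qed
  with m show ?thesis by (simp add: L2_def)
qed

lemma mon_borel: "mon N \<in> borel_measurable borel"
  by (rule borel_measurable_continuous_onI[OF continuous_on_mon])

lemma mon_L2: "set_mset N \<subseteq> Basis \<Longrightarrow> mon N \<in> L2 (ball 0 1)"
  by (rule bounded_L2[OF mon_borel order_trans[OF norm_mon_le], where C = 1])
    (auto intro: power_le_one)

section \<open>Two-sided bounds for the counting function\<close>

context weighted_bergman
begin

text \<open>The functionals are the jets at the origin. The exponent is \<open>2 * Suc K\<close>
  because annihilating all jets up to order \<open>K\<close> forces vanishing to order
  \<open>K + 1\<close>.\<close>

lemma n_plus_upper_bases:
  assumes r: "c < r" "r < \<rho>" "\<rho> < 1" and s: "0 < s" and K: "M / (1 - (c / r)\<^sup>2) * (r / \<rho>) ^ (2 * Suc K) \<le> s"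
  obtains B where "spectral_basis s B"
    "n_plus s bergman T \<le> 2 * ((K + (DIM('a) - 1)) choose (DIM('a) - 1))"
proof -
  obtain b0 :: 'a where b0: "b0 \<in> Basis" using nonempty_Basis by blast
  obtain B where B: "spectral_basis s B"
    "n_plus s bergman T \<le> card (jet_index b0 K)"
  proof (rule eigenvalue_bases[OF finite_jet_index, where lf = jet and s = s])
    fix j a and I :: "(real \<times> ('a \<Rightarrow> complex)) set"
    assume "j \<in> jet_index b0 K" "finite I" "snd ` I \<subseteq> bergman"
    then show "jet j (\<lambda>x. \<Sum>i\<in>I. a i * snd i x) = (\<Sum>i\<in>I. a i * jet j (snd i))"
      by (intro jet_sum[OF b0]) (auto intro: bergman_harmonic)
  next
    fix u :: "'a \<Rightarrow> complex" assume u: "u \<in> bergman" "\<And>j. j \<in> jet_index b0 K \<Longrightarrow> jet j u = 0"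
    obtain C where "\<And>x. x \<in> cball 0 \<rho> \<Longrightarrow> norm (u x) \<le> C * norm x ^ Suc K"
      using jets_vanish_order[OF b0 bergman_harmonic[OF u(1)] r(3) u(2)] by blast
    then have "qs u \<le> M / (1 - (c / r)\<^sup>2) * (r / \<rho>) ^ (2 * Suc K) * nsq u"
      by (rule qs_decay[OF u(1) r])
    also have "\<dots> \<le> s * nsq u" by (intro mult_right_mono K nsq_nonneg)
    finally show "qs u \<le> s * nsq u" .
  qed
  have "card (jet_index b0 K) \<le> 2 * ((K + (DIM('a) - 1)) choose (DIM('a) - 1))" by (rule card_jet_index[OF b0])
  with B that show ?thesis by (meson order_trans)
qed

lemma n_plus_upper:
  assumes a: "1 / (2 * \<bar>ln c\<bar>) < a" and m: "DIM('a) = Suc m"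
  shows "\<exists>b. \<forall>s\<in>{0<..<1}. real (n_plus s bergman T) \<le> 2 * (a * \<bar>ln s\<bar> + b) ^ m / fact m"
proof -
  have lnc: "ln c < 0" using c by simp
  have a0: "0 < a" using a lnc by (smt (verit) divide_pos_pos zero_less_abs_iff)
  \<comment> \<open>Chosen so that \<open>\<theta> ^ (2 * K) = exp (- K / a)\<close>. The assumption
    on \<open>a\<close> says that \<theta> exceeds \<open>c\<close>, which leaves room for
    \<open>c < r < \<rho> < 1\<close> with \<open>r / \<rho> = \<theta>\<close>.\<close>
  define \<theta> where "\<theta> = exp (- (1 / (2 * a)))"
  have "1 / (2 * a) < \<bar>ln c\<bar>" using a a0 lnc by (simp add: field_simps)
  then have "ln c < - (1 / (2 * a))" using lnc by linarith
  then have "exp (ln c) < \<theta>" unfolding \<theta>_def by (simp only: exp_less_cancel_iff)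
  then have \<theta>: "c < \<theta>" "\<theta> < 1" "0 < \<theta>" using c a0 by (auto simp: \<theta>_def)
  then have "c / \<theta> < 1" by simp
  then obtain \<rho> where \<rho>: "c / \<theta> < \<rho>" "\<rho> < 1" using dense by blast
  define r where "r = \<theta> * \<rho>"
  have \<rho>0: "0 < \<rho>" using \<rho>(1) c \<theta> by (meson divide_pos_pos less_trans)
  have r: "c < r" "r < \<rho>" "r / \<rho> = \<theta>" using \<rho> \<rho>0 \<theta> by (auto simp: r_def field_simps)
  define A where "A = M / (1 - (c / r)\<^sup>2)"
  have "c / r < 1" "0 \<le> c / r" using c r by auto
  then have A: "0 < A" using M by (simp add: A_def power_less_one_iff)
  show ?thesis
  \<comment> \<open>The intercept collects the constant \<open>A\<close> of \<open>qs_decay\<close>,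
    1 for rounding up, and \<open>m\<close> from the estimate of the binomial coefficient by a power
    of \<open>K + m\<close>.\<close>
  proof (intro exI[of _ "a * \<bar>ln A\<bar> + 1 + real m"] ballI)
    fix s :: real assume s: "s \<in> {0<..<1}"
    define K where "K = nat \<lceil>a * (\<bar>ln s\<bar> + \<bar>ln A\<bar>)\<rceil>"
    have y: "0 \<le> a * (\<bar>ln s\<bar> + \<bar>ln A\<bar>)" using a0 by simp
    have K: "a * (\<bar>ln s\<bar> + \<bar>ln A\<bar>) \<le> real K" "real K \<le> a * (\<bar>ln s\<bar> + \<bar>ln A\<bar>) + 1"
      using y unfolding K_def by linarith+
    have "\<bar>ln s\<bar> + \<bar>ln A\<bar> \<le> real (2 * Suc K) * (1 / (2 * a))"
      using K(1) a0 by (simp add: field_simps)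
    then have "ln A + real (2 * Suc K) * (- (1 / (2 * a))) \<le> ln s" using s by simp
    then have "exp (ln A + real (2 * Suc K) * (- (1 / (2 * a)))) \<le> exp (ln s)" by (simp only: exp_le_cancel_iff)
    then have "A * \<theta> ^ (2 * Suc K) \<le> s"
      using A s unfolding exp_add exp_of_nat_mult \<theta>_def by simp
    then have K': "M / (1 - (c / r)\<^sup>2) * (r / \<rho>) ^ (2 * Suc K) \<le> s" by (simp only: A_def r(3))
    have "0 < s" using s by simp
    from n_plus_upper_bases[OF r(1,2) \<rho>(2) this K']
    have "n_plus s bergman T \<le> 2 * ((K + (DIM('a) - 1)) choose (DIM('a) - 1))" by blast
    then have "real (n_plus s bergman T) \<le> real (2 * ((K + m) choose m))" using m by (simp only: of_nat_le_iff) simp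
    also have "\<dots> \<le> 2 * real (K + m) ^ m / fact m"
      using fact_mult_binomial_le[of m K] by (simp add: field_simps)
    also have "\<dots> \<le> 2 * (a * \<bar>ln s\<bar> + (a * \<bar>ln A\<bar> + 1 + real m)) ^ m / fact m"
      using K(2) by (intro divide_right_mono mult_left_mono power_mono) (auto simp: algebra_simps)
    finally show "real (n_plus s bergman T) \<le> 2 * (a * \<bar>ln s\<bar> + (a * \<bar>ln A\<bar> + 1 + real m)) ^ m / fact m" .
  qed
qed

text \<open>For any positive \<open>s\<close> a sufficiently large \<open>K\<close> satisfies the
  threshold. Only the finiteness gained from the upper bound matters here: it makes
  \<open>n_plus_lower\<close> applicable.\<close>

lemma spectral_bases:
  assumes s: "0 < s"
  obtains B where "spectral_basis s B"
proof -
  obtain \<rho> where \<rho>: "c < \<rho>" "\<rho> < 1" using dense c by blast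
  obtain r where r: "c < r" "r < \<rho>" using dense \<rho> by blast
  define A where "A = M / (1 - (c / r)\<^sup>2)"
  have "c / r < 1" "0 \<le> c / r" using c r by auto
  then have A: "0 < A" using M by (simp add: A_def power_less_one_iff)
  define q where "q = (r / \<rho>)\<^sup>2"
  have "0 < r / \<rho>" "r / \<rho> < 1" using c r by auto
  then have q: "0 < q" "q < 1" by (auto simp: q_def power_less_one_iff)
  have "0 < s / A" using s A by simp
  then obtain K where "q ^ K < s / A" using real_arch_pow_inv q by blast
  moreover have "q ^ Suc K \<le> q ^ K" using q by (intro power_decreasing) auto
  ultimately have "q ^ Suc K \<le> s / A" by linarith
  then have "A * q ^ Suc K \<le> s" using A by (simp only: pos_le_divide_eq mult.commute)
  then have K: "M / (1 - (c / r)\<^sup>2) * (r / \<rho>) ^ (2 * Suc K) \<le> s" by (simp only: A_def q_def power_mult)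
  show ?thesis by (rule n_plus_upper_bases[OF r \<rho>(2) s K]) (rule that)
qed

text \<open>A test function for \<open>n_plus_lower\<close> is sought among polynomials of degree at
  most \<open>K + 2\<close>. Harmonicity costs one equation per monomial of degree at most
  \<open>K\<close>, orthogonality one per element of \<open>G\<close>; by the bound on
  \<open>card G\<close> there are still fewer equations than coefficients.\<close>

lemma n_plus_ge_monomials:
  assumes s: "0 < s" and \<delta>: "0 < \<delta>" "\<delta> < 1" and \<rho>: "1 < \<rho>"
    and \<epsilon>: "0 < \<epsilon>" "AE x in unit_leb. x \<in> ball 0 \<delta> \<longrightarrow> \<epsilon> \<le> V x"
    and K: "(\<rho> / \<delta>) ^ (2 * (K + 2)) * s < \<epsilon> * (\<delta> / \<rho>) ^ DIM('a) * (1 - (1 / \<rho>)\<^sup>2)"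
  shows "card (msets_upto (Basis :: 'a set) (K + 2)) - card (msets_upto (Basis :: 'a set) K) \<le> n_plus s bergman T"
proof -
  obtain B where B: "spectral_basis s B"
    by (rule spectral_bases[OF s])
  show ?thesis
  proof (rule n_plus_lower[OF s B])
    fix G :: "('a \<Rightarrow> complex) set"
    assume G: "finite G" "G \<subseteq> bergman"
      "card G < card (msets_upto (Basis :: 'a set) (K + 2)) - card (msets_upto (Basis :: 'a set) K)"
    define S where "S = msets_upto (Basis :: 'a set) (K + 2)"
    have finS: "finite S" by (simp add: S_def finite_msets_upto)
    define J :: "('a multiset + ('a \<Rightarrow> complex)) set" where "J = Inl ` msets_upto Basis K \<union> Inr ` G"
    define Q :: "'a multiset + ('a \<Rightarrow> complex) \<Rightarrow> 'a multiset \<Rightarrow> complex" where "Q = (\<lambda>j N. case j of Inl N' \<Rightarrow> laplace_coeff N' N | Inr e \<Rightarrow> ip (mon N) e)"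
    have finJ: "finite J" using G by (simp add: J_def finite_msets_upto)
    have "card J \<le> card (msets_upto (Basis :: 'a set) K) + card G"
      unfolding J_def by (rule order_trans[OF card_Un_le]) (intro add_mono card_image_le finite_msets_upto finite_Basis G)
    then have "card J < card S" using G(3) by (simp add: S_def)
    from homogeneous_system_nontrivial[OF finJ finS this, of Q]
    obtain a where a: "\<exists>N\<in>S. a N \<noteq> 0" "\<And>j. j \<in> J \<Longrightarrow> (\<Sum>N\<in>S. Q j N * a N) = 0" by blast
    define v where "v = (\<lambda>x. \<Sum>N\<in>S. a N * mon N x)"
    \<comment> \<open>Two versions of the polynomial: \<open>v\<close> is entire, as the growth
      estimate requires, and \<open>u\<close> is cut off to represent an element of the
      space.\<close>
    define u where "u = (\<lambda>x. if x \<in> ball 0 1 then v x else 0)"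
    have v: "harmonic_on UNIV v"
      unfolding v_def S_def
    proof (rule harmonic_monomials)
      fix N :: "'a multiset" assume "N \<in> msets_upto Basis K"
      then have "Inl N \<in> J" by (simp add: J_def)
      from a(2)[OF this] show "(\<Sum>M\<in>msets_upto Basis (K + 2). laplace_coeff N M * a M) = 0"
        by (simp add: Q_def S_def)
    qed
    obtain C where C: "\<And>x. norm (v x) \<le> C * (1 + norm x) ^ (K + 2)"
      using monomials_growth[where K = "K + 2" and a = a] unfolding v_def S_def by metis
    have vL2: "v \<in> L2 (ball 0 1)"
    proof (rule bounded_L2[where C = "\<bar>C\<bar> * 2 ^ (K + 2)"])
      show "v \<in> borel_measurable borel"
        using harmonic_on_continuous[OF v] by (rule borel_measurable_continuous_onI)
      fix x :: 'a assume "x \<in> ball 0 1"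
      then have "C * (1 + norm x) ^ (K + 2) \<le> \<bar>C\<bar> * 2 ^ (K + 2)" by (intro mult_mono power_mono) auto
      then show "norm (v x) \<le> \<bar>C\<bar> * 2 ^ (K + 2)" using C[of x] by linarith
    qed
    have u: "u \<in> bergman"
    proof (rule bergmanI)
      show "harmonic_on (ball 0 1) u"
        by (rule harmonic_on_cong_open[OF open_ball harmonic_on_subset[OF v]]) (auto simp: u_def)
      have "integrable unit_leb (\<lambda>x. (cmod (v x))\<^sup>2)" using vL2 by (simp add: L2_def)
      then show "integrable unit_leb (\<lambda>x. (cmod (u x))\<^sup>2)"
        by (rule Bochner_Integration.integrable_cong[THEN iffD1, rotated 2]) (auto simp: u_def)
    qed (auto simp: u_def)
    have "ip u e = 0" if e: "e \<in> G" for e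
    proof -
      have eb: "e \<in> bergman" using G e by blast
      have "ip u e = (CLINT x|unit_leb. (\<Sum>N\<in>S. a N * (mon N x * cnj (e x))))"
        unfolding L2_inner_def
        by (intro Bochner_Integration.integral_cong) (auto simp: u_def v_def sum_distrib_right mult.assoc)
      also have "\<dots> = (\<Sum>N\<in>S. CLINT x|unit_leb. a N * (mon N x * cnj (e x)))"
      proof (rule Bochner_Integration.integral_sum)
        fix N assume "N \<in> S"
        then have "mon N \<in> L2 (ball 0 1)" by (intro mon_L2) (auto simp: S_def msets_upto_def)
        then show "integrable unit_leb (\<lambda>x. a N * (mon N x * cnj (e x)))"
          by (intro integrable_mult_right L2_integrable_mult bergman_L2[OF eb])
      qed
      also have "\<dots> = (\<Sum>N\<in>S. Q (Inr e) N * a N)"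
        by (simp add: Q_def L2_inner_def mult.commute)
      also have "\<dots> = 0" using e by (intro a(2)) (simp add: J_def)
      finally show ?thesis .
    qed
    moreover have "s * nsq u < qs u"
    proof -
      have "u \<noteq> (\<lambda>_. 0)"
      proof
        assume "u = (\<lambda>_. 0)"
        then have "v x = 0" if "x \<in> ball 0 1" for x using that by (auto simp: u_def fun_eq_iff split: if_splits)
        then have "a N = 0" if "N \<in> S" for N
          using monomials_independent[where K = "K + 2" and a = a and M = N] that by (simp add: v_def S_def)
        then show False using a(1) by blast
      qed
      then have pos: "0 < nsq u" by (rule nsq_pos[OF u])
      have "(\<rho> / \<delta>) ^ (2 * (K + 2)) * (s * nsq u) = ((\<rho> / \<delta>) ^ (2 * (K + 2)) * s) * nsq u" by (simp only: mult.assoc)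
      also have "\<dots> < (\<epsilon> * (\<delta> / \<rho>) ^ DIM('a) * (1 - (1 / \<rho>)\<^sup>2)) * nsq u"
        by (rule mult_strict_right_mono[OF K pos])
      also have "\<dots> \<le> (\<rho> / \<delta>) ^ (2 * (K + 2)) * qs u"
        by (rule qs_lower[OF v u _ C \<delta> \<rho> \<epsilon>]) (simp add: u_def)
      finally show ?thesis
        by (rule mult_left_less_imp_less) (use \<delta> \<rho> in simp)
    qed
    ultimately show "\<exists>u\<in>bergman. (\<forall>e\<in>G. ip u e = 0) \<and> s * nsq u < qs u" using u by blast
  qed
qed

lemma n_plus_lower_bound:
  assumes a: "0 < a" "a < 1 / (2 * \<bar>ln c\<bar>)" and m: "DIM('a) = Suc m"
    and pos: "\<And>\<delta>. 0 < \<delta> \<Longrightarrow> \<delta> < c \<Longrightarrow> \<exists>\<epsilon>>0. AE x in unit_leb. x \<in> ball 0 \<delta> \<longrightarrow> \<epsilon> \<le> V x"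
  shows "\<exists>b. \<forall>s\<in>{0<..<1}. 2 \<le> a * \<bar>ln s\<bar> - b \<longrightarrow> 2 * (a * \<bar>ln s\<bar> - b) ^ m / fact m \<le> real (n_plus s bergman T)"
proof -
  have lnc: "ln c < 0" using c by simp
  \<comment> \<open>Chosen so that \<open>\<Theta> ^ (2 * k) = exp (k / a)\<close>. The assumption
    on \<open>a\<close> says \<open>1 / \<Theta> < c\<close>, so some \<delta> fits between them and
    \<open>\<rho> = \<Theta> * \<delta>\<close> exceeds 1.\<close>
  define \<Theta> where "\<Theta> = exp (1 / (2 * a))"
  have \<Theta>1: "1 < \<Theta>" using a by (simp add: \<Theta>_def)
  have "\<bar>ln c\<bar> < 1 / (2 * a)" using a lnc by (simp add: field_simps)
  then have "- (1 / (2 * a)) < ln c" using lnc by linarith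
  then have "exp (- (1 / (2 * a))) < exp (ln c)" by (simp only: exp_less_cancel_iff)
  then have "1 / \<Theta> < c" using c by (simp add: \<Theta>_def exp_minus inverse_eq_divide)
  then obtain \<delta> where \<delta>': "1 / \<Theta> < \<delta>" "\<delta> < c" using dense by blast
  have \<delta>: "0 < \<delta>" "\<delta> < 1" using \<delta>' \<Theta>1 c by (auto intro: less_trans[of 0 "1 / \<Theta>"])
  define \<rho> where "\<rho> = \<Theta> * \<delta>"
  have \<rho>: "1 < \<rho>" "\<rho> / \<delta> = \<Theta>" using \<delta>' \<delta> \<Theta>1 by (auto simp: \<rho>_def field_simps)
  obtain \<epsilon> where \<epsilon>: "0 < \<epsilon>" "AE x in unit_leb. x \<in> ball 0 \<delta> \<longrightarrow> \<epsilon> \<le> V x" using pos[OF \<delta>(1) \<delta>'(2)] by blast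
  define \<kappa> where "\<kappa> = \<epsilon> * (\<delta> / \<rho>) ^ DIM('a) * (1 - (1 / \<rho>)\<^sup>2)"
  have \<kappa>: "0 < \<kappa>" using \<epsilon> \<delta> \<rho> by (simp add: \<kappa>_def power_less_one_iff)
  show ?thesis
  proof (intro exI[of _ "a * \<bar>ln \<kappa>\<bar> + 2"] ballI impI)
    fix s :: real assume s: "s \<in> {0<..<1}" and big: "2 \<le> a * \<bar>ln s\<bar> - (a * \<bar>ln \<kappa>\<bar> + 2)"
    \<comment> \<open>The 1 subtracted here makes the threshold inequality strict; rounding down
      loses at most another 1, hence the 2 in the intercept. The hypothesis \<open>big\<close> gives
      \<open>3 \<le> y\<close>, so \<open>k\<close> is at least 2 and has the form
      \<open>K + 2\<close>.\<close>
    define y where "y = a * \<bar>ln s\<bar> - a * \<bar>ln \<kappa>\<bar> - 1"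
    define k where "k = nat \<lfloor>y\<rfloor>"
    have y: "3 \<le> y" using big by (simp add: y_def)
    have k: "y - 1 \<le> real k" "real k \<le> y" using y unfolding k_def by linarith+
    then have "2 \<le> k" using y by linarith
    then obtain K where K: "k = K + 2" by (metis le_add_diff_inverse2)
    have "real (2 * k) * (1 / (2 * a)) \<le> y / a" using k(2) a by (simp add: field_simps)
    also have "y / a < \<bar>ln s\<bar> - \<bar>ln \<kappa>\<bar>" using a by (simp add: y_def field_simps)
    finally have "real (2 * k) * (1 / (2 * a)) + ln s < ln \<kappa>" using s by simp
    then have "exp (real (2 * k) * (1 / (2 * a)) + ln s) < exp (ln \<kappa>)" by (simp only: exp_less_cancel_iff)
    then have "\<Theta> ^ (2 * k) * s < \<kappa>"
      using s \<kappa> unfolding exp_add exp_of_nat_mult \<Theta>_def by simp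
    then have K': "(\<rho> / \<delta>) ^ (2 * (K + 2)) * s < \<epsilon> * (\<delta> / \<rho>) ^ DIM('a) * (1 - (1 / \<rho>)\<^sup>2)"
      by (simp only: \<rho>(2) \<kappa>_def K)
    have "0 < s" using s by simp
    have "(K + 2) ^ m \<le> fact m * ((K + 1 + m) choose m)" using power_le_fact_mult_binomial[of "K + 1" m] by simp
    then have "real ((K + 2) ^ m) \<le> real (fact m * ((K + 1 + m) choose m))" by (simp only: of_nat_le_iff)
    then have "real (K + 2) ^ m \<le> fact m * real ((K + 1 + m) choose m)" by simp
    then have "2 * real (K + 2) ^ m / fact m \<le> real (2 * ((K + 1 + m) choose m))" by (simp add: field_simps)
    also have "2 * ((K + 1 + m) choose m) \<le> n_plus s bergman T"
      using monomial_count_difference[OF m, of K] n_plus_ge_monomials[OF \<open>0 < s\<close> \<delta> \<rho>(1) \<epsilon> K'] by linarith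
    finally have "2 * real k ^ m / fact m \<le> real (n_plus s bergman T)" by (simp add: K)
    moreover have "2 * (a * \<bar>ln s\<bar> - (a * \<bar>ln \<kappa>\<bar> + 2)) ^ m / fact m \<le> 2 * real k ^ m / fact m"
      using k(1) big by (intro divide_right_mono mult_left_mono power_mono) (auto simp: y_def)
    ultimately show "2 * (a * \<bar>ln s\<bar> - (a * \<bar>ln \<kappa>\<bar> + 2)) ^ m / fact m \<le> real (n_plus s bergman T)" by linarith
  qed
qed

lemma n_plus_asymptotics:
  assumes m: "DIM('a) = Suc m"
    and pos: "\<And>\<delta>. 0 < \<delta> \<Longrightarrow> \<delta> < c \<Longrightarrow> \<exists>\<epsilon>>0. AE x in unit_leb. x \<in> ball 0 \<delta> \<longrightarrow> \<epsilon> \<le> V x"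
  shows "((\<lambda>s. real (n_plus s bergman T) / \<bar>ln s\<bar> ^ m) \<longlongrightarrow> 2 * (1 / (2 * \<bar>ln c\<bar>)) ^ m / fact m) (at_right 0)"
proof (rule tendsto_squeeze_power)
  have "ln c < 0" using c by simp
  then show "0 < 1 / (2 * \<bar>ln c\<bar>)" by simp
qed (use n_plus_upper[OF _ m] n_plus_lower_bound[OF _ _ m pos] in blast)+

end

section \<open>Essential support and essential infimum\<close>

text \<open>The union in \<open>ess_support\<close> is uncountable in general; by the Lindelof
  property countably many of its open sets cover it, and their exceptional null sets can be
  united.\<close>

lemma AE_outside_ess_support:
  fixes V :: "'a::euclidean_space \<Rightarrow> real"
  shows "AE x in lebesgue_on \<Omega>. x \<notin> ess_support \<Omega> V \<longrightarrow> V x = 0"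
proof -
  define F where "F = {U. open U \<and> (AE x in lebesgue_on \<Omega>. x \<in> U \<longrightarrow> V x = 0)}"
  obtain F' where F': "F' \<subseteq> F" "countable F'" "\<Union>F' = \<Union>F"
    using Lindelof[of F] by (auto simp: F_def)
  have "AE x in lebesgue_on \<Omega>. \<forall>U\<in>F'. x \<in> U \<longrightarrow> V x = 0"
    using F'(1) by (subst AE_ball_countable[OF F'(2)]) (auto simp: F_def)
  then show ?thesis
  proof (rule AE_mp, intro AE_I2 impI)
    fix x assume x: "x \<in> space (lebesgue_on \<Omega>)" "\<forall>U\<in>F'. x \<in> U \<longrightarrow> V x = 0" "x \<notin> ess_support \<Omega> V"
    then have "x \<in> \<Union>F" by (auto simp: ess_support_def F_def)
    then show "V x = 0" using F'(3) x(2) by blast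
  qed
qed

text \<open>The essential supremum of \<open>- V\<close> is an extended real that might be infinite,
  so a real number strictly between it and 0 is chosen. The estimate is then moved from the measure
  on \<open>A\<close> to the one on \<open>B\<close>.\<close>

lemma ess_inf_pos:
  assumes "ess_inf A V > 0" "A \<in> sets lebesgue" "B \<in> sets lebesgue" 
  obtains \<epsilon> where "0 < \<epsilon>" "AE x in lebesgue_on B. x \<in> A \<longrightarrow> \<epsilon> \<le> V x"
proof -
  define E where "E = esssup (lebesgue_on A) (\<lambda>x. - ereal (V x))"
  have "0 < - E" using assms(1) by (simp add: ess_inf_def E_def)
  then have E: "E < 0" by (cases E) auto
  then obtain e where e: "E < ereal e" "ereal e < 0" using ereal_dense2 by blast
  have "AE x in lebesgue_on A. - ereal (V x) \<le> E" unfolding E_def by (rule esssup_AE)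
  then have "AE x in lebesgue_on A. - e \<le> V x"
  proof eventually_elim
    case (elim x)
    then have "- ereal (V x) \<le> ereal e" using e(1) by (meson less_imp_le order_trans)
    then show ?case by simp
  qed
  then have "AE x in lebesgue. x \<in> A \<longrightarrow> - e \<le> V x" using assms(2) by (simp add: AE_restrict_space_iff)
  then have "AE x in lebesgue_on B. x \<in> A \<longrightarrow> - e \<le> V x"
    using assms(3) by (subst AE_restrict_space_iff) (auto elim: AE_mp)
  moreover have "0 < - e" using e(2) by simp
  ultimately show ?thesis using that by blast
qed

theorem proposition4p1:
  fixes V :: "'a::euclidean_space \<Rightarrow> real" and c :: real
  assumes "DIM('a) \<ge> 2"
    and "\<And>x. x \<in> ball 0 1 \<Longrightarrow> V x \<ge> 0"
    and "V \<in> L_infinity (ball 0 1)"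
    and "0 < c" and "c < 1"
    and "ess_support (ball 0 1) V = closure (ball 0 c)"
    and "\<And>\<delta>. 0 < \<delta> \<Longrightarrow> \<delta> < c \<Longrightarrow> ess_inf (ball 0 \<delta>) V > 0"
  shows "((\<lambda>s. \<bar>ln s\<bar> powi (- int DIM('a) + 1) *
            real (n_plus s (harmonic_L2 (ball 0 1)) (toeplitz (ball 0 1) V)))
          \<longlongrightarrow> 2 powi (- int DIM('a) + 2) / (fact (DIM('a) - 1) * \<bar>ln c\<bar> ^ (DIM('a) - 1)))
         (at_right 0)"
proof -
  obtain m where m: "DIM('a) = Suc m" using assms(1) by (metis Suc_le_D numeral_2_eq_2)
  have Vm: "V \<in> borel_measurable unit_leb" and "esssup unit_leb (\<lambda>x. ereal \<bar>V x\<bar>) < \<infinity>"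
    using assms(3) by (auto simp: L_infinity_def)
  then obtain M0 where M0: "esssup unit_leb (\<lambda>x. ereal \<bar>V x\<bar>) < ereal M0" using ereal_dense2 by blast
  \<comment> \<open>The maximum with 1 secures the positivity of \<open>M\<close> demanded by the
    locale.\<close>
  define M where "M = max M0 1"
  have "AE x in unit_leb. ereal \<bar>V x\<bar> \<le> esssup unit_leb (\<lambda>x. ereal \<bar>V x\<bar>)" by (rule esssup_AE)
  then have VM: "AE x in unit_leb. \<bar>V x\<bar> \<le> M"
  proof eventually_elim
    case (elim x)
    then have "ereal \<bar>V x\<bar> \<le> ereal M0" using M0 by (meson less_imp_le order_trans)
    then show ?case by (simp add: M_def)
  qed
  have V0: "AE x in unit_leb. 0 \<le> V x" using assms(2) by (intro AE_I2) auto
  have "AE x in unit_leb. x \<notin> cball 0 c \<longrightarrow> V x = 0"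
    using AE_outside_ess_support[of "ball 0 1" V] assms(4,6) by simp
  with VM V0 have "AE x in unit_leb. 0 \<le> V x \<and> V x \<le> M * indicator (cball 0 c) x"
    by eventually_elim (auto simp: indicator_def)
  then interpret weighted_bergman V c M
    using Vm assms(4,5) by unfold_locales (auto simp: M_def)
  have pos: "\<exists>\<epsilon>>0. AE x in unit_leb. x \<in> ball 0 \<delta> \<longrightarrow> \<epsilon> \<le> V x" if \<delta>: "0 < \<delta>" "\<delta> < c" for \<delta>
    using ess_inf_pos[OF assms(7)[OF \<delta>], of "ball 0 1"] by auto
  have "((\<lambda>s. real (n_plus s bergman T) / \<bar>ln s\<bar> ^ m) \<longlongrightarrow> 2 * (1 / (2 * \<bar>ln c\<bar>)) ^ m / fact m) (at_right 0)"
    by (rule n_plus_asymptotics[OF m pos])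
  moreover have "\<bar>ln s\<bar> powi (- int DIM('a) + 1) * real (n_plus s bergman T) = real (n_plus s bergman T) / \<bar>ln s\<bar> ^ m" for s
    using m by (simp add: power_int_minus divide_inverse mult.commute)
  moreover have "2 powi (- int DIM('a) + 2) / (fact (DIM('a) - 1) * \<bar>ln c\<bar> ^ (DIM('a) - 1))
      = 2 * (1 / (2 * \<bar>ln c\<bar>)) ^ m / fact m"
  proof -
    have e: "- int DIM('a) + 2 = 1 - int m" using m by simp
    \<comment> \<open>With \<open>m = d - 1\<close>, the factor 2 from the two families of jets
      combines with \<open>(1 / 2) ^ m\<close> from the slope to \<open>2 ^ (2 - d)\<close>.\<close>
    have "2 powi (- int DIM('a) + 2) = (2::real) / 2 ^ m" unfolding e by (simp add: power_int_diff)
    then show ?thesis using m by (simp add: power_divide power_mult_distrib mult_ac)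
  qed
  ultimately show ?thesis by simp
qed

end
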